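(* If $y\in\mathcal{I}_\infty$ and $(p,q)\in \mathrm{Cyc}_{\mathbb{P}}(y)$, then $$x_{(p,q)}\,\hat{\mathfrak{S}}_y=\sum_{z\in\hat\Phi^+(y,q)}\hat{\mathfrak{S}}_z-\sum_{z\in\hat\Phi^-(y,p)}\hat{\mathfrak{S}}_z,$$ where we set $\hat{\mathfrak{S}}_z=0$ for $z\in\mathcal{I}_{\mathbb{Z}}-\mathcal{I}_\infty$.
   Context: $S_{\mathbb{Z}}$ is the group of permutations of $\mathbb{Z}$ fixing all but finitely many integers, $\mathbb{P}=\{1,2,3,\dots\}$, $S_\infty$ is the subgroup of elements with support contained in $\mathbb{P}$, and $S_n\subset S_\infty$ is the subgroup fixing all integers outside $\{1,\dots,n\}$. Products are compositions of functions; $(i,j)$ denotes a transposition and $s_i=(i,i+1)$. $\ell(w)$ is the number of pairs $i<j$ with $w(i)>w(j)$. $\mathcal{I}_{\mathbb{Z}}$, $\mathcal{I}_\infty$ are the sets of $y=y^{-1}$ in $S_{\mathbb{Z}}$, $S_\infty$. The Bruhat order $<$ on $S_{\mathbb{Z}}$ is the weakest strict partial order with $w<wt$ whenever $t$ is a transposition with $\ell(w)<\ell(wt)$. For $y,z\in\mathcal{I}_{\mathbb{Z}}$ write $y\lessdot_{\mathcal{I}}z$ if $\{y\}=\{\sigma\in\mathcal{I}_{\mathbb{Z}}: y\le\sigma<z\}$. Schubert polynomials: $S_\infty$ acts on $\mathbb{Z}[x_1,x_2,\dots]$ by permuting variables; $\partial_i f=(f-s_if)/(x_i-x_{i+1})$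 for $i\in\mathbb{P}$; $\partial_w=\partial_{i_1}\cdots\partial_{i_k}$ for any reduced word $w=s_{i_1}\cdots s_{i_k}$, $k=\ell(w)$. For $v\in S_n$, $\mathfrak{S}_v=\partial_{v^{-1}w_n}(x_1^{n-1}x_2^{n-2}\cdots x_{n-1})$ where $w_n=n\cdots 321$; this is independent of the choice of $n$. Atoms and involution Schubert polynomials: the Demazure product is the unique associative map $\circ:S_{\mathbb{Z}}\times S_{\mathbb{Z}}\to S_{\mathbb{Z}}$ with $u\circ v=uv$ if $\ell(uv)=\ell(u)+\ell(v)$ and $s_i\circ s_i=s_i$. For $y\in\mathcal{I}_{\mathbb{Z}}$, $\mathcal{A}(y)$ is the set of $w\in S_{\mathbb{Z}}$ of minimal length with $y=w^{-1}\circ w$. For $y\in\mathcal{I}_\infty$, $\hat{\mathfrak{S}}_y=\sum_{w\in\mathcal{A}(y)}\mathfrak{S}_w$. The maps $\tau_{ij}$: for $y\in\mathcal{I}_{\mathbb{Z}}$ and $i<j$ let $A=\{i,j,y(i),y(j)\}$. Then $\tau_{ij}(y)$ is the involution $z$ that agrees with $y$ on $\mathbb{Z}\setminus A$ and whose restriction to the $y$-invariant set $A$ is as follows (restrictions are written by their 2-cycles; unlisted elements of $A$ are fixed). (1) $A=\{a<b\}$, $y|_A=1$, $(i,j)=(a,b)$: $z|_A=(a,b)$. (2) $A=\{a<b<c\}$, $y|_A=(a,b)$, $(i,j)\in\{(b,c),(a,c)\}$: $z|_A=(a,c)$. (3) $A=\{a<b<c\}$, $y|_A=(b,c)$, $(i,j)\in\{(a,b),(a,c)\}$: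 $z|_A=(a,c)$. (4) $A=\{a<b<c<d\}$, $y|_A=(a,b)(c,d)$, $(i,j)=(b,c)$: $z|_A=(a,c)(b,d)$. (5) $A=\{a<b<c<d\}$, $y|_A=(a,b)(c,d)$, $(i,j)\in\{(a,c),(b,d),(a,d)\}$: $z|_A=(a,d)$. (6) $A=\{a<b<c<d\}$, $y|_A=(a,c)(b,d)$, $(i,j)\in\{(a,b),(c,d),(a,d)\}$: $z|_A=(a,d)(b,c)$. In all other cases $\tau_{ij}(y)=y$. For $y\in\mathcal{I}_{\mathbb{Z}}$ and $r\in\mathbb{Z}$: $\hat\Phi^+(y,r)=\{z\in\mathcal{I}_{\mathbb{Z}}: y\lessdot_{\mathcal{I}}z$ and $z=\tau_{rj}(y)$ for an integer $j>r\}$, $\hat\Phi^-(y,r)=\{z\in\mathcal{I}_{\mathbb{Z}}: y\lessdot_{\mathcal{I}}z$ and $z=\tau_{ir}(y)$ for an integer $i<r\}$. $\mathrm{Cyc}_{\mathbb{P}}(y)=\{(p,q)\in\mathbb{P}\times\mathbb{P}: p\le q=y(p)\}$; $x_{(p,q)}=x_p+x_q$ if $p\ne q$ and $x_{(p,q)}=x_p$ if $p=q$. *)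

theory Defs
  imports "HOL-Combinatorics.Perm" "HOL-Library.Poly_Mapping"
begin

unbundle permutation_syntax

section \<open>Permutations of the integers\<close>

text \<open>The type \<^typ>\<open>int perm\<close> of bijections of the integers with finite support is the group
  \<open>S\<^sub>\<int>\<close>; its product is composition of functions.\<close>

definition S_infty :: "int perm set" where
  "S_infty = {w. affected w \<subseteq> {1..}}"

definition S_fin :: "nat \<Rightarrow> int perm set" where
  "S_fin n = {w. affected w \<subseteq> {1..int n}}"

definition I_Z :: "int perm set" where
  "I_Z = {y. inverse y = y}"

definition I_infty :: "int perm set" where
  "I_infty = I_Z \<inter> S_infty"

definition sref :: "int \<Rightarrow> int perm" where
  "sref i = \<langle>i \<leftrightarrow> i + 1\<rangle>"

definition len :: "int perm \<Rightarrow> nat" where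
  "len w = card {(i, j). i < j \<and> w \<langle>$\<rangle> i > w \<langle>$\<rangle> j}"

text \<open>A transitive closure is the weakest transitive relation containing its generators; this one is
  automatically irreflexive, since the length strictly increases along it.\<close>

definition bruhat_less :: "int perm \<Rightarrow> int perm \<Rightarrow> bool" where
  "bruhat_less = (\<lambda>w v. \<exists>i j. i \<noteq> j \<and> v = w * \<langle>i \<leftrightarrow> j\<rangle> \<and> len w < len v)\<^sup>+\<^sup>+"

definition bruhat_le :: "int perm \<Rightarrow> int perm \<Rightarrow> bool" where
  "bruhat_le v w \<longleftrightarrow> v = w \<or> bruhat_less v w"

definition inv_covers :: "int perm \<Rightarrow> int perm \<Rightarrow> bool" where
  "inv_covers y z \<longleftrightarrow> y \<in> I_Z \<and> z \<in> I_Z \<and> {y} = {\<sigma> \<in> I_Z. bruhat_le y \<sigma> \<and> bruhat_less \<sigma> z}"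

section \<open>Schubert polynomials\<close>

text \<open>Monomials are exponent vectors with finite support. The variables \<open>x\<^sub>i\<close> are indexed by
  arbitrary integers, so that the ring contains \<open>\<int>[x\<^sub>1, x\<^sub>2, \<dots>]\<close> as a subring and the
  permutation action needs no reindexing; the variables with \<open>i \<le> 0\<close> never occur in the
  polynomials below.\<close>

type_synonym ipoly = "(int \<Rightarrow>\<^sub>0 nat) \<Rightarrow>\<^sub>0 int"

definition xvar :: "int \<Rightarrow> ipoly" where
  "xvar i = Poly_Mapping.single (Poly_Mapping.single i 1) 1"

text \<open>The coefficient of \<open>m\<close> in \<open>w f\<close> is the coefficient of \<open>m \<circ> w\<close> in \<open>f\<close>, which amounts to
  replacing each \<open>x\<^sub>i\<close> by \<open>x\<^bsub>w(i)\<^esub>\<close>; see \<open>act_xvar\<close> below.\<close>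

definition act :: "int perm \<Rightarrow> ipoly \<Rightarrow> ipoly" where
  "act w f = Poly_Mapping.map_key (Poly_Mapping.map_key (apply w)) f"

lemma inj_map_key_apply: "inj (Poly_Mapping.map_key (apply (w :: 'a perm)) :: ('a \<Rightarrow>\<^sub>0 'b::zero) \<Rightarrow> _)"
proof (rule injI)
  fix m n :: "'a \<Rightarrow>\<^sub>0 'b"
  assume "Poly_Mapping.map_key (apply w) m = Poly_Mapping.map_key (apply w) n"
  moreover have "Poly_Mapping.lookup (Poly_Mapping.map_key (apply w) k) i = Poly_Mapping.lookup k (w \<langle>$\<rangle> i)"
    for k :: "'a \<Rightarrow>\<^sub>0 'b" and i
    by (simp add: map_key.rep_eq bij_is_inj)
  ultimately have *: "Poly_Mapping.lookup m (w \<langle>$\<rangle> i) = Poly_Mapping.lookup n (w \<langle>$\<rangle> i)" for i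
    by metis
  show "m = n"
  proof (rule poly_mapping_eqI)
    fix k
    show "Poly_Mapping.lookup m k = Poly_Mapping.lookup n k"
      using *[of "inv (apply w) k"] by (simp add: bij_is_surj surj_f_inv_f)
  qed
qed

lemma map_key_apply_single:
  "Poly_Mapping.map_key (apply w) (Poly_Mapping.single (w \<langle>$\<rangle> i) c) = Poly_Mapping.single i c"
  by (simp add: bij_is_inj)

lemma act_xvar: "act w (xvar i) = xvar (w \<langle>$\<rangle> i)"
  unfolding act_def xvar_def
  by (subst map_key_apply_single[symmetric, of i _ w]) (simp only: map_key_single[OF inj_map_key_apply])

text \<open>As the ring is an integral domain, the quotient is unique whenever it exists.\<close>

definition divdiff :: "int \<Rightarrow> ipoly \<Rightarrow> ipoly" where
  "divdiff i f = (THE g. (xvar i - xvar (i + 1)) * g = f - act (sref i) f)"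

definition reduced_word :: "int list \<Rightarrow> int perm \<Rightarrow> bool" where
  "reduced_word a w \<longleftrightarrow> w = prod_list (map sref a) \<and> length a = len w"

text \<open>The result does not depend on which reduced word is chosen. All reduced words of an element
  of \<^term>\<open>S_infty\<close> have positive letters.\<close>

definition divdiff_perm :: "int perm \<Rightarrow> ipoly \<Rightarrow> ipoly" where
  "divdiff_perm w f = foldr divdiff (SOME a. reduced_word a w) f"

lift_definition longest :: "nat \<Rightarrow> int perm"
  is "\<lambda>n i. if 1 \<le> i \<and> i \<le> int n then int n + 1 - i else i"
proof -
  fix n :: nat
  let ?f = "\<lambda>i. if 1 \<le> i \<and> i \<le> int n then int n + 1 - i else i"
  have "bij ?f"
    by (rule o_bij[where g = ?f]) auto
  moreover have "finite {i. ?f i \<noteq> i}"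
    by (rule finite_subset[of _ "{1..int n}"]) auto
  ultimately show "bij ?f \<and> finite {i. ?f i \<noteq> i}" ..
qed

text \<open>The value for \<open>v \<in> S_fin n\<close> is independent of \<open>n\<close>; we take the smallest possible one.
  Only \<open>v \<in> S_infty\<close> is meaningful.\<close>

definition schubert :: "int perm \<Rightarrow> ipoly" where
  "schubert v = (let n = LEAST n. v \<in> S_fin n in
     divdiff_perm (inverse v * longest n) (\<Prod>i = 1..n. xvar (int i) ^ (n - i)))"

section \<open>Atoms and involution Schubert polynomials\<close>

definition demazure :: "int perm \<Rightarrow> int perm \<Rightarrow> int perm" where
  "demazure = (THE d. (\<forall>u v w. d (d u v) w = d u (d v w)) \<and>
     (\<forall>u v. len (u * v) = len u + len v \<longrightarrow> d u v = u * v) \<and>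
     (\<forall>i. d (sref i) (sref i) = sref i))"

definition atoms :: "int perm \<Rightarrow> int perm set" where
  "atoms y = {w. is_arg_min len (\<lambda>w. y = demazure (inverse w) w) w}"

text \<open>The set \<^term>\<open>atoms y\<close> is finite, as are the index sets \<open>Phi_plus\<close> and \<open>Phi_minus\<close> below,
  so the sums over them are genuine. The value is \<open>0\<close> outside \<^term>\<open>I_infty\<close>, by convention.\<close>

definition inv_schubert :: "int perm \<Rightarrow> ipoly" where
  "inv_schubert y = (if y \<in> I_infty then \<Sum>w\<in>atoms y. schubert w else 0)"

section \<open>The maps \<open>\<tau>\<^sub>i\<^sub>j\<close>\<close>

text \<open>\<open>tau_rule A f (i, j) g\<close> is one line of the defining table: \<open>f\<close> and \<open>g\<close> restrict on
  \<open>A\<close> to \<open>y\<close> and to \<open>z = \<tau>\<^sub>i\<^sub>j(y)\<close>, respectively.\<close>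

inductive tau_rule :: "int set \<Rightarrow> int perm \<Rightarrow> int \<times> int \<Rightarrow> int perm \<Rightarrow> bool" where
  "a < b \<Longrightarrow>
    tau_rule {a, b} 1 (a, b) \<langle>a \<leftrightarrow> b\<rangle>"
| "a < b \<Longrightarrow> b < c \<Longrightarrow> ij \<in> {(b, c), (a, c)} \<Longrightarrow>
    tau_rule {a, b, c} \<langle>a \<leftrightarrow> b\<rangle> ij \<langle>a \<leftrightarrow> c\<rangle>"
| "a < b \<Longrightarrow> b < c \<Longrightarrow> ij \<in> {(a, b), (a, c)} \<Longrightarrow>
    tau_rule {a, b, c} \<langle>b \<leftrightarrow> c\<rangle> ij \<langle>a \<leftrightarrow> c\<rangle>"
| "a < b \<Longrightarrow> b < c \<Longrightarrow> c < d \<Longrightarrow>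
    tau_rule {a, b, c, d} (\<langle>a \<leftrightarrow> b\<rangle> * \<langle>c \<leftrightarrow> d\<rangle>) (b, c) (\<langle>a \<leftrightarrow> c\<rangle> * \<langle>b \<leftrightarrow> d\<rangle>)"
| "a < b \<Longrightarrow> b < c \<Longrightarrow> c < d \<Longrightarrow> ij \<in> {(a, c), (b, d), (a, d)} \<Longrightarrow>
    tau_rule {a, b, c, d} (\<langle>a \<leftrightarrow> b\<rangle> * \<langle>c \<leftrightarrow> d\<rangle>) ij \<langle>a \<leftrightarrow> d\<rangle>"
| "a < b \<Longrightarrow> b < c \<Longrightarrow> c < d \<Longrightarrow> ij \<in> {(a, b), (c, d), (a, d)} \<Longrightarrow>
    tau_rule {a, b, c, d} (\<langle>a \<leftrightarrow> c\<rangle> * \<langle>b \<leftrightarrow> d\<rangle>) ij (\<langle>a \<leftrightarrow> d\<rangle> * \<langle>b \<leftrightarrow> c\<rangle>)"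

definition tau_step :: "int \<Rightarrow> int \<Rightarrow> int perm \<Rightarrow> int perm \<Rightarrow> bool" where
  "tau_step i j y z \<longleftrightarrow> (let A = {i, j, y \<langle>$\<rangle> i, y \<langle>$\<rangle> j} in
     (\<exists>f g. tau_rule A f (i, j) g \<and> (\<forall>k\<in>A. y \<langle>$\<rangle> k = f \<langle>$\<rangle> k \<and> z \<langle>$\<rangle> k = g \<langle>$\<rangle> k)) \<and>
     (\<forall>k. k \<notin> A \<longrightarrow> z \<langle>$\<rangle> k = y \<langle>$\<rangle> k))"

definition tau :: "int \<Rightarrow> int \<Rightarrow> int perm \<Rightarrow> int perm" where
  "tau i j y = (if \<exists>z. tau_step i j y z then THE z. tau_step i j y z else y)"

definition Phi_plus :: "int perm \<Rightarrow> int \<Rightarrow> int perm set" where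
  "Phi_plus y r = {z \<in> I_Z. inv_covers y z \<and> (\<exists>j>r. z = tau r j y)}"

definition Phi_minus :: "int perm \<Rightarrow> int \<Rightarrow> int perm set" where
  "Phi_minus y r = {z \<in> I_Z. inv_covers y z \<and> (\<exists>i<r. z = tau i r y)}"

definition Cyc :: "int perm \<Rightarrow> (int \<times> int) set" where
  "Cyc y = {(p, q). 1 \<le> p \<and> 1 \<le> q \<and> p \<le> q \<and> q = y \<langle>$\<rangle> p}"

definition x_cyc :: "int \<times> int \<Rightarrow> ipoly" where
  "x_cyc = (\<lambda>(p, q). if p \<noteq> q then xvar p + xvar q else xvar p)"

end

theory Submission
  imports Defs
begin

text \<open>
  A polynomial in \<open>x\<^sub>1, x\<^sub>2, \<dots>\<close> without constant term that is killed by all divided differences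
  \<open>\<partial>\<^sub>i\<close> is zero: it is symmetric in infinitely many variables (\<open>eq_0_if_divdiff_0\<close>). The
  transition formula is proved by applying \<open>\<partial>\<^sub>i\<close> to the difference of its two sides, for all \<open>i
  \<ge> 1\<close>, and by induction on \<open>\<ell>(y)\<close>. Three facts make this work.

  First, divided differences act on involution Schubert polynomials as they do on Schubert
  polynomials. Let \<open>up i y\<close> be the Demazure conjugate \<open>s\<^sub>i \<circ> y \<circ> s\<^sub>i\<close> and let \<open>down i\<close> be the
  inverse operation. If \<open>i\<close> is a descent of \<open>y\<close>, then \<open>\<partial>\<^sub>i\<close> takes the polynomial of \<open>y\<close> to the
  polynomial of \<open>down i y\<close>, and otherwise to \<open>0\<close> (\<open>divdiff_inv_schubert\<close>). This reduces to the
  rule \<open>\<partial>\<^sub>i \<SS>\<^sub>w = \<SS>\<^bsub>ws\<^sub>i\<^esub>\<close>, because the atoms of \<open>y\<close> with descent \<open>i\<close> are the products \<open>v s\<^sub>i\<close>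
  for the atoms \<open>v\<close> of \<open>down i y\<close> (\<open>atoms_mult_sref\<close>).

  Second, \<open>up i\<close> and \<open>down i\<close> respect the covers of involutions, by the lifting property of the
  Bruhat order. If \<open>i\<close> is an ascent of \<open>y\<close>, then \<open>up i y\<close> is the only cover of \<open>y\<close> with descent
  \<open>i\<close>. If \<open>i\<close> is a descent of \<open>y\<close>, then \<open>down i\<close> is a bijection from the covers of \<open>y\<close> with
  descent \<open>i\<close> to the covers of \<open>down i y\<close> other than \<open>y\<close> (\<open>inv_covers_down\<close>, \<open>inv_covers_up\<close>).

  Third, signs are preserved. In a cover, two cycles \<open>P\<close> and \<open>N\<close> of \<open>y\<close> exchange partners, so
  that values rise on \<open>P\<close> and fall on \<open>N\<close> (\<open>inv_covers_raises\<close>). Hence the right-hand side of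
  the formula is a single sum over the covers \<open>z\<close> of \<open>y\<close>, weighted by the sign of \<open>z(q) - y(q)\<close>:
  the sets \<^const>\<open>Phi_plus\<close> and \<^const>\<open>Phi_minus\<close> collect the covers with \<open>q \<in> P\<close> and with \<open>q \<in> N\<close>. Under
  \<open>up i\<close> the pair \<open>P\<close>, \<open>N\<close> changes in the same way as the cycles of \<open>y\<close> do (\<open>raises_up_up\<close>).

  Now let \<open>i\<close> be a descent of \<open>y\<close>. By the Leibniz rule, \<open>\<partial>\<^sub>i\<close> turns the left-hand side into the
  left-hand side for \<open>down i y\<close> and the cycle \<open>(s\<^sub>i p, s\<^sub>i q)\<close>, plus \<open>\<partial>\<^sub>i x\<^bsub>(p,q)\<^esub>\<close> times the
  polynomial of \<open>y\<close>. It turns the right-hand side into the right-hand side for \<open>down i y\<close> with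
  the cover \<open>y\<close> omitted, and the weight of this cover is exactly \<open>-\<partial>\<^sub>i x\<^bsub>(p,q)\<^esub>\<close>. If \<open>(p, q) =
  (i, i + 1)\<close>, the formulas for the two fixed points \<open>i\<close> and \<open>i + 1\<close> of \<open>down i y\<close> are added
  instead.
\<close>

section \<open>Descents, length and inversions\<close>

lemma apply_mult [simp]: "(u * v) \<langle>$\<rangle> k = u \<langle>$\<rangle> (v \<langle>$\<rangle> k)"
  by (simp add: apply_times)

lemma apply_inverse_apply [simp]: "inverse w \<langle>$\<rangle> (w \<langle>$\<rangle> k) = k"
  using apply_mult[of "inverse w" w k] by simp

lemma apply_apply_inverse [simp]: "w \<langle>$\<rangle> (inverse w \<langle>$\<rangle> k) = k"
  using apply_mult[of w "inverse w" k] by simp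

lemma apply_swap: "\<langle>a \<leftrightarrow> b\<rangle> \<langle>$\<rangle> k = (if k = a then b else if k = b then a else k)"
  by auto

lemma apply_sref: "sref i \<langle>$\<rangle> k = (if k = i then i + 1 else if k = i + 1 then i else k)"
  by (simp add: sref_def apply_swap)

lemma apply_sref_simps [simp]:
  "sref i \<langle>$\<rangle> i = i + 1" "sref i \<langle>$\<rangle> (i + 1) = i" "sref i \<langle>$\<rangle> (sref i \<langle>$\<rangle> k) = k"
  by (auto simp: apply_sref)

lemma inverse_sref [simp]: "inverse (sref i) = sref i"
  by (simp add: sref_def)

lemma sref_sref [simp]: "sref i * sref i = 1"
  by (simp add: perm_eq_iff)

lemma sref_cancel [simp]: "w * sref i * sref i = w" "sref i * (sref i * w) = w"
  by (simp_all add: perm_eq_iff)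

lemma sref_less_iff:
  "\<not> (k = i \<and> l = i + 1) \<Longrightarrow> \<not> (k = i + 1 \<and> l = i) \<Longrightarrow> sref i \<langle>$\<rangle> k < sref i \<langle>$\<rangle> l \<longleftrightarrow> k < l"
  by (auto simp: apply_sref)

definition descent :: "int \<Rightarrow> int perm \<Rightarrow> bool" where
  "descent i w \<longleftrightarrow> w \<langle>$\<rangle> (i + 1) < w \<langle>$\<rangle> i"

lemma not_descent_iff: "\<not> descent i w \<longleftrightarrow> w \<langle>$\<rangle> i < w \<langle>$\<rangle> (i + 1)"
  using apply_inj[of w i "i + 1"] by (simp add: descent_def) linarith

lemma descent_mult_sref [simp]: "descent i (w * sref i) \<longleftrightarrow> \<not> descent i w"
  by (simp add: not_descent_iff) (simp add: descent_def)

lemma not_descent_one [simp]: "\<not> descent i 1"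
  by (simp add: descent_def)

definition inversions :: "int perm \<Rightarrow> (int \<times> int) set" where
  "inversions w = {(i, j). i < j \<and> w \<langle>$\<rangle> i > w \<langle>$\<rangle> j}"

lemma len_eq: "len w = card (inversions w)"
  by (simp add: len_def inversions_def)

lemma ex_affected_bounds: "\<exists>l u. affected w \<subseteq> {l..u}" for w :: "int perm"
proof (cases "affected w = {}")
  case False
  then have "affected w \<subseteq> {Min (affected w)..Max (affected w)}"
    by auto
  then show ?thesis by blast
qed auto

lemma apply_outside: "affected w \<subseteq> A \<Longrightarrow> k \<notin> A \<Longrightarrow> w \<langle>$\<rangle> k = k"
  by (metis in_affected subsetD)

lemma apply_inside: "affected w \<subseteq> A \<Longrightarrow> k \<in> A \<Longrightarrow> w \<langle>$\<rangle> k \<in> A"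
  by (metis apply_affected in_affected subsetD)

lemma inversions_subset:
  assumes "affected w \<subseteq> {l..u}"
  shows "inversions w \<subseteq> {l..u} \<times> {l..u}"
proof clarify
  fix i j assume "(i, j) \<in> inversions w"
  then have ij: "i < j" "w \<langle>$\<rangle> j < w \<langle>$\<rangle> i" by (auto simp: inversions_def)
  have *: "w \<langle>$\<rangle> k \<in> {l..u}" if "k \<in> {l..u}" for k
    using apply_inside[OF assms that] .
  have **: "w \<langle>$\<rangle> k = k" if "k \<notin> {l..u}" for k
    using apply_outside[OF assms that] .
  show "i \<in> {l..u} \<and> j \<in> {l..u}"
    using ij *[of i] *[of j] **[of i] **[of j]
    by (cases "i \<in> {l..u}"; cases "j \<in> {l..u}") auto
qed

lemma finite_inversions [simp]: "finite (inversions w)"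
proof -
  obtain l u where "affected w \<subseteq> {l..u}" using ex_affected_bounds by blast
  then show ?thesis by (rule finite_subset[OF inversions_subset]) simp
qed

lemma len_one [simp]: "len 1 = 0"
proof -
  have "inversions 1 = {}" by (auto simp: inversions_def)
  then show ?thesis by (simp add: len_eq)
qed

lemma len_inverse [simp]: "len (inverse w) = len w"
proof -
  have "inversions (inverse w) = (\<lambda>(i, j). (w \<langle>$\<rangle> j, w \<langle>$\<rangle> i)) ` inversions w"
  proof safe
    fix a b assume "(a, b) \<in> inversions (inverse w)"
    then show "(a, b) \<in> (\<lambda>(i, j). (w \<langle>$\<rangle> j, w \<langle>$\<rangle> i)) ` inversions w"
      by (intro image_eqI[where x = "(inverse w \<langle>$\<rangle> b, inverse w \<langle>$\<rangle> a)"])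
        (auto simp: inversions_def)
  qed (auto simp: inversions_def)
  moreover have "inj_on (\<lambda>(i, j). (w \<langle>$\<rangle> j, w \<langle>$\<rangle> i)) (inversions w)"
    by (auto simp: inj_on_def apply_inj)
  ultimately show ?thesis
    by (simp add: len_eq card_image)
qed

lemma len_mult_sref_ascent:
  assumes "\<not> descent i w"
  shows "len (w * sref i) = Suc (len w)"
proof -
  let ?s = "\<lambda>(k, l). (sref i \<langle>$\<rangle> k, sref i \<langle>$\<rangle> l)"
  have asc: "w \<langle>$\<rangle> i < w \<langle>$\<rangle> (i + 1)" using assms by (simp add: not_descent_iff)
  have less: "sref i \<langle>$\<rangle> k < sref i \<langle>$\<rangle> l" if "k < l" "(k, l) \<noteq> (i, i + 1)" for k l
    using that sref_less_iff[of k i l] by auto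
  have "inversions (w * sref i) = insert (i, i + 1) (?s ` inversions w)"
  proof (intro set_eqI iffI; clarify)
    fix k l assume kl: "(k, l) \<in> inversions (w * sref i)" "(k, l) \<notin> ?s ` inversions w"
    show "k = i \<and> l = i + 1"
    proof (rule ccontr)
      assume "\<not> ?thesis"
      then have "?s (k, l) \<in> inversions w"
        using kl(1) less[of k l] by (auto simp: inversions_def)
      then have "?s (?s (k, l)) \<in> ?s ` inversions w" by (rule imageI)
      then show False using kl(2) by simp
    qed
  next
    fix k l assume "(k, l) \<in> insert (i, i + 1) (?s ` inversions w)"
    then consider "k = i" "l = i + 1" | "(sref i \<langle>$\<rangle> k, sref i \<langle>$\<rangle> l) \<in> inversions w" by auto
    then show "(k, l) \<in> inversions (w * sref i)"
    proof cases
      case 2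
      then have "sref i \<langle>$\<rangle> k < sref i \<langle>$\<rangle> l" "(sref i \<langle>$\<rangle> k, sref i \<langle>$\<rangle> l) \<noteq> (i, i + 1)"
        using asc by (auto simp: inversions_def)
      then show ?thesis using less[of "sref i \<langle>$\<rangle> k" "sref i \<langle>$\<rangle> l"] 2 by (auto simp: inversions_def)
    qed (use asc in \<open>auto simp: inversions_def\<close>)
  qed
  moreover have "(i, i + 1) \<notin> ?s ` inversions w"
    by (auto simp: inversions_def apply_sref split: if_splits)
  moreover have "inj_on ?s (inversions w)"
    by (auto simp: inj_on_def apply_inj)
  ultimately show ?thesis
    by (simp add: len_eq card_image)
qed

lemma len_mult_sref_descent:
  assumes "descent i w"
  shows "Suc (len (w * sref i)) = len w"
  using len_mult_sref_ascent[of i "w * sref i"] assms by simp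

lemma len_le_mult_sref: "len w \<le> Suc (len (w * sref i))"
  using len_mult_sref_ascent[of i w] len_mult_sref_descent[of i w] by (cases "descent i w") auto

lemma len_sref_mult_ascent: "\<not> descent i (inverse w) \<Longrightarrow> len (sref i * w) = Suc (len w)"
  using len_mult_sref_ascent[of i "inverse w"] len_inverse[of "sref i * w"]
  by (simp add: perm.inverse_distrib_swap)

lemma len_sref_mult_descent: "descent i (inverse w) \<Longrightarrow> Suc (len (sref i * w)) = len w"
  using len_mult_sref_descent[of i "inverse w"] len_inverse[of "sref i * w"]
  by (simp add: perm.inverse_distrib_swap)

text \<open>An increasing bijection of the integers is a translation, so finite support leaves only the
  identity.\<close>

lemma ex_descent:
  assumes "w \<noteq> 1"
  shows "\<exists>i. descent i w"
proof (rule ccontr)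
  assume "\<not> ?thesis"
  then have asc: "w \<langle>$\<rangle> i < w \<langle>$\<rangle> (i + 1)" for i by (simp add: not_descent_iff)
  obtain l u where lu: "affected w \<subseteq> {l..u}" using ex_affected_bounds by blast
  have "w \<langle>$\<rangle> (u + 1 - int n) \<le> u + 1 - int n" for n
  proof (induction n)
    case 0
    then show ?case using apply_outside[OF lu, of "u + 1"] by simp
  next
    case (Suc n)
    then show ?case using asc[of "u + 1 - int (Suc n)"] by (simp add: algebra_simps)
  qed
  then have le: "w \<langle>$\<rangle> k \<le> k" if "k \<le> u" for k
    using that spec[of "\<lambda>n. w \<langle>$\<rangle> (u + 1 - int n) \<le> u + 1 - int n" "nat (u + 1 - k)"] by simp
  have "w \<langle>$\<rangle> (l - 1 + int n) \<ge> l - 1 + int n" for n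
  proof (induction n)
    case 0
    then show ?case using apply_outside[OF lu, of "l - 1"] by simp
  next
    case (Suc n)
    then show ?case using asc[of "l - 1 + int n"] by (simp add: algebra_simps)
  qed
  then have ge: "w \<langle>$\<rangle> k \<ge> k" if "k \<ge> l" for k
    using that spec[of "\<lambda>n. w \<langle>$\<rangle> (l - 1 + int n) \<ge> l - 1 + int n" "nat (k + 1 - l)"] by simp
  have "w \<langle>$\<rangle> k = k" for k
    using le[of k] ge[of k] apply_outside[OF lu, of k] by (cases "k \<in> {l..u}") force+
  then show False using assms by (simp add: perm_eq_iff)
qed

lemma len_eq_0_iff [simp]: "len w = 0 \<longleftrightarrow> w = 1"
  by (metis ex_descent len_mult_sref_descent len_one nat.distinct(1))

text \<open>Moving one endpoint of a reflection inwards by an adjacent transposition reduces the general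
  case to \<open>len_mult_sref_ascent\<close>.\<close>

lemma len_less_mult_swap:
  assumes "a < b" and "w \<langle>$\<rangle> a < w \<langle>$\<rangle> b"
  shows "len w < len (w * \<langle>a \<leftrightarrow> b\<rangle>)"
  using assms
proof (induction "nat (b - a)" arbitrary: b w rule: less_induct)
  case (less b w)
  show ?case
  proof (cases "b = a + 1")
    case True
    then show ?thesis
      using less.prems len_mult_sref_ascent[of a w] by (simp add: not_descent_iff sref_def)
  next
    case False
    define s where "s = sref (b - 1)"
    let ?t = "\<langle>a \<leftrightarrow> b - 1\<rangle>"
    have "len (w * s) < len (w * s * ?t)"
      unfolding s_def using False less.prems by (intro less.hyps) (auto simp: apply_sref)
    moreover have eq: "w * \<langle>a \<leftrightarrow> b\<rangle> = w * s * ?t * s"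
      using False less.prems by (auto simp: perm_eq_iff s_def apply_sref apply_swap)
    moreover have "len (w * \<langle>a \<leftrightarrow> b\<rangle>) = Suc (len (w * s * ?t))" if "descent (b - 1) w"
    proof -
      have "(w * s * ?t) \<langle>$\<rangle> (b - 1) = w \<langle>$\<rangle> a" "(w * s * ?t) \<langle>$\<rangle> b = w \<langle>$\<rangle> (b - 1)"
        using False less.prems(1) by (simp_all add: s_def apply_swap apply_sref)
      moreover have "w \<langle>$\<rangle> a < w \<langle>$\<rangle> (b - 1)"
        using that less.prems(2) by (simp add: descent_def)
      ultimately have "\<not> descent (b - 1) (w * s * ?t)"
        by (simp only: not_descent_iff diff_add_cancel)
      then show ?thesis unfolding eq s_def by (rule len_mult_sref_ascent)
    qed
    moreover have "len (w * s * ?t) \<le> Suc (len (w * \<langle>a \<leftrightarrow> b\<rangle>))"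
      unfolding eq s_def by (rule len_le_mult_sref)
    moreover have "Suc (len (w * s)) = len w" if "descent (b - 1) w"
      unfolding s_def by (rule len_mult_sref_descent[OF that])
    moreover have "len (w * s) = Suc (len w)" if "\<not> descent (b - 1) w"
      unfolding s_def by (rule len_mult_sref_ascent[OF that])
    ultimately show ?thesis
      by (cases "descent (b - 1) w") linarith+
  qed
qed

section \<open>Bruhat order\<close>

text \<open>The generating relation of the Bruhat order, phrased through two values instead of two
  lengths: a condition that can be checked pointwise and is visibly compatible with translation
  by \<open>s\<^sub>i\<close>.\<close>

definition bruhat_step :: "int perm \<Rightarrow> int perm \<Rightarrow> bool" where
  "bruhat_step u v \<longleftrightarrow> (\<exists>a b. a < b \<and> u \<langle>$\<rangle> a < u \<langle>$\<rangle> b \<and> v = u * \<langle>a \<leftrightarrow> b\<rangle>)"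

lemma bruhat_stepI:
  "a < b \<Longrightarrow> u \<langle>$\<rangle> a < u \<langle>$\<rangle> b \<Longrightarrow> v = u * \<langle>a \<leftrightarrow> b\<rangle> \<Longrightarrow> bruhat_step u v"
  by (auto simp: bruhat_step_def)

lemma swap_commute: "\<langle>a \<leftrightarrow> b\<rangle> = \<langle>b \<leftrightarrow> a\<rangle>"
  by (auto simp: perm_eq_iff apply_swap)

lemma bruhat_step_iff:
  "bruhat_step u v \<longleftrightarrow> (\<exists>i j. i \<noteq> j \<and> v = u * \<langle>i \<leftrightarrow> j\<rangle> \<and> len u < len v)"
proof
  assume "\<exists>i j. i \<noteq> j \<and> v = u * \<langle>i \<leftrightarrow> j\<rangle> \<and> len u < len v"
  then obtain i j where "i \<noteq> j" and v: "v = u * \<langle>i \<leftrightarrow> j\<rangle>" and len: "len u < len v" by blast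
  then obtain a b where ab: "a < b" "v = u * \<langle>a \<leftrightarrow> b\<rangle>"
    using that[of i j] that[of j i] swap_commute[of i j] by (cases "i < j") auto
  have "u \<langle>$\<rangle> a < u \<langle>$\<rangle> b"
  proof (rule ccontr)
    assume "\<not> ?thesis"
    then have "u \<langle>$\<rangle> b < u \<langle>$\<rangle> a" using ab(1) apply_inj[of u a b] by linarith
    then have "len v < len (v * \<langle>a \<leftrightarrow> b\<rangle>)" using ab by (intro len_less_mult_swap) auto
    moreover have "v * \<langle>a \<leftrightarrow> b\<rangle> = u" by (simp add: ab(2) perm_eq_iff apply_swap)
    ultimately show False using len by simp
  qed
  then show "bruhat_step u v" using ab by (auto simp: bruhat_step_def)
next
  assume "bruhat_step u v"
  then show "\<exists>i j. i \<noteq> j \<and> v = u * \<langle>i \<leftrightarrow> j\<rangle> \<and> len u < len v"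
    unfolding bruhat_step_def by (metis len_less_mult_swap less_irrefl)
qed

lemma bruhat_less_eq: "bruhat_less = bruhat_step\<^sup>+\<^sup>+"
  unfolding bruhat_less_def by (intro arg_cong[where f = tranclp] ext) (simp add: bruhat_step_iff)

lemma bruhat_le_eq: "bruhat_le u v \<longleftrightarrow> bruhat_step\<^sup>*\<^sup>* u v"
  unfolding bruhat_le_def bruhat_less_eq by (meson Nitpick.rtranclp_unfold)

lemma bruhat_le_refl [simp]: "bruhat_le u u"
  by (simp add: bruhat_le_def)

lemma bruhat_le_trans: "bruhat_le u v \<Longrightarrow> bruhat_le v w \<Longrightarrow> bruhat_le u w"
  unfolding bruhat_le_eq by simp

lemma bruhat_less_imp_len_less: "bruhat_less u v \<Longrightarrow> len u < len v"
  unfolding bruhat_less_eq by (induction rule: tranclp_induct) (auto simp: bruhat_step_iff)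

lemma bruhat_less_iff: "bruhat_less u v \<longleftrightarrow> bruhat_le u v \<and> u \<noteq> v"
  using bruhat_less_imp_len_less by (auto simp: bruhat_le_def)

lemma bruhat_le_antisym: "bruhat_le u v \<Longrightarrow> bruhat_le v u \<Longrightarrow> u = v"
  unfolding bruhat_le_def using bruhat_less_imp_len_less by (metis less_asym)

lemma bruhat_step_imp_le: "bruhat_step u v \<Longrightarrow> bruhat_le u v"
  by (simp add: bruhat_le_eq)

lemma bruhat_step_inverse:
  assumes "bruhat_step u v"
  shows "bruhat_step (inverse u) (inverse v)"
proof -
  obtain a b where ab: "a < b" "u \<langle>$\<rangle> a < u \<langle>$\<rangle> b" and v: "v = u * \<langle>a \<leftrightarrow> b\<rangle>"
    using assms by (auto simp: bruhat_step_def)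
  have "inverse v = inverse u * \<langle>u \<langle>$\<rangle> a \<leftrightarrow> u \<langle>$\<rangle> b\<rangle>"
    by (auto simp: v perm.inverse_distrib_swap perm_eq_iff apply_swap)
  then show ?thesis using ab by (intro bruhat_stepI) auto
qed

lemma bruhat_le_inverse: "bruhat_le u v \<Longrightarrow> bruhat_le (inverse u) (inverse v)"
  unfolding bruhat_le_eq
  by (induction rule: rtranclp_induct) (auto intro: rtranclp.rtrancl_into_rtrancl bruhat_step_inverse)

lemma bruhat_step_mult_sref: "\<not> descent i w \<Longrightarrow> bruhat_step w (w * sref i)"
  by (rule bruhat_stepI[of i "i + 1"]) (auto simp: not_descent_iff sref_def)

text \<open>Right translation by \<open>s\<^sub>i\<close> replaces the reflection \<open>t\<close> by \<open>s\<^sub>i t s\<^sub>i\<close> and moves the two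
  compared values to new positions. Their order is kept unless \<open>t = s\<^sub>i\<close>.\<close>

lemma bruhat_step_translate:
  assumes "bruhat_step u v"
  shows "v = u * sref i \<or> bruhat_step (u * sref i) (v * sref i)"
proof -
  obtain a b where ab: "a < b" "u \<langle>$\<rangle> a < u \<langle>$\<rangle> b" and v: "v = u * \<langle>a \<leftrightarrow> b\<rangle>"
    using assms by (auto simp: bruhat_step_def)
  show ?thesis
  proof (cases "a = i \<and> b = i + 1")
    case False
    have "v * sref i = u * sref i * \<langle>sref i \<langle>$\<rangle> a \<leftrightarrow> sref i \<langle>$\<rangle> b\<rangle>"
      unfolding v by (simp add: perm_eq_iff) (auto simp: apply_sref apply_swap)
    moreover have "sref i \<langle>$\<rangle> a < sref i \<langle>$\<rangle> b"
      using ab(1) False sref_less_iff[of a i b] by auto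
    ultimately show ?thesis
      using ab(2) unfolding bruhat_step_def
      by (intro disjI2 exI[of _ "sref i \<langle>$\<rangle> a"] exI[of _ "sref i \<langle>$\<rangle> b"]) simp
  qed (simp add: v sref_def)
qed

text \<open>The lifting property. Translating a chain from \<open>u\<close> to \<open>w\<close> by \<open>s\<close> gives a chain from \<open>us\<close> to
  \<open>ws\<close>, unless one of its steps is multiplication by \<open>s\<close> itself; such a step meets the translated
  chain and the original one.\<close>

lemma bruhat_lift_descent:
  assumes "bruhat_le u w" and "descent i w"
  shows "bruhat_le (u * sref i) w"
  using assms(1)[unfolded bruhat_le_eq]
proof (induction rule: converse_rtranclp_induct)
  case base
  then show ?case
    using bruhat_step_mult_sref[of i "w * sref i"] assms(2) by (simp add: bruhat_step_imp_le)
next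
  case (step u v)
  then show ?case
    using bruhat_step_translate[OF step(1), of i] bruhat_step_imp_le bruhat_le_trans bruhat_le_eq
    by metis
qed

lemma bruhat_lift_ascent:
  assumes "bruhat_le u w" and "\<not> descent i u"
  shows "bruhat_le u (w * sref i)"
  using assms(1)[unfolded bruhat_le_eq]
proof (induction rule: rtranclp_induct)
  case base
  then show ?case
    using bruhat_step_mult_sref[of i u] assms(2) by (simp add: bruhat_step_imp_le)
next
  case (step v w)
  then show ?case
    using bruhat_step_translate[OF step(2), of i] bruhat_step_imp_le bruhat_le_trans bruhat_le_eq
    by (metis sref_cancel(1))
qed

lemma bruhat_lift_descent_left:
  assumes "bruhat_le u w" and "descent i (inverse w)"
  shows "bruhat_le (sref i * u) w"
  using bruhat_le_inverse[OF bruhat_lift_descent[OF bruhat_le_inverse[OF assms(1)] assms(2)]]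
  by (simp add: perm.inverse_distrib_swap)

lemma bruhat_lift_ascent_left:
  assumes "bruhat_le u w" and "\<not> descent i (inverse u)"
  shows "bruhat_le u (sref i * w)"
  using bruhat_le_inverse[OF bruhat_lift_ascent[OF bruhat_le_inverse[OF assms(1)] assms(2)]]
  by (simp add: perm.inverse_distrib_swap)

section \<open>Covers of involutions\<close>

lemma I_Z_apply [simp]: "y \<in> I_Z \<Longrightarrow> y \<langle>$\<rangle> (y \<langle>$\<rangle> k) = k"
  using apply_inverse_apply[of y k] by (simp add: I_Z_def)

lemma I_Z_iff: "y \<in> I_Z \<longleftrightarrow> (\<forall>k. y \<langle>$\<rangle> (y \<langle>$\<rangle> k) = k)"
proof
  assume "\<forall>k. y \<langle>$\<rangle> (y \<langle>$\<rangle> k) = k"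
  then have "y * y = 1" by (simp add: perm_eq_iff)
  then have "inverse y = y" by (rule perm.inverse_unique)
  then show "y \<in> I_Z" by (simp add: I_Z_def)
qed simp

lemma I_Z_inverse: "y \<in> I_Z \<Longrightarrow> inverse y = y"
  by (simp add: I_Z_def)

lemma I_Z_eq_swap:
  assumes "y \<in> I_Z"
  shows "y \<langle>$\<rangle> a = b \<longleftrightarrow> y \<langle>$\<rangle> b = a"
  using I_Z_apply[OF assms, of a] I_Z_apply[OF assms, of b] by metis

lemma one_in_I_Z [simp]: "1 \<in> I_Z"
  by (simp add: I_Z_iff)

text \<open>\<open>up i y\<close> is the Demazure conjugate of \<open>y\<close> by \<open>s\<^sub>i\<close> (\<open>demazure_conj_eq_up\<close> below), and
  \<open>down i\<close> undoes it on the involutions with descent \<open>i\<close> (\<open>down_up\<close>, \<open>up_down\<close>). These are the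
  two moves on involutions that correspond to \<open>w \<mapsto> w s\<^sub>i\<close> on permutations.\<close>

definition up :: "int \<Rightarrow> int perm \<Rightarrow> int perm" where
  "up i y = (if descent i y then y
     else if y \<langle>$\<rangle> i = i \<and> y \<langle>$\<rangle> (i + 1) = i + 1 then y * sref i
     else sref i * y * sref i)"

definition down :: "int \<Rightarrow> int perm \<Rightarrow> int perm" where
  "down i y = (if \<not> descent i y then y
     else if y \<langle>$\<rangle> i = i + 1 then y * sref i
     else sref i * y * sref i)"

lemma descent_conj_sref:
  assumes "y \<in> I_Z" and "\<not> (y \<langle>$\<rangle> i = i + 1)" and "\<not> (y \<langle>$\<rangle> i = i \<and> y \<langle>$\<rangle> (i + 1) = i + 1)"
  shows "descent i (sref i * y * sref i) \<longleftrightarrow> \<not> descent i y"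
proof -
  have "\<not> (y \<langle>$\<rangle> (i + 1) = i)" using assms(1,2) I_Z_eq_swap by blast
  then show ?thesis
    using assms(2,3) sref_less_iff[of "y \<langle>$\<rangle> i" i "y \<langle>$\<rangle> (i + 1)"] apply_inj[of y i "i + 1"]
    by (auto simp: descent_def not_descent_iff)
qed

lemma up_descent [simp]: "descent i y \<Longrightarrow> up i y = y"
  by (simp add: up_def)

lemma down_ascent [simp]: "\<not> descent i y \<Longrightarrow> down i y = y"
  by (simp add: down_def)

lemma sref_conj_I_Z: "y \<in> I_Z \<Longrightarrow> sref i * y * sref i \<in> I_Z"
  by (simp add: I_Z_iff)

lemma mult_sref_I_Z:
  assumes "y \<in> I_Z" and "y \<langle>$\<rangle> i = i \<and> y \<langle>$\<rangle> (i + 1) = i + 1 \<or> y \<langle>$\<rangle> i = i + 1"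
  shows "y * sref i \<in> I_Z"
  unfolding I_Z_iff
proof
  fix k
  have inv: "y \<langle>$\<rangle> (y \<langle>$\<rangle> l) = l" for l using assms(1) by simp
  have "y \<langle>$\<rangle> (i + 1) = i" if "y \<langle>$\<rangle> i = i + 1" using inv[of i] that by simp
  then show "(y * sref i) \<langle>$\<rangle> ((y * sref i) \<langle>$\<rangle> k) = k"
    using assms(2) inv[of k] apply_inj[of y k i] apply_inj[of y k "i + 1"]
    by (cases "k = i"; cases "k = i + 1") (auto simp: apply_sref)
qed

lemma up_I_Z [simp]: "y \<in> I_Z \<Longrightarrow> up i y \<in> I_Z"
  by (simp add: up_def sref_conj_I_Z mult_sref_I_Z)

lemma down_I_Z [simp]: "y \<in> I_Z \<Longrightarrow> down i y \<in> I_Z"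
  by (simp add: down_def sref_conj_I_Z mult_sref_I_Z)

lemma I_Z_cycle_descent: "y \<in> I_Z \<Longrightarrow> y \<langle>$\<rangle> i = i + 1 \<Longrightarrow> descent i y"
  using I_Z_eq_swap[of y i "i + 1"] by (simp add: descent_def)

lemma descent_up [simp]:
  assumes "y \<in> I_Z"
  shows "descent i (up i y)"
  using descent_conj_sref[OF assms, of i] I_Z_cycle_descent[OF assms, of i] by (auto simp: up_def)

lemma fixed_ascent: "y \<langle>$\<rangle> i = i \<Longrightarrow> y \<langle>$\<rangle> (i + 1) = i + 1 \<Longrightarrow> \<not> descent i y"
  by (simp add: not_descent_iff)

lemma not_descent_down [simp]:
  assumes "y \<in> I_Z"
  shows "\<not> descent i (down i y)"
  using descent_conj_sref[OF assms, of i] fixed_ascent[of y i] by (auto simp: down_def)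

lemma conj_sref_cancel [simp]: "sref i * (sref i * y * sref i) * sref i = y"
  by (simp add: perm_eq_iff)

lemma down_up [simp]:
  assumes "y \<in> I_Z" and "\<not> descent i y"
  shows "down i (up i y) = y"
proof (cases "y \<langle>$\<rangle> i = i \<and> y \<langle>$\<rangle> (i + 1) = i + 1")
  case True
  then show ?thesis using assms(2) by (simp add: up_def down_def)
next
  case False
  have "(sref i * y * sref i) \<langle>$\<rangle> i \<noteq> i + 1"
  proof
    assume "(sref i * y * sref i) \<langle>$\<rangle> i = i + 1"
    then have "sref i \<langle>$\<rangle> (y \<langle>$\<rangle> (i + 1)) = sref i \<langle>$\<rangle> i" by simp
    then have "y \<langle>$\<rangle> (i + 1) = i" by (simp only: apply_inj)
    then show False using I_Z_cycle_descent I_Z_eq_swap assms by blast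
  qed
  then show ?thesis
    using descent_up[OF assms(1), of i] False assms(2) unfolding up_def down_def by simp
qed

lemma up_down [simp]:
  assumes "y \<in> I_Z" and "descent i y"
  shows "up i (down i y) = y"
proof (cases "y \<langle>$\<rangle> i = i + 1")
  case True
  then have "y \<langle>$\<rangle> (i + 1) = i" using assms(1) I_Z_eq_swap by blast
  then show ?thesis using assms True by (simp add: up_def down_def)
next
  case False
  have "\<not> (sref i \<langle>$\<rangle> (y \<langle>$\<rangle> (i + 1)) = i \<and> sref i \<langle>$\<rangle> (y \<langle>$\<rangle> i) = i + 1)"
  proof
    assume "sref i \<langle>$\<rangle> (y \<langle>$\<rangle> (i + 1)) = i \<and> sref i \<langle>$\<rangle> (y \<langle>$\<rangle> i) = i + 1"
    then have "y \<langle>$\<rangle> i = i \<and> y \<langle>$\<rangle> (i + 1) = i + 1"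
      by (metis apply_sref_simps)
    then show False using assms(2) fixed_ascent by blast
  qed
  moreover have down: "down i y = sref i * y * sref i"
    using False assms(2) by (simp add: down_def)
  moreover have "\<not> descent i (sref i * y * sref i)"
    using not_descent_down[OF assms(1), of i] unfolding down .
  ultimately show ?thesis
    by (auto simp add: up_def simp del: descent_mult_sref)
qed

text \<open>The lifting property for involutions is the one for permutations, applied on the right and
  then on the left; a descent of an involution is a descent on both sides.\<close>

lemma up_bruhat_lift:
  assumes "y \<in> I_Z" "z \<in> I_Z" "bruhat_le y z" "descent i z"
  shows "bruhat_le (up i y) z"
proof -
  have 1: "bruhat_le (y * sref i) z" by (rule bruhat_lift_descent[OF assms(3,4)])
  moreover have "bruhat_le (sref i * (y * sref i)) z"
    using bruhat_lift_descent_left[OF 1] assms(2,4) by (simp add: I_Z_inverse)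
  ultimately show ?thesis using assms(3) by (simp add: up_def mult.assoc)
qed

lemma down_bruhat_lift:
  assumes "y \<in> I_Z" "z \<in> I_Z" "bruhat_le y z" "\<not> descent i y"
  shows "bruhat_le y (down i z)"
proof -
  have 1: "bruhat_le y (z * sref i)" by (rule bruhat_lift_ascent[OF assms(3,4)])
  moreover have "bruhat_le y (sref i * (z * sref i))"
    using bruhat_lift_ascent_left[OF 1] assms(1,4) by (simp add: I_Z_inverse)
  ultimately show ?thesis using assms(3) by (simp add: down_def mult.assoc)
qed

lemma bruhat_le_up:
  assumes "y \<in> I_Z"
  shows "bruhat_le y (up i y)"
proof (cases "descent i y")
  case False
  have 1: "bruhat_le y (y * sref i)"
    by (rule bruhat_step_imp_le[OF bruhat_step_mult_sref[OF False]])
  moreover have "bruhat_le y (sref i * (y * sref i))"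
    using bruhat_lift_ascent_left[OF 1] False assms by (simp add: I_Z_inverse)
  ultimately show ?thesis by (simp add: up_def mult.assoc)
qed simp

lemma bruhat_le_down:
  assumes "y \<in> I_Z"
  shows "bruhat_le (down i y) y"
  using bruhat_le_up[of "down i y" i] assms by (cases "descent i y") auto

lemma up_mono:
  assumes "y \<in> I_Z" "z \<in> I_Z" "bruhat_le y z"
  shows "bruhat_le (up i y) (up i z)"
  using assms by (intro up_bruhat_lift) (auto intro: bruhat_le_trans bruhat_le_up)

lemma down_mono:
  assumes "y \<in> I_Z" "z \<in> I_Z" "bruhat_le y z"
  shows "bruhat_le (down i y) (down i z)"
  using assms by (intro down_bruhat_lift) (auto intro: bruhat_le_trans bruhat_le_down)

lemma down_neq: "y \<in> I_Z \<Longrightarrow> descent i y \<Longrightarrow> down i y \<noteq> y"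
  by (metis not_descent_down)

lemma up_neq: "y \<in> I_Z \<Longrightarrow> \<not> descent i y \<Longrightarrow> up i y \<noteq> y"
  by (metis descent_up)

lemma inv_covers_iff:
  "inv_covers y z \<longleftrightarrow> y \<in> I_Z \<and> z \<in> I_Z \<and> bruhat_le y z \<and> y \<noteq> z \<and>
     (\<forall>\<sigma>\<in>I_Z. bruhat_le y \<sigma> \<longrightarrow> bruhat_le \<sigma> z \<longrightarrow> \<sigma> = y \<or> \<sigma> = z)"
  unfolding inv_covers_def bruhat_less_iff by auto

lemma inv_coversD:
  assumes "inv_covers y z"
  shows "y \<in> I_Z" "z \<in> I_Z" "bruhat_le y z" "y \<noteq> z"
    and "\<And>\<sigma>. \<sigma> \<in> I_Z \<Longrightarrow> bruhat_le y \<sigma> \<Longrightarrow> bruhat_le \<sigma> z \<Longrightarrow> \<sigma> = y \<or> \<sigma> = z"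
  using assms unfolding inv_covers_iff by auto

text \<open>By lifting, \<open>down i z\<close> lies between \<open>y\<close> and \<open>z\<close>.\<close>

lemma inv_covers_ascent_descent:
  assumes "inv_covers y z" "\<not> descent i y" "descent i z"
  shows "z = up i y"
proof -
  note c = inv_coversD[OF assms(1)]
  have "down i z = y \<or> down i z = z"
    using c assms(2) by (intro c(5)) (auto intro: down_bruhat_lift bruhat_le_down)
  then show ?thesis using c(2) assms(3) down_neq up_down by metis
qed

text \<open>An involution between \<open>down i y\<close> and \<open>down i z\<close> is carried by \<open>up i\<close> into the interval
  from \<open>y\<close> to \<open>z\<close>. So \<open>down i\<close> maps the covers of \<open>y\<close> with descent \<open>i\<close> to covers of \<open>down i y\<close>;
  \<open>inv_covers_up\<close> shows that only \<open>y\<close> itself is missed.\<close>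

lemma inv_covers_down:
  assumes "inv_covers y z" "descent i y" "descent i z"
  shows "inv_covers (down i y) (down i z)"
  unfolding inv_covers_iff
proof (intro conjI ballI impI)
  note c = inv_coversD[OF assms(1)]
  show "down i y \<noteq> down i z" using c assms(2,3) by (metis up_down)
  show "bruhat_le (down i y) (down i z)" using c by (intro down_mono)
  fix \<sigma> assume s: "\<sigma> \<in> I_Z" "bruhat_le (down i y) \<sigma>" "bruhat_le \<sigma> (down i z)"
  have "bruhat_le y (up i \<sigma>)" using up_mono[OF _ s(1,2), of i] c(1) assms(2) by simp
  moreover have "bruhat_le (up i \<sigma>) z" using up_mono[OF s(1) _ s(3), of i] c(2) assms(3) by simp
  ultimately have "up i \<sigma> = y \<or> up i \<sigma> = z" using s(1) by (intro c(5)) auto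
  \<comment> \<open>Here \<open>down i z\<close> would lie strictly between \<open>y\<close> and \<open>z\<close>, as it has no descent \<open>i\<close>.\<close>
  moreover have False if "descent i \<sigma>"
  proof -
    have "bruhat_le y \<sigma>" using \<open>bruhat_le y (up i \<sigma>)\<close> that by simp
    then have "bruhat_le y (down i z)" using s(3) bruhat_le_trans by blast
    then have "down i z = y \<or> down i z = z" using c by (intro c(5)) (auto intro: bruhat_le_down)
    then show False using assms(2,3) c(2) by (metis not_descent_down)
  qed
  ultimately show "\<sigma> = down i y \<or> \<sigma> = down i z" using s(1) by (metis down_up)
qed (use inv_coversD[OF assms(1)] in auto)

lemma inv_covers_ascent:
  assumes "inv_covers y z" "\<not> descent i y" "z \<noteq> up i y"
  shows "\<not> descent i z"
  using inv_covers_ascent_descent[OF assms(1,2)] assms(3) by blast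

text \<open>The converse of \<open>inv_covers_down\<close>. The exception \<open>z = up i y\<close> is needed because \<open>up i\<close>
  sends both ends of that cover to the same involution.\<close>

lemma inv_covers_up:
  assumes "inv_covers y z" "\<not> descent i y" "z \<noteq> up i y"
  shows "inv_covers (up i y) (up i z)"
  unfolding inv_covers_iff
proof (intro conjI ballI impI)
  note c = inv_coversD[OF assms(1)]
  have asc: "\<not> descent i z" by (rule inv_covers_ascent[OF assms])
  show "up i y \<noteq> up i z" using c assms(2) asc by (metis down_up)
  show "bruhat_le (up i y) (up i z)" using c by (intro up_mono)
  fix \<sigma> assume s: "\<sigma> \<in> I_Z" "bruhat_le (up i y) \<sigma>" "bruhat_le \<sigma> (up i z)"
  have y_le: "bruhat_le y (down i \<sigma>)" using down_mono[OF _ s(1,2), of i] c(1) assms(2) by simp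
  have le_z: "bruhat_le (down i \<sigma>) z" using down_mono[OF s(1) _ s(3), of i] c(2) asc by simp
  have "down i \<sigma> = y \<or> down i \<sigma> = z" using s(1) y_le le_z by (intro c(5)) auto
  \<comment> \<open>Here \<open>up i y\<close> would lie strictly between \<open>y\<close> and \<open>z\<close>.\<close>
  moreover have False if "\<not> descent i \<sigma>"
  proof -
    have "bruhat_le \<sigma> z" using le_z that by simp
    then have "bruhat_le (up i y) z" using s(2) bruhat_le_trans by blast
    then have "up i y = y \<or> up i y = z" using c by (intro c(5)) (auto intro: bruhat_le_up)
    then show False using assms(2,3) c(1) by (metis descent_up)
  qed
  ultimately show "\<sigma> = up i y \<or> \<sigma> = up i z" using s(1) by (metis up_down)
qed (use inv_coversD[OF assms(1)] in auto)

lemma len_down_less: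
  assumes "y \<in> I_Z" "descent i y"
  shows "len (down i y) < len y"
  using bruhat_le_down[OF assms(1), of i] down_neq[OF assms] bruhat_less_imp_len_less
  by (auto simp: bruhat_le_def)

section \<open>Classification of the covers\<close>

text \<open>The shape of a cover: two cycles \<open>P\<close> and \<open>N\<close> of \<open>y\<close> exchange partners so that the values
  rise on \<open>P\<close> and fall on \<open>N\<close>. The six lines in the table of \<open>\<tau>\<^sub>i\<^sub>j\<close> collapse to three rules,
  because \<open>a = b\<close> or \<open>c = d\<close> is admitted in the first one: the transposition \<open>(a, d)\<close> replaces
  two disjoint cycles, fixed points included. The other two rules pass from disjoint to crossing
  and from crossing to nested pairs. Keeping \<open>P\<close> and \<open>N\<close> as parameters makes it possible to
  follow the signs in the transition formula through the maps \<open>up i\<close>.\<close>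

inductive raises :: "int perm \<Rightarrow> int perm \<Rightarrow> int set \<Rightarrow> int set \<Rightarrow> bool" for y z where
  nested: "a \<le> b \<Longrightarrow> b < c \<Longrightarrow> c \<le> d \<Longrightarrow> y \<langle>$\<rangle> a = b \<Longrightarrow> y \<langle>$\<rangle> c = d \<Longrightarrow>
    z \<langle>$\<rangle> a = d \<Longrightarrow> (a \<noteq> b \<Longrightarrow> z \<langle>$\<rangle> b = b) \<Longrightarrow> (c \<noteq> d \<Longrightarrow> z \<langle>$\<rangle> c = c) \<Longrightarrow>
    (\<And>k. k \<notin> {a, b, c, d} \<Longrightarrow> z \<langle>$\<rangle> k = y \<langle>$\<rangle> k) \<Longrightarrow> raises y z {a, b} {c, d}"
| crossing: "a < b \<Longrightarrow> b < c \<Longrightarrow> c < d \<Longrightarrow> y \<langle>$\<rangle> a = b \<Longrightarrow> y \<langle>$\<rangle> c = d \<Longrightarrow>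
    z \<langle>$\<rangle> a = c \<Longrightarrow> z \<langle>$\<rangle> b = d \<Longrightarrow>
    (\<And>k. k \<notin> {a, b, c, d} \<Longrightarrow> z \<langle>$\<rangle> k = y \<langle>$\<rangle> k) \<Longrightarrow> raises y z {a, b} {c, d}"
| uncrossing: "a < b \<Longrightarrow> b < c \<Longrightarrow> c < d \<Longrightarrow> y \<langle>$\<rangle> a = c \<Longrightarrow> y \<langle>$\<rangle> b = d \<Longrightarrow>
    z \<langle>$\<rangle> a = d \<Longrightarrow> z \<langle>$\<rangle> b = c \<Longrightarrow>
    (\<And>k. k \<notin> {a, b, c, d} \<Longrightarrow> z \<langle>$\<rangle> k = y \<langle>$\<rangle> k) \<Longrightarrow> raises y z {a, c} {b, d}"

lemma I_Z_sym: "y \<in> I_Z \<Longrightarrow> y \<langle>$\<rangle> a = b \<Longrightarrow> y \<langle>$\<rangle> b = a"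
  using I_Z_eq_swap by blast

text \<open>When \<open>i\<close> is an ascent, Demazure conjugation by \<open>s\<^sub>i\<close> raises the values on the cycle of \<open>i\<close>
  and lowers them on the cycle of \<open>i + 1\<close>. Which rule of \<open>raises\<close> applies depends on the side of
  \<open>i\<close> and \<open>i + 1\<close> on which their partners lie.\<close>

lemma raises_up:
  assumes y: "y \<in> I_Z" and asc: "\<not> descent i y"
  shows "raises y (up i y) {i, y \<langle>$\<rangle> i} {i + 1, y \<langle>$\<rangle> (i + 1)}"
proof -
  define u v where "u = y \<langle>$\<rangle> i" and "v = y \<langle>$\<rangle> (i + 1)"
  have uv: "y \<langle>$\<rangle> i = u" "y \<langle>$\<rangle> u = i" "y \<langle>$\<rangle> (i + 1) = v" "y \<langle>$\<rangle> v = i + 1"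
    using y by (simp_all add: u_def v_def)
  have "u < v" using asc by (simp add: not_descent_iff u_def v_def)
  have "u \<noteq> i + 1" using I_Z_cycle_descent[OF y, of i] asc uv by blast
  then have "v \<noteq> i" using uv by auto
  have z: "up i y = (if u = i \<and> v = i + 1 then y * sref i else sref i * y * sref i)"
    using asc by (simp add: up_def uv)
  have inj: "y \<langle>$\<rangle> k = i \<longleftrightarrow> k = u" "y \<langle>$\<rangle> k = i + 1 \<longleftrightarrow> k = v" for k
    using uv I_Z_eq_swap[OF y, of k] by auto
  have zo: "up i y \<langle>$\<rangle> k = y \<langle>$\<rangle> k" if "k \<notin> {i, i + 1, u, v}" for k
    using that inj[of k] by (simp add: z apply_sref)
  have zi: "up i y \<langle>$\<rangle> i = (if u = i \<and> v = i + 1 then i + 1 else if v = i + 1 then i else v)"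
    using \<open>v \<noteq> i\<close> uv by (simp add: z apply_sref)
  have zj: "up i y \<langle>$\<rangle> (i + 1) = (if u = i \<and> v = i + 1 then i else if u = i then i + 1 else u)"
    using \<open>u \<noteq> i + 1\<close> uv by (simp add: z apply_sref)
  have zu: "up i y \<langle>$\<rangle> u = i + 1" if "u \<noteq> i"
    using that \<open>u \<noteq> i + 1\<close> \<open>u < v\<close> uv by (simp add: z apply_sref)
  have zv: "up i y \<langle>$\<rangle> v = i" if "v \<noteq> i + 1"
    using that \<open>v \<noteq> i\<close> \<open>u < v\<close> uv by (simp add: z apply_sref)
  consider "u \<le> i" "i + 1 \<le> v" "u = i \<or> v = i + 1" | "u < i" "i + 1 < v"
    | "v < i" | "i + 1 < u"
    using \<open>u < v\<close> \<open>u \<noteq> i + 1\<close> \<open>v \<noteq> i\<close> by linarith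
  then have "raises y (up i y) {i, u} {i + 1, v}"
  proof cases
    case 1
    have "up i y \<langle>$\<rangle> u = v" using 1(3) zi zu by (cases "u = i") auto
    moreover have "up i y \<langle>$\<rangle> i = i" if "u \<noteq> i" using that 1(3) zi by simp
    moreover have "up i y \<langle>$\<rangle> (i + 1) = i + 1" if "v \<noteq> i + 1" using that 1(3) zj by simp
    ultimately have "raises y (up i y) {u, i} {i + 1, v}"
      using 1 uv zo by (intro nested) simp_all
    then show ?thesis by (simp add: insert_commute)
  next
    case 2
    then have "raises y (up i y) {u, i} {i + 1, v}"
      using uv zi zu zo by (intro crossing) simp_all
    then show ?thesis by (simp add: insert_commute)
  next
    case 3
    then have "raises y (up i y) {u, i} {v, i + 1}"
      using \<open>u < v\<close> uv zu zv zo by (intro uncrossing) simp_all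
    then show ?thesis by (simp add: insert_commute)
  next
    case 4
    then show ?thesis
      using \<open>u < v\<close> uv zi zj zo by (intro uncrossing) simp_all
  qed
  then show ?thesis by (simp only: u_def v_def)
qed

lemma raises_moved:
  assumes "raises y z P N" "y \<in> I_Z" "k \<in> P \<union> N"
  shows "y \<langle>$\<rangle> k \<noteq> k \<or> z \<langle>$\<rangle> k \<noteq> k"
  using assms(1)
proof (cases rule: raises.cases)
  case (nested a b c d)
  have "y \<langle>$\<rangle> b = a" "y \<langle>$\<rangle> d = c" using nested I_Z_sym[OF assms(2)] by blast+
  moreover have "k = a \<or> k = b \<or> k = c \<or> k = d" using nested(1,2) assms(3) by blast
  ultimately show ?thesis using nested(3-10) apply_inj[of z a d]
    by (elim disjE; cases "a = b"; cases "c = d") simp_all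
next
  case (crossing a b c d)
  have "y \<langle>$\<rangle> b = a" "y \<langle>$\<rangle> d = c" using crossing I_Z_sym[OF assms(2)] by blast+
  moreover have "k = a \<or> k = b \<or> k = c \<or> k = d" using crossing(1,2) assms(3) by blast
  ultimately show ?thesis using crossing(3-9) by (elim disjE) simp_all
next
  case (uncrossing a b c d)
  have "y \<langle>$\<rangle> c = a" "y \<langle>$\<rangle> d = b" using uncrossing I_Z_sym[OF assms(2)] by blast+
  moreover have "k = a \<or> k = b \<or> k = c \<or> k = d" using uncrossing(1,2) assms(3) by blast
  ultimately show ?thesis using uncrossing(3-9) by (elim disjE) simp_all
qed

lemma raises_outside: "raises y z P N \<Longrightarrow> k \<notin> P \<union> N \<Longrightarrow> z \<langle>$\<rangle> k = y \<langle>$\<rangle> k"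
  by (cases rule: raises.cases) auto

text \<open>Conjugation by \<open>s\<^sub>i\<close> relabels the points. The rules of \<open>raises\<close> only see the relative
  order of the points of \<open>P \<union> N\<close>, which changes only if both \<open>i\<close> and \<open>i + 1\<close> are among them.\<close>

lemma raises_conj:
  assumes "raises y z P N" and not_both: "\<not> (i \<in> P \<union> N \<and> i + 1 \<in> P \<union> N)"
  shows "raises (sref i * y * sref i) (sref i * z * sref i) (apply (sref i) ` P) (apply (sref i) ` N)"
proof -
  let ?s = "apply (sref i)"
  have less: "?s k < ?s l" if "k < l" "k \<in> P \<union> N" "l \<in> P \<union> N" for k l
    using that not_both sref_less_iff[of k i l] by auto
  have le: "?s k \<le> ?s l" if "k \<le> l" "k \<in> P \<union> N" "l \<in> P \<union> N" for k l
    using less[of k l] that by (cases "k = l") auto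
  have out: "(sref i * z * sref i) \<langle>$\<rangle> k = (sref i * y * sref i) \<langle>$\<rangle> k"
    if "k \<notin> ?s ` (P \<union> N)" for k
  proof -
    have "?s k \<notin> P \<union> N" using that imageI[of "?s k" "P \<union> N" ?s] by (simp only: apply_sref_simps) blast
    then show ?thesis using raises_outside[OF assms(1), of "?s k"] by simp
  qed
  show ?thesis
    using assms(1)
  proof (cases rule: raises.cases)
    case (nested a b c d)
    have "raises (sref i * y * sref i) (sref i * z * sref i) {?s a, ?s b} {?s c, ?s d}"
      using nested less[of b c] le[of a b] le[of c d] out
      by (intro raises.nested) (simp_all add: apply_inj)
    then show ?thesis using nested by simp
  next
    case (crossing a b c d)
    have "raises (sref i * y * sref i) (sref i * z * sref i) {?s a, ?s b} {?s c, ?s d}"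
      using crossing less[of a b] less[of b c] less[of c d] out
      by (intro raises.crossing) simp_all
    then show ?thesis using crossing by simp
  next
    case (uncrossing a b c d)
    have "raises (sref i * y * sref i) (sref i * z * sref i) {?s a, ?s c} {?s b, ?s d}"
      using uncrossing less[of a b] less[of b c] less[of c d] out
      by (intro raises.uncrossing) simp_all
    then show ?thesis using uncrossing by simp
  qed
qed

text \<open>An explicit chain of reflections. It serves to rule out pairs \<open>y\<close>, \<open>z\<close> of the first shape
  for which some involution lies strictly in between.\<close>

lemma bruhat_le_nested:
  assumes y: "y \<in> I_Z" and z: "z \<in> I_Z"
    and ord: "a \<le> b" "b < c" "c \<le> d"
    and vals: "y \<langle>$\<rangle> a = b" "y \<langle>$\<rangle> c = d" "z \<langle>$\<rangle> a = d" "a \<noteq> b \<Longrightarrow> z \<langle>$\<rangle> b = b" "c \<noteq> d \<Longrightarrow> z \<langle>$\<rangle> c = c"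
    and out: "\<And>k. k \<notin> {a, b, c, d} \<Longrightarrow> z \<langle>$\<rangle> k = y \<langle>$\<rangle> k"
  shows "bruhat_le y z"
proof -
  have vals': "y \<langle>$\<rangle> b = a" "y \<langle>$\<rangle> d = c" "z \<langle>$\<rangle> d = a"
    using vals y z I_Z_sym by blast+
  define u1 where "u1 = y * \<langle>a \<leftrightarrow> c\<rangle>"
  define u2 where "u2 = (if a < b then u1 * \<langle>b \<leftrightarrow> c\<rangle> else u1)"
  have "bruhat_le y u1"
    unfolding u1_def using ord vals
    by (intro bruhat_step_imp_le bruhat_stepI[of a c]) auto
  moreover have "bruhat_le u1 u2"
  proof (cases "a < b")
    case True
    have "bruhat_le u1 (u1 * \<langle>b \<leftrightarrow> c\<rangle>)"
      using ord vals vals' True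
      by (intro bruhat_step_imp_le bruhat_stepI[of b c]) (auto simp: u1_def apply_swap)
    then show ?thesis using True by (simp add: u2_def)
  qed (simp add: u2_def)
  moreover have "bruhat_le u2 (u2 * \<langle>c \<leftrightarrow> d\<rangle>)"
  proof (cases "c < d")
    case True
    then show ?thesis
      using ord vals vals'
      by (intro bruhat_step_imp_le bruhat_stepI[of c d]) (auto simp: u1_def u2_def apply_swap)
  qed (use ord in simp)
  moreover have "u2 * \<langle>c \<leftrightarrow> d\<rangle> = z"
  proof (rule perm_eqI)
    fix k
    have neq: "a \<noteq> c" "a \<noteq> d" "b \<noteq> c" "b \<noteq> d" using ord by auto
    consider "k = a" | "k = b" "a \<noteq> b" | "k = c" "c \<noteq> d" | "k = d" | "k \<notin> {a, b, c, d}" by blast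
    then show "(u2 * \<langle>c \<leftrightarrow> d\<rangle>) \<langle>$\<rangle> k = z \<langle>$\<rangle> k"
    proof cases
      case 5
      then show ?thesis using out[of k] by (simp add: u1_def u2_def apply_swap)
    qed (use neq ord(1) vals vals' in \<open>simp_all add: u1_def u2_def apply_swap\<close>)
  qed
  ultimately show ?thesis using bruhat_le_trans by metis
qed

lemma up_fixed: "y \<langle>$\<rangle> i = i \<Longrightarrow> y \<langle>$\<rangle> (i + 1) = i + 1 \<Longrightarrow> up i y = y * sref i"
  using fixed_ascent[of y i] by (simp add: up_def)

lemma up_conj:
  "\<not> descent i y \<Longrightarrow> \<not> (y \<langle>$\<rangle> i = i \<and> y \<langle>$\<rangle> (i + 1) = i + 1) \<Longrightarrow> up i y = sref i * y * sref i"
  unfolding up_def by (simp only: if_False)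

text \<open>The effect of \<open>up i\<close> on a cycle \<open>P\<close> of \<open>y\<close>. If \<open>i\<close> and \<open>i + 1\<close> are fixed points of \<open>y\<close>,
  they merge into one cycle of \<open>up i y\<close>; otherwise cycles are just relabelled.\<close>

definition up_cycle :: "int \<Rightarrow> int perm \<Rightarrow> int set \<Rightarrow> int set" where
  "up_cycle i y P = (if y \<langle>$\<rangle> i = i \<and> y \<langle>$\<rangle> (i + 1) = i + 1
     then if P \<inter> {i, i + 1} = {} then P else {i, i + 1}
     else apply (sref i) ` P)"

lemma raises_mult_sref:
  assumes r: "raises y z P N" and "i \<notin> P \<union> N" "i + 1 \<notin> P \<union> N"
  shows "raises (y * sref i) (z * sref i) P N"
proof -
  have s_id: "sref i \<langle>$\<rangle> k = k" if "k \<in> P \<union> N" for k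
    using that assms(2,3) by (cases "k = i"; cases "k = i + 1") (simp_all add: apply_sref)
  have out: "(z * sref i) \<langle>$\<rangle> k = (y * sref i) \<langle>$\<rangle> k" if "k \<notin> P \<union> N" for k
  proof -
    have "sref i \<langle>$\<rangle> k \<notin> P \<union> N" using that assms(2,3) by (simp add: apply_sref)
    then show ?thesis using raises_outside[OF r, of "sref i \<langle>$\<rangle> k"] by simp
  qed
  show ?thesis
    using r
  proof (cases rule: raises.cases)
    case (nested a b c d)
    have "sref i \<langle>$\<rangle> a = a" "sref i \<langle>$\<rangle> b = b" "sref i \<langle>$\<rangle> c = c" "sref i \<langle>$\<rangle> d = d"
      using nested(1,2) by (simp_all add: s_id)
    then show ?thesis unfolding nested(1,2) using nested out by (intro raises.nested) simp_all
  next
    case (crossing a b c d)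
    have "sref i \<langle>$\<rangle> a = a" "sref i \<langle>$\<rangle> b = b" "sref i \<langle>$\<rangle> c = c" "sref i \<langle>$\<rangle> d = d"
      using crossing(1,2) by (simp_all add: s_id)
    then show ?thesis unfolding crossing(1,2) using crossing out by (intro raises.crossing) simp_all
  next
    case (uncrossing a b c d)
    have "sref i \<langle>$\<rangle> a = a" "sref i \<langle>$\<rangle> b = b" "sref i \<langle>$\<rangle> c = c" "sref i \<langle>$\<rangle> d = d"
      using uncrossing(1,2) by (simp_all add: s_id)
    then show ?thesis unfolding uncrossing(1,2) using uncrossing out by (intro raises.uncrossing) simp_all
  qed
qed

text \<open>Here \<open>up i y\<close> gains the cycle \<open>(i, i + 1)\<close>. If \<open>P\<close> or \<open>N\<close> is one of the fixed points \<open>i\<close>,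
  \<open>i + 1\<close>, then \<open>z\<close> moves it and gets conjugated instead, which leaves the other fixed point in
  the place where the first rule of \<open>raises\<close> wants it. Two of the four positions contradict the
  ascent of \<open>z\<close>.\<close>

lemma raises_up_fixed:
  assumes y: "y \<in> I_Z" and z: "z \<in> I_Z" and r: "raises y z P N"
    and fixed: "y \<langle>$\<rangle> i = i" "y \<langle>$\<rangle> (i + 1) = i + 1" and asc: "\<not> descent i z"
  shows "raises (up i y) (up i z) (up_cycle i y P) (up_cycle i y N)"
proof (cases "i \<notin> P \<union> N \<and> i + 1 \<notin> P \<union> N")
  case True
  have "P \<inter> {i, i + 1} = {}" "N \<inter> {i, i + 1} = {}" using True by auto
  moreover have "z \<langle>$\<rangle> i = i" "z \<langle>$\<rangle> (i + 1) = i + 1"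
    using True raises_outside[OF r] fixed by auto
  ultimately show ?thesis
    using raises_mult_sref[OF r] True fixed by (simp add: up_fixed up_cycle_def)
next
  case False
  then have i: "i \<in> P \<union> N \<or> i + 1 \<in> P \<union> N" by blast
  have z_less: "z \<langle>$\<rangle> i < z \<langle>$\<rangle> (i + 1)" using asc by (simp add: not_descent_iff)
  have zfix: "\<not> (z \<langle>$\<rangle> i = i \<and> z \<langle>$\<rangle> (i + 1) = i + 1)"
    using raises_moved[OF r y] i fixed by blast
  have upz: "up i z = sref i * z * sref i" by (rule up_conj[OF asc zfix])
  have upy: "up i y = y * sref i" using fixed by (rule up_fixed)
  have out: "up i z \<langle>$\<rangle> k = up i y \<langle>$\<rangle> k" if "k \<notin> P \<union> N" "k \<noteq> i" "k \<noteq> i + 1" for k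
  proof -
    have "y \<langle>$\<rangle> k \<noteq> i" "y \<langle>$\<rangle> k \<noteq> i + 1"
      using that fixed I_Z_eq_swap[OF y, of k i] I_Z_eq_swap[OF y, of k "i + 1"] by simp_all
    then show ?thesis
      using that raises_outside[OF r, of k] by (simp add: upy upz apply_sref)
  qed
  show ?thesis
    using r
  proof (cases rule: raises.cases)
    case (nested a b c d)
    have vals: "y \<langle>$\<rangle> b = a" "y \<langle>$\<rangle> d = c" "z \<langle>$\<rangle> d = a"
      using nested y z I_Z_sym by blast+
    have key: "a = b \<and> k = a \<or> c = d \<and> k = c" if "k \<in> {a, b, c, d}" "y \<langle>$\<rangle> k = k" for k
      using that nested(6,7) vals by (elim insertE) simp_all
    have cyc: "up_cycle i y P = (if P \<inter> {i, i + 1} = {} then P else {i, i + 1})" for P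
      using fixed by (simp add: up_cycle_def)
    have PN: "P \<union> N = {a, b, c, d}" using nested(1,2) by auto
    have ex: "i \<in> {a, b, c, d} \<or> i + 1 \<in> {a, b, c, d}" using i PN by simp
    consider "a = i" "b = i" | "a = i + 1" "b = i + 1" | "c = i" "d = i" | "c = i + 1" "d = i + 1"
      using ex key[of i] key[of "i + 1"] fixed by metis
    then show ?thesis
    proof cases
      case 1
      have "z \<langle>$\<rangle> (i + 1) \<le> i + 1"
      proof (cases "i + 1 \<in> {a, b, c, d}")
        case True
        then have "d = i + 1" using key[of "i + 1"] fixed 1 by simp
        then show ?thesis using vals(3) 1 by simp
      next
        case False
        then show ?thesis using nested(11)[of "i + 1"] fixed by simp
      qed
      moreover have "z \<langle>$\<rangle> i > i" using nested(4,5,8) 1 by simp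
      ultimately have False using z_less by linarith
      then show ?thesis ..
    next
      case 2
      have notin: "i \<notin> {a, b, c, d}" using 2 nested(4,5) by simp
      then have zi: "z \<langle>$\<rangle> i = i" using nested(11)[of i] fixed by simp
      have cd: "c \<noteq> i" "c \<noteq> i + 1" "d \<noteq> i" "d \<noteq> i + 1" using 2 nested(4,5) by simp_all
      have "raises (up i y) (up i z) {i, i + 1} {c, d}"
      proof (rule raises.nested)
        show "up i z \<langle>$\<rangle> k = up i y \<langle>$\<rangle> k" if "k \<notin> {i, i + 1, c, d}" for k
          using that out[of k] PN 2 by simp
        show "c \<noteq> d \<Longrightarrow> up i z \<langle>$\<rangle> c = c" using nested(10) cd by (simp add: upz apply_sref)
        show "up i y \<langle>$\<rangle> c = d" using nested(7) cd by (simp add: upy apply_sref)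
        show "up i z \<langle>$\<rangle> i = d" using nested(8) 2 cd by (simp add: upz apply_sref)
      qed (use nested(4,5) 2 zi fixed in \<open>simp_all add: upy upz\<close>)
      moreover have "up_cycle i y P = {i, i + 1}" "up_cycle i y N = {c, d}"
        unfolding cyc nested(1,2) using 2 cd by auto
      ultimately show ?thesis by simp
    next
      case 3
      have notin: "i + 1 \<notin> {a, b, c, d}" using 3 nested(3,4) by simp
      then have zi: "z \<langle>$\<rangle> (i + 1) = i + 1" using nested(11)[of "i + 1"] fixed by simp
      have ab: "a \<noteq> i" "a \<noteq> i + 1" "b \<noteq> i" "b \<noteq> i + 1" using 3 nested(3,4) by simp_all
      have "raises (up i y) (up i z) {a, b} {i, i + 1}"
      proof (rule raises.nested)
        show "up i z \<langle>$\<rangle> k = up i y \<langle>$\<rangle> k" if "k \<notin> {a, b, i, i + 1}" for k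
          using that out[of k] PN 3 by simp
        show "a \<noteq> b \<Longrightarrow> up i z \<langle>$\<rangle> b = b" using nested(9) ab by (simp add: upz apply_sref)
        show "up i y \<langle>$\<rangle> a = b" using nested(6) ab by (simp add: upy apply_sref)
        show "up i z \<langle>$\<rangle> a = i + 1" using nested(8) 3 ab by (simp add: upz apply_sref)
      qed (use nested(3,4) 3 zi fixed in \<open>simp_all add: upy upz\<close>)
      moreover have "up_cycle i y P = {a, b}" "up_cycle i y N = {i, i + 1}"
        unfolding cyc nested(1,2) using 3 ab by auto
      ultimately show ?thesis by simp
    next
      case 4
      have "z \<langle>$\<rangle> i \<ge> i"
      proof (cases "i \<in> {a, b, c, d}")
        case True
        then have "a = i" using key[of i] fixed 4 by simp
        then show ?thesis using nested(8) 4 by simp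
      next
        case False
        then show ?thesis using nested(11)[of i] fixed by simp
      qed
      moreover have "z \<langle>$\<rangle> (i + 1) < i + 1" using nested(3,4) vals(3) 4 by simp
      ultimately have False using z_less by linarith
      then show ?thesis ..
    qed
  next
    case (crossing a b c d)
    have "y \<langle>$\<rangle> b = a" "y \<langle>$\<rangle> d = c" using crossing I_Z_sym[OF y] by blast+
    then have "y \<langle>$\<rangle> k \<noteq> k" if "k \<in> {a, b, c, d}" for k
      using that crossing(3-7) by (elim insertE) simp_all
    then show ?thesis using i fixed unfolding crossing(1,2) by blast
  next
    case (uncrossing a b c d)
    have "y \<langle>$\<rangle> c = a" "y \<langle>$\<rangle> d = b" using uncrossing I_Z_sym[OF y] by blast+
    then have "y \<langle>$\<rangle> k \<noteq> k" if "k \<in> {a, b, c, d}" for k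
      using that uncrossing(3-7) by (elim insertE) simp_all
    then show ?thesis using i fixed unfolding uncrossing(1,2) by blast
  qed
qed

lemma adjacent_among_four:
  fixes a b c d i :: int
  assumes "a \<le> b" "b < c" "c \<le> d" "i \<in> {a, b, c, d}" "i + 1 \<in> {a, b, c, d}"
  shows "i = a \<and> i + 1 = b \<or> i = b \<and> i + 1 = c \<or> i = c \<and> i + 1 = d"
  using assms by simp presburger

text \<open>In each rule of \<open>raises\<close>, neighbouring points of \<open>P \<union> N\<close> give a descent of \<open>y\<close> or of \<open>z\<close>,
  except for two points that \<open>z\<close> fixes.\<close>

lemma raises_ascent_not_both:
  assumes y: "y \<in> I_Z" and z: "z \<in> I_Z" and r: "raises y z P N"
    and "\<not> descent i y" "\<not> descent i z" and zfix: "\<not> (z \<langle>$\<rangle> i = i \<and> z \<langle>$\<rangle> (i + 1) = i + 1)"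
  shows "\<not> (i \<in> P \<union> N \<and> i + 1 \<in> P \<union> N)"
proof
  assume both: "i \<in> P \<union> N \<and> i + 1 \<in> P \<union> N"
  have less: "y \<langle>$\<rangle> i < y \<langle>$\<rangle> (i + 1)" "z \<langle>$\<rangle> i < z \<langle>$\<rangle> (i + 1)"
    using assms by (simp_all add: not_descent_iff)
  show False
    using r
  proof (cases rule: raises.cases)
    case (nested a b c d)
    have vals: "y \<langle>$\<rangle> b = a" "y \<langle>$\<rangle> d = c" "z \<langle>$\<rangle> d = a"
      using nested y z I_Z_sym by blast+
    consider "i = a" "i + 1 = b" | "i = b" "i + 1 = c" | "i = c" "i + 1 = d"
      using adjacent_among_four[OF nested(3-5), of i] both unfolding nested(1,2) by blast
    then show False
    proof cases
      case 1
      then show False using less(1) nested(3,6) vals by simp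
    next
      case 2
      then show False
        using less(2) zfix nested(3-5,8-10) vals by (cases "a = b"; cases "c = d") simp_all
    next
      case 3
      then show False using less(1) nested(5,7) vals by simp
    qed
  next
    case (crossing a b c d)
    have vals: "y \<langle>$\<rangle> b = a" "y \<langle>$\<rangle> d = c" "z \<langle>$\<rangle> c = a" "z \<langle>$\<rangle> d = b"
      using crossing y z I_Z_sym by blast+
    consider "i = a" "i + 1 = b" | "i = b" "i + 1 = c" | "i = c" "i + 1 = d"
      using adjacent_among_four[of a b c d i] crossing(3-5) both unfolding crossing(1,2) by force
    then show False using less crossing(3-9) vals by cases simp_all
  next
    case (uncrossing a b c d)
    have vals: "y \<langle>$\<rangle> c = a" "y \<langle>$\<rangle> d = b" "z \<langle>$\<rangle> d = a" "z \<langle>$\<rangle> c = b"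
      using uncrossing y z I_Z_sym by blast+
    consider "i = a" "i + 1 = b" | "i = b" "i + 1 = c" | "i = c" "i + 1 = d"
      using adjacent_among_four[of a b c d i] uncrossing(3-5) both unfolding uncrossing(1,2) by force
    then show False using less uncrossing(3-9) vals by cases simp_all
  qed
qed

text \<open>The remaining case: \<open>z\<close> fixes \<open>i\<close> and \<open>i + 1\<close> but \<open>y\<close> does not, so \<open>y\<close> is conjugated while
  \<open>z\<close> is multiplied by \<open>s\<^sub>i\<close>. If both points lie on the two exchanged cycles of \<open>y\<close>, these cross
  in \<open>up i y\<close>, and an instance of \<open>nested\<close> becomes one of \<open>uncrossing\<close>. If only one of them
  does, \<open>up i y\<close> lies strictly between \<open>y\<close> and \<open>z\<close>; it is here that covering is used, and not
  just the shape of the pair.\<close>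

lemma raises_up_fixes_created:
  assumes r: "raises y z P N" and cov: "inv_covers y z"
    and asc: "\<not> descent i y" and neq: "z \<noteq> up i y"
    and yfix: "\<not> (y \<langle>$\<rangle> i = i \<and> y \<langle>$\<rangle> (i + 1) = i + 1)"
    and zfix: "z \<langle>$\<rangle> i = i" "z \<langle>$\<rangle> (i + 1) = i + 1"
  shows "raises (up i y) (up i z) (apply (sref i) ` P) (apply (sref i) ` N)"
proof -
  note c = inv_coversD[OF cov]
  have less: "y \<langle>$\<rangle> i < y \<langle>$\<rangle> (i + 1)" using asc by (simp add: not_descent_iff)
  have upy: "up i y = sref i * y * sref i" by (rule up_conj[OF asc yfix])
  have upz: "up i z = z * sref i" by (rule up_fixed[OF zfix])
  have no_between: False if "bruhat_le (up i y) z"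
    using c(5)[of "up i y"] that c(1) bruhat_le_up up_neq asc neq by auto
  have i: "i \<in> P \<union> N \<or> i + 1 \<in> P \<union> N"
  proof (rule ccontr)
    assume "\<not> ?thesis"
    then have "z \<langle>$\<rangle> i = y \<langle>$\<rangle> i" "z \<langle>$\<rangle> (i + 1) = y \<langle>$\<rangle> (i + 1)"
      using raises_outside[OF r] by blast+
    then show False using yfix zfix by simp
  qed
  have z_neq: "z \<langle>$\<rangle> k \<noteq> i" "z \<langle>$\<rangle> k \<noteq> i + 1" if "k \<noteq> i" "k \<noteq> i + 1" for k
    using that zfix I_Z_eq_swap[OF c(2), of k] by simp_all
  show ?thesis
    using r
  proof (cases rule: raises.cases)
    case (nested a b c' d)
    note ord = nested(3-5)
    have vals: "y \<langle>$\<rangle> b = a" "y \<langle>$\<rangle> d = c'" "z \<langle>$\<rangle> d = a"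
      using nested c(1,2) I_Z_sym by blast+
    have PN: "P \<union> N = {a, b, c', d}" using nested(1,2) by auto
    have ends: "k \<noteq> a" "k \<noteq> d" if "z \<langle>$\<rangle> k = k" for k
      using that nested(8) vals(3) ord by auto
    note ends_i = ends[OF zfix(1)] ends[OF zfix(2)]
    have "i + 1 \<noteq> b"
    proof
      assume eq: "i + 1 = b"
      have "i \<notin> {a, b, c', d}" using ends_i eq ord by auto
      then have "y \<langle>$\<rangle> i = i" using nested(11)[of i] zfix by simp
      moreover have "y \<langle>$\<rangle> (i + 1) = a" using eq vals by simp
      ultimately show False using less ord eq ends_i by simp
    qed
    moreover have "i \<noteq> c'"
    proof
      assume eq: "i = c'"
      have "i + 1 \<notin> {a, b, c', d}" using ends_i eq ord by auto
      then have "y \<langle>$\<rangle> (i + 1) = i + 1" using nested(11)[of "i + 1"] zfix by simp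
      moreover have "y \<langle>$\<rangle> i = d" using eq nested(7) by simp
      ultimately show False using less ord eq ends_i by simp
    qed
    ultimately consider "i = b" "i + 1 = c'" | "i = b" "i + 1 \<notin> {a, b, c', d}" | "i + 1 = c'" "i \<notin> {a, b, c', d}"
      using i ends_i unfolding PN by blast
    then show ?thesis
    proof cases
      case 1
      have ad: "a \<noteq> i + 1" "a \<noteq> i" "d \<noteq> i" "d \<noteq> i + 1" using 1 ends_i ord by simp_all
      have "raises (up i y) (up i z) {a, c'} {b, d}"
      proof (rule raises.uncrossing)
        fix k assume k: "k \<notin> {a, b, c', d}"
        then have zy: "z \<langle>$\<rangle> k = y \<langle>$\<rangle> k" and "k \<noteq> i" "k \<noteq> i + 1" using nested(11) 1 by simp_all
        then show "up i z \<langle>$\<rangle> k = up i y \<langle>$\<rangle> k"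
          using z_neq[of k] by (simp add: upy upz apply_sref)
      next
        show "up i y \<langle>$\<rangle> a = c'" unfolding upy using ad nested(6) 1 by (simp add: apply_sref)
        show "up i y \<langle>$\<rangle> b = d" using ad nested(7) 1(2) unfolding 1(1)[symmetric] upy
          by (simp add: apply_sref)
        show "up i z \<langle>$\<rangle> a = d" unfolding upz using ad nested(8) by (simp add: apply_sref)
        show "up i z \<langle>$\<rangle> b = c'" using zfix 1(2) unfolding 1(1)[symmetric] by (simp add: upz)
      qed (use ord ad 1 in simp_all)
      moreover have "apply (sref i) ` P = {a, c'}" "apply (sref i) ` N = {b, d}"
        unfolding nested(1,2) 1(1)[symmetric] 1(2)[symmetric] using ad by (simp_all add: apply_sref insert_commute)
      ultimately show ?thesis by simp
    next
      case 2
      have y1: "y \<langle>$\<rangle> (i + 1) = i + 1" using nested(11)[OF 2(2)] zfix by simp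
      have ai: "a < i" using ord 2(1) ends_i by simp
      have ci: "c' > i + 1" using ord 2 by simp
      \<comment> \<open>Now \<open>up i y\<close> would lie strictly between \<open>y\<close> and \<open>z\<close>.\<close>
      have "bruhat_le (up i y) z"
      proof (rule bruhat_le_nested[of _ _ a "i + 1" c' d])
        fix k assume k: "k \<notin> {a, i + 1, c', d}"
        show "z \<langle>$\<rangle> k = up i y \<langle>$\<rangle> k"
        proof (cases "k = i")
          case True
          then show ?thesis using zfix y1 by (simp add: upy)
        next
          case False
          then have "z \<langle>$\<rangle> k = y \<langle>$\<rangle> k" using k nested(11) 2(1) by simp
          then show ?thesis unfolding upy using z_neq[of k] False k by (simp add: apply_sref)
        qed
      next
        show "up i y \<langle>$\<rangle> a = i + 1" unfolding upy using nested(6) 2(1) ai by (simp add: apply_sref)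
        show "up i y \<langle>$\<rangle> c' = d" unfolding upy using nested(7) ci ord by (simp add: apply_sref)
      qed (use nested(5,8,10) zfix c(1,2) ai ci in simp_all)
      then show ?thesis using no_between by blast
    next
      case 3
      have yi: "y \<langle>$\<rangle> i = i" using nested(11)[OF 3(2)] zfix by simp
      have di: "d > i + 1" using ord 3(1) ends_i by simp
      have bi: "b < i" using ord 3 by simp
      \<comment> \<open>Now \<open>up i y\<close> would lie strictly between \<open>y\<close> and \<open>z\<close>.\<close>
      have "bruhat_le (up i y) z"
      proof (rule bruhat_le_nested[of _ _ a b i d])
        fix k assume k: "k \<notin> {a, b, i, d}"
        show "z \<langle>$\<rangle> k = up i y \<langle>$\<rangle> k"
        proof (cases "k = i + 1")
          case True
          then show ?thesis using zfix yi by (simp add: upy)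
        next
          case False
          then have "z \<langle>$\<rangle> k = y \<langle>$\<rangle> k" using k nested(11) 3(1) by simp
          then show ?thesis unfolding upy using z_neq[of k] False k by (simp add: apply_sref)
        qed
      next
        show "up i y \<langle>$\<rangle> a = b" unfolding upy using nested(6) bi ord by (simp add: apply_sref)
        show "up i y \<langle>$\<rangle> i = d" unfolding upy using nested(7) 3(1) di by (simp add: apply_sref)
      qed (use nested(3,8,9) zfix c(1,2) bi di in simp_all)
      then show ?thesis using no_between by blast
    qed
  next
    case (crossing a b c' d)
    have "z \<langle>$\<rangle> c' = a" "z \<langle>$\<rangle> d = b"
      using crossing c(2) I_Z_sym by blast+
    then have "z \<langle>$\<rangle> k \<noteq> k" if "k \<in> {a, b, c', d}" for k
      using that crossing(3-9) by (elim insertE) simp_all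
    then show ?thesis using i zfix unfolding crossing(1,2) by blast
  next
    case (uncrossing a b c' d)
    have "z \<langle>$\<rangle> d = a" "z \<langle>$\<rangle> c' = b"
      using uncrossing c(2) I_Z_sym by blast+
    then have "z \<langle>$\<rangle> k \<noteq> k" if "k \<in> {a, b, c', d}" for k
      using that uncrossing(3-9) by (elim insertE) simp_all
    then show ?thesis using i zfix unfolding uncrossing(1,2) by blast
  qed
qed

lemma raises_up_up:
  assumes r: "raises y z P N" and cov: "inv_covers y z"
    and asc: "\<not> descent i y" and neq: "z \<noteq> up i y"
  shows "raises (up i y) (up i z) (up_cycle i y P) (up_cycle i y N)"
proof -
  have I: "y \<in> I_Z" "z \<in> I_Z" using inv_coversD[OF cov] by auto
  have ascz: "\<not> descent i z" by (rule inv_covers_ascent[OF cov asc neq])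
  show ?thesis
  proof (cases "y \<langle>$\<rangle> i = i \<and> y \<langle>$\<rangle> (i + 1) = i + 1")
    case True
    then show ?thesis using raises_up_fixed I r ascz by blast
  next
    case yfix: False
    then have "up_cycle i y = image (apply (sref i))"
      unfolding up_cycle_def by (simp only: if_False)
    moreover have "raises (up i y) (up i z) (apply (sref i) ` P) (apply (sref i) ` N)"
    proof (cases "z \<langle>$\<rangle> i = i \<and> z \<langle>$\<rangle> (i + 1) = i + 1")
      case True
      then show ?thesis using raises_up_fixes_created[OF assms yfix] by blast
    next
      case False
      show ?thesis
        unfolding up_conj[OF asc yfix] up_conj[OF ascz False]
        by (intro raises_conj raises_ascent_not_both[OF I] r asc ascz False)
    qed
    ultimately show ?thesis by simp
  qed
qed

text \<open>Every cover arises from a cover \<open>y\<close>, \<open>up i y\<close> by a sequence of maps \<open>up i\<close>: strip common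
  descents until \<open>z\<close> has a descent that \<open>y\<close> does not have.\<close>

theorem inv_covers_raises:
  assumes "inv_covers y z"
  shows "\<exists>P N. raises y z P N"
  using assms
proof (induction "len z" arbitrary: y z rule: less_induct)
  case less
  note c = inv_coversD[OF less.prems]
  have "len z \<noteq> 0"
    using bruhat_less_imp_len_less[of y z] c(3,4) by (auto simp: bruhat_less_iff)
  then obtain i where i: "descent i z" using ex_descent by auto
  show ?case
  proof (cases "descent i y")
    case False
    then show ?thesis
      using inv_covers_ascent_descent[OF less.prems False i] raises_up[OF c(1) False] by blast
  next
    case True
    let ?y = "down i y" and ?z = "down i z"
    have cov: "inv_covers ?y ?z" by (rule inv_covers_down[OF less.prems True i])
    obtain P N where "raises ?y ?z P N"
      using less.hyps[OF len_down_less[OF c(2) i] cov] by blast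
    moreover have "?z \<noteq> up i ?y" using not_descent_down[OF c(2), of i] up_down[OF c(1) True] True by auto
    ultimately have "raises (up i ?y) (up i ?z) (up_cycle i ?y P) (up_cycle i ?y N)"
      using raises_up_up cov c(1) by simp
    then show ?thesis using c(1,2) True i by auto
  qed
qed

section \<open>Weights of covers\<close>

text \<open>The sign with which \<open>z\<close> enters the transition formula for the cycle of \<open>q\<close>. It is positive
  on \<open>P\<close>, negative on \<open>N\<close> and zero elsewhere (\<open>raises_weight\<close>).\<close>

definition weight :: "int perm \<Rightarrow> int perm \<Rightarrow> int \<Rightarrow> int" where
  "weight y z q = sgn (z \<langle>$\<rangle> q - y \<langle>$\<rangle> q)"

lemma weight_eq_0_iff: "weight y z q = 0 \<longleftrightarrow> z \<langle>$\<rangle> q = y \<langle>$\<rangle> q"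
  by (simp add: weight_def sgn_0_0)

lemma raises_weight:
  assumes y: "y \<in> I_Z" and z: "z \<in> I_Z" and r: "raises y z P N"
  shows "weight y z q = of_bool (q \<in> P) - of_bool (q \<in> N)"
    and "P \<inter> N = {}"
    and "\<And>k. k \<in> P \<Longrightarrow> P = {k, y \<langle>$\<rangle> k}"
    and "\<And>k. k \<in> N \<Longrightarrow> N = {k, y \<langle>$\<rangle> k}"
    and "\<And>k. k \<in> P \<Longrightarrow> \<exists>l\<in>N. k < l"
    and "\<And>k. k \<in> N \<Longrightarrow> \<exists>l\<in>P. l < k"
proof -
  have "(\<forall>k\<in>P. y \<langle>$\<rangle> k < z \<langle>$\<rangle> k) \<and> (\<forall>k\<in>N. z \<langle>$\<rangle> k < y \<langle>$\<rangle> k) \<and> (\<forall>k\<in>P. P = {k, y \<langle>$\<rangle> k})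
      \<and> (\<forall>k\<in>N. N = {k, y \<langle>$\<rangle> k}) \<and> (\<forall>k\<in>P. \<exists>l\<in>N. k < l) \<and> (\<forall>k\<in>N. \<exists>l\<in>P. l < k)"
    using r
  proof (cases rule: raises.cases)
    case (nested a b c d)
    have vals: "y \<langle>$\<rangle> b = a" "y \<langle>$\<rangle> d = c" "z \<langle>$\<rangle> d = a"
      using nested y z I_Z_sym by blast+
    have "z \<langle>$\<rangle> b > a" using nested(3-5,8,9) by (cases "a = b") simp_all
    moreover have "z \<langle>$\<rangle> c < d" using nested(3-5,10) vals by (cases "c = d") simp_all
    ultimately show ?thesis
      unfolding nested(1,2) using nested(3-8) vals by (simp add: insert_commute)
  next
    case (crossing a b c d)
    have vals: "y \<langle>$\<rangle> b = a" "y \<langle>$\<rangle> d = c" "z \<langle>$\<rangle> c = a" "z \<langle>$\<rangle> d = b"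
      using crossing y z I_Z_sym by blast+
    then show ?thesis
      unfolding crossing(1,2) using crossing(3-9) by (simp add: insert_commute)
  next
    case (uncrossing a b c d)
    have vals: "y \<langle>$\<rangle> c = a" "y \<langle>$\<rangle> d = b" "z \<langle>$\<rangle> d = a" "z \<langle>$\<rangle> c = b"
      using uncrossing y z I_Z_sym by blast+
    then show ?thesis
      unfolding uncrossing(1,2) using uncrossing(3-9) by (simp add: insert_commute)
  qed
  then have *: "\<And>k. k \<in> P \<Longrightarrow> y \<langle>$\<rangle> k < z \<langle>$\<rangle> k" "\<And>k. k \<in> N \<Longrightarrow> z \<langle>$\<rangle> k < y \<langle>$\<rangle> k"
    "\<And>k. k \<in> P \<Longrightarrow> P = {k, y \<langle>$\<rangle> k}" "\<And>k. k \<in> N \<Longrightarrow> N = {k, y \<langle>$\<rangle> k}"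
    "\<And>k. k \<in> P \<Longrightarrow> \<exists>l\<in>N. k < l" "\<And>k. k \<in> N \<Longrightarrow> \<exists>l\<in>P. l < k"
    by blast+
  show disj: "P \<inter> N = {}"
  proof (rule ccontr)
    assume "P \<inter> N \<noteq> {}"
    then obtain k where "k \<in> P" "k \<in> N" by blast
    then show False using *(1)[of k] *(2)[of k] by simp
  qed
  show "weight y z q = of_bool (q \<in> P) - of_bool (q \<in> N)"
    using *(1,2)[of q] raises_outside[OF r, of q] disj
    by (cases "q \<in> P"; cases "q \<in> N") (auto simp: weight_def)
  show "\<And>k. k \<in> P \<Longrightarrow> P = {k, y \<langle>$\<rangle> k}" "\<And>k. k \<in> N \<Longrightarrow> N = {k, y \<langle>$\<rangle> k}"
    "\<And>k. k \<in> P \<Longrightarrow> \<exists>l\<in>N. k < l" "\<And>k. k \<in> N \<Longrightarrow> \<exists>l\<in>P. l < k"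
    using * by blast+
qed

lemma weight_up:
  assumes "y \<in> I_Z" and "\<not> descent i y"
  shows "weight y (up i y) q = of_bool (q \<in> {i, y \<langle>$\<rangle> i}) - of_bool (q \<in> {i + 1, y \<langle>$\<rangle> (i + 1)})"
  using raises_weight(1)[OF _ _ raises_up] assms by simp

text \<open>In this lemma and the next one, the weights follow the cycles \<open>P\<close> and \<open>N\<close> under \<open>up i\<close> as
  described by \<open>up_cycle\<close>.\<close>

lemma weight_up_conj:
  assumes cov: "inv_covers y z" and asc: "\<not> descent i y" and neq: "z \<noteq> up i y"
    and yfix: "\<not> (y \<langle>$\<rangle> i = i \<and> y \<langle>$\<rangle> (i + 1) = i + 1)"
  shows "weight (up i y) (up i z) (sref i \<langle>$\<rangle> q) = weight y z q"
proof -
  have I: "y \<in> I_Z" "z \<in> I_Z" using inv_coversD[OF cov] by auto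
  obtain P N where r: "raises y z P N" using inv_covers_raises[OF cov] by blast
  have "up_cycle i y = image (apply (sref i))"
    using yfix unfolding up_cycle_def by (simp only: if_False)
  moreover have "sref i \<langle>$\<rangle> q \<in> apply (sref i) ` S \<longleftrightarrow> q \<in> S" for S
    by (auto simp: apply_inj)
  ultimately show ?thesis
    using raises_weight(1)[OF _ _ raises_up_up[OF r cov asc neq], of "sref i \<langle>$\<rangle> q"]
      raises_weight(1)[OF I r, of q] I by simp
qed

lemma weight_up_fixed:
  assumes cov: "inv_covers y z" and neq: "z \<noteq> up i y"
    and fixed: "y \<langle>$\<rangle> i = i" "y \<langle>$\<rangle> (i + 1) = i + 1"
  shows "q \<notin> {i, i + 1} \<Longrightarrow> weight (up i y) (up i z) q = weight y z q"
    and "weight (up i y) (up i z) (i + 1) = weight y z i + weight y z (i + 1)"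
proof -
  have I: "y \<in> I_Z" "z \<in> I_Z" using inv_coversD[OF cov] by auto
  have asc: "\<not> descent i y" using fixed by (rule fixed_ascent)
  obtain P N where r: "raises y z P N" using inv_covers_raises[OF cov] by blast
  note w = raises_weight[OF I r]
  have up: "weight (up i y) (up i z) q
    = of_bool (q \<in> up_cycle i y P) - of_bool (q \<in> up_cycle i y N)" for q
    using raises_weight(1)[OF _ _ raises_up_up[OF r cov asc neq]] I by simp
  have cyc: "up_cycle i y S = (if S \<inter> {i, i + 1} = {} then S else {i, i + 1})" for S
    using fixed by (simp add: up_cycle_def)
  have single: "S = {k}" if "k \<in> {i, i + 1}" "k \<in> S" "S \<in> {P, N}" for S k
    using that w(3,4)[of k] fixed by auto
  have "q \<in> up_cycle i y S \<longleftrightarrow> q \<in> S" if "q \<notin> {i, i + 1}" "S \<in> {P, N}" for S q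
    using that single[of _ S] unfolding cyc by auto
  then show "q \<notin> {i, i + 1} \<Longrightarrow> weight (up i y) (up i z) q = weight y z q"
    by (simp add: up w(1))
  have "(of_bool (i + 1 \<in> up_cycle i y S) :: int) = of_bool (i \<in> S) + of_bool (i + 1 \<in> S)"
    if "S \<in> {P, N}" for S
    using that single[of i S] single[of "i + 1" S] unfolding cyc by auto
  then show "weight (up i y) (up i z) (i + 1) = weight y z i + weight y z (i + 1)"
    by (simp add: up w(1))
qed

lemma finite_perms_within: "finite A \<Longrightarrow> finite {w. affected w \<subseteq> A}"
proof -
  assume A: "finite A"
  have "inj_on (\<lambda>w. \<lambda>k. if k \<in> A then w \<langle>$\<rangle> k else undefined) {w. affected w \<subseteq> A}"
  proof (rule inj_onI)
    fix v w assume vw: "v \<in> {w. affected w \<subseteq> A}" "w \<in> {w. affected w \<subseteq> A}"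
      and eq: "(\<lambda>k. if k \<in> A then v \<langle>$\<rangle> k else undefined) = (\<lambda>k. if k \<in> A then w \<langle>$\<rangle> k else undefined)"
    show "v = w"
    proof (rule perm_eqI)
      fix k
      show "v \<langle>$\<rangle> k = w \<langle>$\<rangle> k"
        using fun_cong[OF eq, of k] vw apply_outside[of v A k] apply_outside[of w A k]
        by (cases "k \<in> A") auto
    qed
  qed
  moreover have "(\<lambda>w. \<lambda>k. if k \<in> A then w \<langle>$\<rangle> k else undefined) ` {w. affected w \<subseteq> A} 
      \<subseteq> {f. \<forall>k. (k \<in> A \<longrightarrow> f k \<in> A) \<and> (k \<notin> A \<longrightarrow> f k = undefined)}"
    by (auto intro: apply_inside)
  ultimately show ?thesis
    using finite_set_of_finite_funs[OF A A, of undefined] by (meson finite_imageD finite_subset)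
qed

text \<open>Away from \<open>q\<close> and the support of \<open>y\<close>, the cover \<open>z\<close> has no descent \<open>i\<close>, since otherwise \<open>z
  = y s\<^sub>i\<close> by \<open>inv_covers_ascent_descent\<close>, which does not move \<open>q\<close>. Suppose that \<open>z\<close> moves a
  point \<open>k\<close> far to the right. If its value falls, so does the value at \<open>k - 1\<close>, which leaves no
  room for \<open>q\<close> on the two exchanged cycles. If it rises, then the other exchanged cycle reaches
  beyond \<open>k\<close>, although it is the cycle of \<open>q\<close>. The left side is symmetric.\<close>

lemma finite_covers_moving: "finite {z. inv_covers y z \<and> z \<langle>$\<rangle> q \<noteq> y \<langle>$\<rangle> q}"
proof -
  obtain l u where lu: "affected y \<subseteq> {l..u}" using ex_affected_bounds by blast
  define L U where "L = min l q" and "U = max u q"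
  have fixed: "y \<langle>$\<rangle> k = k" if "k \<notin> {L..U}" for k
  proof -
    have "L \<le> l" "u \<le> U" by (simp_all add: L_def U_def)
    then have "k \<notin> {l..u}" using that by auto
    then show ?thesis by (rule apply_outside[OF lu])
  qed
  have q: "q \<in> {L..U}" by (simp add: L_def U_def)
  have yq: "y \<langle>$\<rangle> q \<in> {L..U}"
    using apply_outside[OF lu, of q] apply_inside[OF lu, of q] by (cases "q \<in> {l..u}") (auto simp: L_def U_def)
  have "affected z \<subseteq> {L - 1..U + 1}" if cov: "inv_covers y z" and moved: "z \<langle>$\<rangle> q \<noteq> y \<langle>$\<rangle> q" for z
  proof
    fix k assume "k \<in> affected z"
    then have k: "z \<langle>$\<rangle> k \<noteq> k" by (simp add: in_affected)
    have I: "y \<in> I_Z" "z \<in> I_Z" using inv_coversD[OF cov] by auto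
    obtain P N where r: "raises y z P N" using inv_covers_raises[OF cov] by blast
    note w = raises_weight[OF I r]
    have qPN: "q \<in> P \<union> N" using raises_outside[OF r, of q] moved by blast
    have asc: "z \<langle>$\<rangle> i < z \<langle>$\<rangle> (i + 1)" if "i \<notin> {L..U}" "i + 1 \<notin> {L..U}" for i
    proof (rule ccontr)
      assume "\<not> ?thesis"
      then have "z = up i y"
        using fixed that by (intro inv_covers_ascent_descent[OF cov] fixed_ascent) (auto simp: not_descent_iff[symmetric])
      moreover have "up i y = y * sref i" using fixed that by (intro up_fixed) auto
      ultimately have "z \<langle>$\<rangle> q = y \<langle>$\<rangle> q" using that q by (auto simp: apply_sref)
      then show False using moved by simp
    qed
    have "k \<in> P \<union> N" if "k \<notin> {L..U}" using raises_outside[OF r, of k] fixed[OF that] k by auto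
    have singleton: "k \<in> P \<Longrightarrow> P = {k} \<and> N = {q, y \<langle>$\<rangle> q} \<and> z \<langle>$\<rangle> k > k"
      "k \<in> N \<Longrightarrow> N = {k} \<and> P = {q, y \<langle>$\<rangle> q} \<and> z \<langle>$\<rangle> k < k"
      if "k \<notin> {L..U}" "z \<langle>$\<rangle> k \<noteq> k" for k
    proof -
      have "q \<noteq> k" using q that by auto
      moreover have "sgn (z \<langle>$\<rangle> k - k) = of_bool (k \<in> P) - of_bool (k \<in> N)"
        using w(1)[of k] fixed[OF that(1)] by (simp add: weight_def)
      ultimately show "k \<in> P \<Longrightarrow> P = {k} \<and> N = {q, y \<langle>$\<rangle> q} \<and> z \<langle>$\<rangle> k > k"
        "k \<in> N \<Longrightarrow> N = {k} \<and> P = {q, y \<langle>$\<rangle> q} \<and> z \<langle>$\<rangle> k < k"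
        using w(2) w(3)[of k] w(4)[of k] w(3)[of q] w(4)[of q] fixed[OF that(1)] qPN
        by (auto simp: sgn_if split: if_splits)
    qed
    have in_PN: "k \<in> P \<union> N" if "k \<notin> {L..U}" "z \<langle>$\<rangle> k \<noteq> k" for k
      using raises_outside[OF r, of k] fixed[OF that(1)] that(2) by auto
    show "k \<in> {L - 1..U + 1}"
    proof (rule ccontr)
      assume "k \<notin> {L - 1..U + 1}"
      then consider "k < L - 1" | "k > U + 1" by fastforce
      then show False
      proof cases
        case 1
        then have out: "k \<notin> {L..U}" "k + 1 \<notin> {L..U}" by auto
        show False
        proof (cases "k \<in> P")
          case True
          then have s: "P = {k}" "N = {q, y \<langle>$\<rangle> q}" "z \<langle>$\<rangle> k > k" using singleton(1)[OF out(1) k] by auto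
          then have "z \<langle>$\<rangle> (k + 1) \<noteq> k + 1" using asc[of k] out by auto
          then have "k + 1 \<in> P \<union> N" using in_PN out by blast
          then show False using s out q yq by auto
        next
          case False
          then have "k \<in> N" "P = {q, y \<langle>$\<rangle> q}" using in_PN[OF out(1) k] singleton(2)[OF out(1) k] by auto
          then show False using w(6)[of k] q yq 1 by auto
        qed
      next
        case 2
        then have out: "k \<notin> {L..U}" "k - 1 \<notin> {L..U}" by auto
        show False
        proof (cases "k \<in> N")
          case True
          then have s: "N = {k}" "P = {q, y \<langle>$\<rangle> q}" "z \<langle>$\<rangle> k < k" using singleton(2)[OF out(1) k] by auto
          then have "z \<langle>$\<rangle> (k - 1) \<noteq> k - 1" using asc[of "k - 1"] out by auto
          then have "k - 1 \<in> P \<union> N" using in_PN out by blast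
          then show False using s out q yq by auto
        next
          case False
          then have "k \<in> P" "N = {q, y \<langle>$\<rangle> q}" using in_PN[OF out(1) k] singleton(1)[OF out(1) k] by auto
          then show False using w(5)[of k] q yq 2 by auto
        qed
      qed
    qed
  qed
  then have "{z. inv_covers y z \<and> z \<langle>$\<rangle> q \<noteq> y \<langle>$\<rangle> q} \<subseteq> {w. affected w \<subseteq> {L - 1..U + 1}}"
    by blast
  then show ?thesis by (rule finite_subset) (rule finite_perms_within, simp)
qed

section \<open>The maps \<open>\<tau>\<^sub>i\<^sub>j\<close>\<close>

text \<open>The lines of the defining table with the set \<open>A\<close> eliminated: everything is expressed
  through \<open>i\<close>, \<open>j\<close>, \<open>y(i)\<close> and \<open>y(j)\<close>. The digit in a case name is the number of the line, and
  the letter counts the pairs \<open>(i, j)\<close> that this line allows.\<close>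

lemma tau_step_cases:
  assumes "tau_step i j y z"
  obtains
    (r1a) "i < j" "y \<langle>$\<rangle> i = i" "y \<langle>$\<rangle> j = j" "z \<langle>$\<rangle> i = j" "z \<langle>$\<rangle> j = i"
  | (r2a) "y \<langle>$\<rangle> i < i" "i < j" "y \<langle>$\<rangle> j = j"
      "z \<langle>$\<rangle> (y \<langle>$\<rangle> i) = j" "z \<langle>$\<rangle> j = y \<langle>$\<rangle> i" "z \<langle>$\<rangle> i = i"
  | (r2b) "i < y \<langle>$\<rangle> i" "y \<langle>$\<rangle> i < j" "y \<langle>$\<rangle> j = j"
      "z \<langle>$\<rangle> i = j" "z \<langle>$\<rangle> j = i" "z \<langle>$\<rangle> (y \<langle>$\<rangle> i) = y \<langle>$\<rangle> i"
  | (r3a) "y \<langle>$\<rangle> i = i" "i < j" "j < y \<langle>$\<rangle> j"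
      "z \<langle>$\<rangle> i = y \<langle>$\<rangle> j" "z \<langle>$\<rangle> (y \<langle>$\<rangle> j) = i" "z \<langle>$\<rangle> j = j"
  | (r3b) "y \<langle>$\<rangle> i = i" "i < y \<langle>$\<rangle> j" "y \<langle>$\<rangle> j < j"
      "z \<langle>$\<rangle> i = j" "z \<langle>$\<rangle> j = i" "z \<langle>$\<rangle> (y \<langle>$\<rangle> j) = y \<langle>$\<rangle> j"
  | (r4a) "y \<langle>$\<rangle> i < i" "i < j" "j < y \<langle>$\<rangle> j"
      "z \<langle>$\<rangle> (y \<langle>$\<rangle> i) = j" "z \<langle>$\<rangle> j = y \<langle>$\<rangle> i" "z \<langle>$\<rangle> i = y \<langle>$\<rangle> j" "z \<langle>$\<rangle> (y \<langle>$\<rangle> j) = i"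
  | (r5a) "i < y \<langle>$\<rangle> i" "y \<langle>$\<rangle> i < j" "j < y \<langle>$\<rangle> j"
      "z \<langle>$\<rangle> i = y \<langle>$\<rangle> j" "z \<langle>$\<rangle> (y \<langle>$\<rangle> j) = i" "z \<langle>$\<rangle> (y \<langle>$\<rangle> i) = y \<langle>$\<rangle> i" "z \<langle>$\<rangle> j = j"
  | (r5b) "y \<langle>$\<rangle> i < i" "i < y \<langle>$\<rangle> j" "y \<langle>$\<rangle> j < j"
      "z \<langle>$\<rangle> (y \<langle>$\<rangle> i) = j" "z \<langle>$\<rangle> j = y \<langle>$\<rangle> i" "z \<langle>$\<rangle> i = i" "z \<langle>$\<rangle> (y \<langle>$\<rangle> j) = y \<langle>$\<rangle> j"
  | (r5c) "i < y \<langle>$\<rangle> i" "y \<langle>$\<rangle> i < y \<langle>$\<rangle> j" "y \<langle>$\<rangle> j < j"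
      "z \<langle>$\<rangle> i = j" "z \<langle>$\<rangle> j = i" "z \<langle>$\<rangle> (y \<langle>$\<rangle> i) = y \<langle>$\<rangle> i" "z \<langle>$\<rangle> (y \<langle>$\<rangle> j) = y \<langle>$\<rangle> j"
  | (r6a) "i < j" "j < y \<langle>$\<rangle> i" "y \<langle>$\<rangle> i < y \<langle>$\<rangle> j"
      "z \<langle>$\<rangle> i = y \<langle>$\<rangle> j" "z \<langle>$\<rangle> (y \<langle>$\<rangle> j) = i" "z \<langle>$\<rangle> j = y \<langle>$\<rangle> i" "z \<langle>$\<rangle> (y \<langle>$\<rangle> i) = j"
  | (r6b) "y \<langle>$\<rangle> i < y \<langle>$\<rangle> j" "y \<langle>$\<rangle> j < i" "i < j"
      "z \<langle>$\<rangle> (y \<langle>$\<rangle> i) = j" "z \<langle>$\<rangle> j = y \<langle>$\<rangle> i" "z \<langle>$\<rangle> (y \<langle>$\<rangle> j) = i" "z \<langle>$\<rangle> i = y \<langle>$\<rangle> j"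
  | (r6c) "i < y \<langle>$\<rangle> j" "y \<langle>$\<rangle> j < y \<langle>$\<rangle> i" "y \<langle>$\<rangle> i < j"
      "z \<langle>$\<rangle> i = j" "z \<langle>$\<rangle> j = i" "z \<langle>$\<rangle> (y \<langle>$\<rangle> j) = y \<langle>$\<rangle> i" "z \<langle>$\<rangle> (y \<langle>$\<rangle> i) = y \<langle>$\<rangle> j"
proof -
  obtain A f g ij where A: "A = {i, j, y \<langle>$\<rangle> i, y \<langle>$\<rangle> j}" and rule: "tau_rule A f ij g" and ij: "ij = (i, j)"
    and fg: "\<forall>k\<in>A. y \<langle>$\<rangle> k = f \<langle>$\<rangle> k \<and> z \<langle>$\<rangle> k = g \<langle>$\<rangle> k"
    using assms unfolding tau_step_def Let_def by blast
  show thesis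
    using rule
  proof (cases rule: tau_rule.cases)
    case (1 a b)
    then have "y \<langle>$\<rangle> a = a" "y \<langle>$\<rangle> b = b" "z \<langle>$\<rangle> a = b" "z \<langle>$\<rangle> b = a"
      using fg by simp_all
    then show thesis using 1(3,5) ij that(1) by simp
  next
    case (2 a b c)
    then have "y \<langle>$\<rangle> a = b" "y \<langle>$\<rangle> b = a" "y \<langle>$\<rangle> c = c" "z \<langle>$\<rangle> a = c" "z \<langle>$\<rangle> b = b" "z \<langle>$\<rangle> c = a"
      using fg by (simp_all add: apply_swap)
    note vals = this 2(4,5)
    consider "i = b" "j = c" | "i = a" "j = c"
      using 2 ij by auto
    then show thesis
    proof cases
      case 1
      show thesis by (rule that(2)) (use vals 1 in simp_all)
    next
      case 2
      show thesis by (rule that(3)) (use vals 2 in simp_all)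
    qed
  next
    case (3 a b c)
    then have "y \<langle>$\<rangle> a = a" "y \<langle>$\<rangle> b = c" "y \<langle>$\<rangle> c = b" "z \<langle>$\<rangle> a = c" "z \<langle>$\<rangle> b = b" "z \<langle>$\<rangle> c = a"
      using fg by (simp_all add: apply_swap)
    note vals = this 3(4,5)
    consider "i = a" "j = b" | "i = a" "j = c"
      using 3 ij by auto
    then show thesis
    proof cases
      case 1
      show thesis by (rule that(4)) (use vals 1 in simp_all)
    next
      case 2
      show thesis by (rule that(5)) (use vals 2 in simp_all)
    qed
  next
    case (4 a b c d)
    then have "y \<langle>$\<rangle> a = b" "y \<langle>$\<rangle> b = a" "y \<langle>$\<rangle> c = d" "y \<langle>$\<rangle> d = c"
        "z \<langle>$\<rangle> a = c" "z \<langle>$\<rangle> b = d" "z \<langle>$\<rangle> c = a" "z \<langle>$\<rangle> d = b"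
      using fg by (simp_all add: apply_swap)
    note vals = this 4(5-7)
    consider "i = b" "j = c"
      using 4 ij by auto
    then show thesis
    proof cases
      case 1
      show thesis by (rule that(6)) (use vals 1 in simp_all)
    qed
  next
    case (5 a b c d)
    then have "y \<langle>$\<rangle> a = b" "y \<langle>$\<rangle> b = a" "y \<langle>$\<rangle> c = d" "y \<langle>$\<rangle> d = c"
        "z \<langle>$\<rangle> a = d" "z \<langle>$\<rangle> b = b" "z \<langle>$\<rangle> c = c" "z \<langle>$\<rangle> d = a"
      using fg by (simp_all add: apply_swap)
    note vals = this 5(4-6)
    consider "i = a" "j = c" | "i = b" "j = d" | "i = a" "j = d"
      using 5 ij by auto
    then show thesis
    proof cases
      case 1
      show thesis by (rule that(7)) (use vals 1 in simp_all)
    next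
      case 2
      show thesis by (rule that(8)) (use vals 2 in simp_all)
    next
      case 3
      show thesis by (rule that(9)) (use vals 3 in simp_all)
    qed
  next
    case (6 a b c d)
    then have "y \<langle>$\<rangle> a = c" "y \<langle>$\<rangle> b = d" "y \<langle>$\<rangle> c = a" "y \<langle>$\<rangle> d = b"
        "z \<langle>$\<rangle> a = d" "z \<langle>$\<rangle> b = c" "z \<langle>$\<rangle> c = b" "z \<langle>$\<rangle> d = a"
      using fg by (simp_all add: apply_swap)
    note vals = this 6(4-6)
    consider "i = a" "j = b" | "i = c" "j = d" | "i = a" "j = d"
      using 6 ij by auto
    then show thesis
    proof cases
      case 1
      show thesis by (rule that(10)) (use vals 1 in simp_all)
    next
      case 2
      show thesis by (rule that(11)) (use vals 2 in simp_all)
    next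
      case 3
      show thesis by (rule that(12)) (use vals 3 in simp_all)
    qed
  qed
qed

lemma tau_step_outside:
  "tau_step i j y z \<Longrightarrow> k \<notin> {i, j, y \<langle>$\<rangle> i, y \<langle>$\<rangle> j} \<Longrightarrow> z \<langle>$\<rangle> k = y \<langle>$\<rangle> k"
  unfolding tau_step_def Let_def by blast

text \<open>The table is unambiguous because the values of \<open>\<tau>\<^sub>i\<^sub>j(y)\<close> at \<open>i\<close>, \<open>j\<close>, \<open>u = y(i)\<close>, \<open>v =
  y(j)\<close> can be computed by comparing these four integers; this gives a meaning to the definite
  description in \<^const>\<open>tau\<close>.\<close>

definition tau_values :: "int \<Rightarrow> int \<Rightarrow> int \<Rightarrow> int \<Rightarrow> int \<times> int \<times> int \<times> int" where
  "tau_values i j u v =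
    (if u < i then
       if v < i then (v, u, j, i) else if v < j then (i, u, j, v)
       else if v = j then (i, u, j, u) else (v, u, j, i)
     else if u = i then
       if v < j then (j, i, j, v) else if v = j then (j, i, j, i) else (v, j, v, i)
     else
       if v < j then if u < v then (j, i, u, v) else (j, i, v, u)
       else if v = j then (j, i, u, i) else if u < j then (v, j, u, i) else (v, u, j, i))"

lemma tau_step_values:
  assumes "tau_step i j y z"
  shows "(z \<langle>$\<rangle> i, z \<langle>$\<rangle> j, z \<langle>$\<rangle> (y \<langle>$\<rangle> i), z \<langle>$\<rangle> (y \<langle>$\<rangle> j)) = tau_values i j (y \<langle>$\<rangle> i) (y \<langle>$\<rangle> j)"
  using assms by (cases rule: tau_step_cases) (simp_all add: tau_values_def)

lemma tau_step_unique:
  assumes z: "tau_step i j y z" and z': "tau_step i j y z'"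
  shows "z = z'"
proof (rule perm_eqI)
  fix k
  have eq: "z \<langle>$\<rangle> i = z' \<langle>$\<rangle> i" "z \<langle>$\<rangle> j = z' \<langle>$\<rangle> j"
    "z \<langle>$\<rangle> (y \<langle>$\<rangle> i) = z' \<langle>$\<rangle> (y \<langle>$\<rangle> i)" "z \<langle>$\<rangle> (y \<langle>$\<rangle> j) = z' \<langle>$\<rangle> (y \<langle>$\<rangle> j)"
    using tau_step_values[OF z] unfolding tau_step_values[OF z', symmetric] by simp_all
  show "z \<langle>$\<rangle> k = z' \<langle>$\<rangle> k"
  proof (cases "k \<in> {i, j, y \<langle>$\<rangle> i, y \<langle>$\<rangle> j}")
    case True
    then show ?thesis using eq by blast
  next
    case False
    then show ?thesis using tau_step_outside[OF z] tau_step_outside[OF z'] by simp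
  qed
qed

lemma tau_eq:
  assumes "tau_step i j y z"
  shows "tau i j y = z"
proof -
  have "(THE z. tau_step i j y z) = z"
    by (rule the_equality[where P = "tau_step i j y", OF assms])
      (rule tau_step_unique[OF _ assms])
  moreover have "\<exists>z. tau_step i j y z" using assms by (rule exI)
  ultimately show ?thesis unfolding tau_def by (simp only: if_True)
qed

lemma tau_step_tau:
  assumes "tau i j y \<noteq> y"
  shows "tau_step i j y (tau i j y)"
proof -
  obtain z where "tau_step i j y z"
    using assms unfolding tau_def by (cases "\<exists>z. tau_step i j y z") auto
  then show ?thesis using tau_eq by simp
qed

lemma tau_stepI:
  assumes "tau_rule A f (i, j) g" "{i, j, y \<langle>$\<rangle> i, y \<langle>$\<rangle> j} = A"
    and "\<And>k. k \<in> A \<Longrightarrow> y \<langle>$\<rangle> k = f \<langle>$\<rangle> k \<and> z \<langle>$\<rangle> k = g \<langle>$\<rangle> k"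
    and "\<And>k. k \<notin> A \<Longrightarrow> z \<langle>$\<rangle> k = y \<langle>$\<rangle> k"
  shows "tau_step i j y z"
  using assms unfolding tau_step_def Let_def by blast

text \<open>A cover raising the cycle of \<open>q\<close> is \<open>\<tau>\<^sub>q\<^sub>j(y)\<close> for some \<open>j > q\<close> when \<open>q\<close> is the larger end
  of its cycle, and a cover lowering the cycle of \<open>p\<close> is \<open>\<tau>\<^sub>i\<^sub>p(y)\<close> for some \<open>i < p\<close> when \<open>p\<close> is
  the smaller end: in each row of the table these ends are allowed as \<open>i\<close> or \<open>j\<close>.\<close>

lemma raises_tau_step:
  assumes y: "y \<in> I_Z" and z: "z \<in> I_Z" and r: "raises y z P N"
  shows "q \<in> P \<Longrightarrow> y \<langle>$\<rangle> q \<le> q \<Longrightarrow> \<exists>j>q. tau_step q j y z"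
    and "p \<in> N \<Longrightarrow> p \<le> y \<langle>$\<rangle> p \<Longrightarrow> \<exists>i<p. tau_step i p y z"
proof -
  have "(\<forall>q\<in>P. y \<langle>$\<rangle> q \<le> q \<longrightarrow> (\<exists>j>q. tau_step q j y z)) \<and>
    (\<forall>p\<in>N. p \<le> y \<langle>$\<rangle> p \<longrightarrow> (\<exists>i<p. tau_step i p y z))"
    using r
  proof (cases rule: raises.cases)
    case (nested a b c d)
    note ord = nested(3-5)
    have vals: "y \<langle>$\<rangle> b = a" "y \<langle>$\<rangle> d = c" "z \<langle>$\<rangle> d = a"
      using nested y z I_Z_sym by blast+
    have "\<exists>i j. i < c \<and> b < j \<and> tau_step b j y z \<and> tau_step i c y z"
    proof (cases "a = b"; cases "c = d")
      assume eq: "a = b" "c = d"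
      have v: "y \<langle>$\<rangle> b = b" "y \<langle>$\<rangle> c = c" "z \<langle>$\<rangle> b = c" "z \<langle>$\<rangle> c = b"
        using eq nested(8) vals by simp_all
      have rule: "tau_rule {b, c} 1 (b, c) \<langle>b \<leftrightarrow> c\<rangle>"
        by (rule tau_rule.intros) (rule ord)
      have "tau_step b c y z"
      proof (rule tau_stepI[OF rule])
        show "y \<langle>$\<rangle> k = 1 \<langle>$\<rangle> k \<and> z \<langle>$\<rangle> k = \<langle>b \<leftrightarrow> c\<rangle> \<langle>$\<rangle> k" if "k \<in> {b, c}" for k
          using that by (elim insertE) (simp_all add: v)
        show "z \<langle>$\<rangle> k = y \<langle>$\<rangle> k" if "k \<notin> {b, c}" for k
          using that nested(11)[of k] eq by simp
      qed (auto simp: v)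
      then show ?thesis using ord by blast
    next
      assume eq: "a = b" "c \<noteq> d"
      have v: "y \<langle>$\<rangle> b = b" "y \<langle>$\<rangle> c = d" "y \<langle>$\<rangle> d = c" "z \<langle>$\<rangle> b = d" "z \<langle>$\<rangle> c = c" "z \<langle>$\<rangle> d = b"
        using eq nested(7,8,10) vals by simp_all
      have rule: "tau_rule {b, c, d} \<langle>c \<leftrightarrow> d\<rangle> (b, c) \<langle>b \<leftrightarrow> d\<rangle>"
        using ord eq by (intro tau_rule.intros) simp_all
      have "tau_step b c y z"
      proof (rule tau_stepI[OF rule])
        show "y \<langle>$\<rangle> k = \<langle>c \<leftrightarrow> d\<rangle> \<langle>$\<rangle> k \<and> z \<langle>$\<rangle> k = \<langle>b \<leftrightarrow> d\<rangle> \<langle>$\<rangle> k" if "k \<in> {b, c, d}" for k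
          using that ord eq by (elim insertE) (simp_all add: v)
        show "z \<langle>$\<rangle> k = y \<langle>$\<rangle> k" if "k \<notin> {b, c, d}" for k
          using that nested(11)[of k] eq by simp
      qed (auto simp: v)
      then show ?thesis using ord by blast
    next
      assume eq: "a \<noteq> b" "c = d"
      have v: "y \<langle>$\<rangle> a = b" "y \<langle>$\<rangle> b = a" "y \<langle>$\<rangle> c = c" "z \<langle>$\<rangle> a = c" "z \<langle>$\<rangle> b = b" "z \<langle>$\<rangle> c = a"
        using eq nested(6-9) vals by simp_all
      have rule: "tau_rule {a, b, c} \<langle>a \<leftrightarrow> b\<rangle> (b, c) \<langle>a \<leftrightarrow> c\<rangle>"
        using ord eq by (intro tau_rule.intros) simp_all
      have "tau_step b c y z"
      proof (rule tau_stepI[OF rule])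
        show "y \<langle>$\<rangle> k = \<langle>a \<leftrightarrow> b\<rangle> \<langle>$\<rangle> k \<and> z \<langle>$\<rangle> k = \<langle>a \<leftrightarrow> c\<rangle> \<langle>$\<rangle> k" if "k \<in> {a, b, c}" for k
          using that ord eq(1) by (elim insertE) (simp_all add: v)
        show "z \<langle>$\<rangle> k = y \<langle>$\<rangle> k" if "k \<notin> {a, b, c}" for k
          using that nested(11)[of k] eq by simp
        show "{b, c, y \<langle>$\<rangle> b, y \<langle>$\<rangle> c} = {a, b, c}" unfolding v by blast
      qed
      then show ?thesis using ord by blast
    next
      assume eq: "a \<noteq> b" "c \<noteq> d"
      have v: "y \<langle>$\<rangle> a = b" "y \<langle>$\<rangle> b = a" "y \<langle>$\<rangle> c = d" "y \<langle>$\<rangle> d = c"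
          "z \<langle>$\<rangle> a = d" "z \<langle>$\<rangle> b = b" "z \<langle>$\<rangle> c = c" "z \<langle>$\<rangle> d = a"
        using eq nested(6-10) vals by simp_all
      have step: "tau_step i j y z" if ij: "(i, j) \<in> {(a, c), (b, d)}" for i j
      proof -
        have rule: "tau_rule {a, b, c, d} (\<langle>a \<leftrightarrow> b\<rangle> * \<langle>c \<leftrightarrow> d\<rangle>) (i, j) \<langle>a \<leftrightarrow> d\<rangle>"
          using ord eq ij by (intro tau_rule.intros) auto
        show ?thesis
        proof (rule tau_stepI[OF rule])
          show "y \<langle>$\<rangle> k = (\<langle>a \<leftrightarrow> b\<rangle> * \<langle>c \<leftrightarrow> d\<rangle>) \<langle>$\<rangle> k \<and> z \<langle>$\<rangle> k = \<langle>a \<leftrightarrow> d\<rangle> \<langle>$\<rangle> k"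
            if "k \<in> {a, b, c, d}" for k
            using that ord eq by (elim insertE) (simp_all add: v)
          show "{i, j, y \<langle>$\<rangle> i, y \<langle>$\<rangle> j} = {a, b, c, d}"
            using ij by (elim insertE) (simp_all add: v insert_commute)
        qed (rule nested(11))
      qed
      have "tau_step b d y z" "tau_step a c y z" "a < c" "b < d"
        using step ord by simp_all
      then show ?thesis by blast
    qed
    moreover have "q = b" if "q \<in> P" "y \<langle>$\<rangle> q \<le> q" for q
      using that unfolding nested(1) by (elim insertE) (use ord nested(6) vals in simp_all)
    moreover have "p = c" if "p \<in> N" "p \<le> y \<langle>$\<rangle> p" for p
      using that unfolding nested(2) by (elim insertE) (use ord nested(7) vals in simp_all)
    ultimately show ?thesis by blast
  next
    case (crossing a b c d)
    note ord = crossing(3-5)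
    have v: "y \<langle>$\<rangle> a = b" "y \<langle>$\<rangle> b = a" "y \<langle>$\<rangle> c = d" "y \<langle>$\<rangle> d = c"
        "z \<langle>$\<rangle> a = c" "z \<langle>$\<rangle> b = d" "z \<langle>$\<rangle> c = a" "z \<langle>$\<rangle> d = b"
      using crossing y z I_Z_sym by blast+
    have rule: "tau_rule {a, b, c, d} (\<langle>a \<leftrightarrow> b\<rangle> * \<langle>c \<leftrightarrow> d\<rangle>) (b, c) (\<langle>a \<leftrightarrow> c\<rangle> * \<langle>b \<leftrightarrow> d\<rangle>)"
      by (rule tau_rule.intros; rule ord)
    have "tau_step b c y z"
    proof (rule tau_stepI[OF rule])
      show "y \<langle>$\<rangle> k = (\<langle>a \<leftrightarrow> b\<rangle> * \<langle>c \<leftrightarrow> d\<rangle>) \<langle>$\<rangle> k \<and> z \<langle>$\<rangle> k = (\<langle>a \<leftrightarrow> c\<rangle> * \<langle>b \<leftrightarrow> d\<rangle>) \<langle>$\<rangle> k"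
        if "k \<in> {a, b, c, d}" for k
        using that ord by (elim insertE) (simp_all add: v)
      show "{b, c, y \<langle>$\<rangle> b, y \<langle>$\<rangle> c} = {a, b, c, d}" unfolding v by blast
    qed (rule crossing(10))
    moreover have "q = b" if "q \<in> P" "y \<langle>$\<rangle> q \<le> q" for q
      using that unfolding crossing(1) by (elim insertE) (use ord v in simp_all)
    moreover have "p = c" if "p \<in> N" "p \<le> y \<langle>$\<rangle> p" for p
      using that unfolding crossing(2) by (elim insertE) (use ord v in simp_all)
    ultimately show ?thesis using ord by blast
  next
    case (uncrossing a b c d)
    note ord = uncrossing(3-5)
    have v: "y \<langle>$\<rangle> a = c" "y \<langle>$\<rangle> c = a" "y \<langle>$\<rangle> b = d" "y \<langle>$\<rangle> d = b"
        "z \<langle>$\<rangle> a = d" "z \<langle>$\<rangle> d = a" "z \<langle>$\<rangle> b = c" "z \<langle>$\<rangle> c = b"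
      using uncrossing y z I_Z_sym by blast+
    have step: "tau_step i j y z" if ij: "(i, j) \<in> {(a, b), (c, d)}" for i j
    proof -
      have rule: "tau_rule {a, b, c, d} (\<langle>a \<leftrightarrow> c\<rangle> * \<langle>b \<leftrightarrow> d\<rangle>) (i, j) (\<langle>a \<leftrightarrow> d\<rangle> * \<langle>b \<leftrightarrow> c\<rangle>)"
        using ord ij by (intro tau_rule.intros) auto
      show ?thesis
      proof (rule tau_stepI[OF rule])
        show "y \<langle>$\<rangle> k = (\<langle>a \<leftrightarrow> c\<rangle> * \<langle>b \<leftrightarrow> d\<rangle>) \<langle>$\<rangle> k \<and> z \<langle>$\<rangle> k = (\<langle>a \<leftrightarrow> d\<rangle> * \<langle>b \<leftrightarrow> c\<rangle>) \<langle>$\<rangle> k"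
          if "k \<in> {a, b, c, d}" for k
          using that ord by (elim insertE) (simp_all add: v)
        show "{i, j, y \<langle>$\<rangle> i, y \<langle>$\<rangle> j} = {a, b, c, d}"
          using ij by (elim insertE) (simp_all add: v insert_commute)
      qed (rule uncrossing(10))
    qed
    have "tau_step a b y z" "tau_step c d y z" by (simp_all add: step)
    moreover have "q = c" if "q \<in> P" "y \<langle>$\<rangle> q \<le> q" for q
      using that unfolding uncrossing(1) by (elim insertE) (use ord v in simp_all)
    moreover have "p = b" if "p \<in> N" "p \<le> y \<langle>$\<rangle> p" for p
      using that unfolding uncrossing(2) by (elim insertE) (use ord v in simp_all)
    ultimately show ?thesis using ord by blast
  qed
  then show "q \<in> P \<Longrightarrow> y \<langle>$\<rangle> q \<le> q \<Longrightarrow> \<exists>j>q. tau_step q j y z"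
    and "p \<in> N \<Longrightarrow> p \<le> y \<langle>$\<rangle> p \<Longrightarrow> \<exists>i<p. tau_step i p y z"
    by blast+
qed

text \<open>With \<open>raises_tau_step\<close> and the classification of the covers, both index sets are described
  by the sign of \<open>z(q) - y(q)\<close> alone.\<close>

lemma Phi_plus_eq:
  assumes "y \<in> I_Z" "y \<langle>$\<rangle> q \<le> q"
  shows "Phi_plus y q = {z. inv_covers y z \<and> y \<langle>$\<rangle> q < z \<langle>$\<rangle> q}"
proof (intro set_eqI iffI CollectI)
  fix z assume "z \<in> Phi_plus y q"
  then obtain j where cov: "inv_covers y z" and j: "j > q" "z = tau q j y"
    by (auto simp: Phi_plus_def)
  have "tau_step q j y z" using tau_step_tau[of q j y] inv_coversD(4)[OF cov] j by simp
  then have "y \<langle>$\<rangle> q < z \<langle>$\<rangle> q"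
    by (rule tau_step_cases) (use assms j(1) in simp_all)
  then show "inv_covers y z \<and> y \<langle>$\<rangle> q < z \<langle>$\<rangle> q" using cov by simp
next
  fix z assume z: "z \<in> {z. inv_covers y z \<and> y \<langle>$\<rangle> q < z \<langle>$\<rangle> q}"
  then have I: "z \<in> I_Z" and cov: "inv_covers y z" using inv_coversD by blast+
  obtain P N where r: "raises y z P N" using inv_covers_raises[OF cov] by blast
  have "weight y z q = 1" using z by (simp add: weight_def)
  then have "q \<in> P" using raises_weight(1)[OF assms(1) I r, of q] by (simp add: of_bool_def split: if_splits)
  then obtain j where "j > q" "tau_step q j y z"
    using raises_tau_step(1)[OF assms(1) I r] assms(2) by blast
  then show "z \<in> Phi_plus y q" using I cov tau_eq by (fastforce simp: Phi_plus_def)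
qed

lemma Phi_minus_eq:
  assumes "y \<in> I_Z" "p \<le> y \<langle>$\<rangle> p"
  shows "Phi_minus y p = {z. inv_covers y z \<and> z \<langle>$\<rangle> p < y \<langle>$\<rangle> p}"
proof (intro set_eqI iffI CollectI)
  fix z assume "z \<in> Phi_minus y p"
  then obtain i where cov: "inv_covers y z" and i: "i < p" "z = tau i p y"
    by (auto simp: Phi_minus_def)
  have "tau_step i p y z" using tau_step_tau[of i p y] inv_coversD(4)[OF cov] i by simp
  then have "z \<langle>$\<rangle> p < y \<langle>$\<rangle> p"
    by (rule tau_step_cases) (use assms i(1) in simp_all)
  then show "inv_covers y z \<and> z \<langle>$\<rangle> p < y \<langle>$\<rangle> p" using cov by simp
next
  fix z assume z: "z \<in> {z. inv_covers y z \<and> z \<langle>$\<rangle> p < y \<langle>$\<rangle> p}"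
  then have I: "z \<in> I_Z" and cov: "inv_covers y z" using inv_coversD by blast+
  obtain P N where r: "raises y z P N" using inv_covers_raises[OF cov] by blast
  have "weight y z p = - 1" using z by (simp add: weight_def)
  then have "p \<in> N" using raises_weight(1)[OF assms(1) I r, of p] by (simp add: of_bool_def split: if_splits)
  then obtain i where "i < p" "tau_step i p y z"
    using raises_tau_step(2)[OF assms(1) I r] assms(2) by blast
  then show "z \<in> Phi_minus y p" using I cov tau_eq by (fastforce simp: Phi_minus_def)
qed

section \<open>Divided differences\<close>

lemma lookup_map_key_apply [simp]:
  "Poly_Mapping.lookup (Poly_Mapping.map_key (apply w) m) i = Poly_Mapping.lookup m (w \<langle>$\<rangle> i)"
  by (simp add: map_key.rep_eq bij_is_inj)

lemma map_key_apply_zero [simp]: "Poly_Mapping.map_key (apply w) 0 = 0"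
  by (rule poly_mapping_eqI) simp

lemma single_zero_eq_of_int: "(Poly_Mapping.single 0 c :: ipoly) = of_int c"
  using single_of_int[of c, where ?'b = int] by simp

lemma lookup_act: "Poly_Mapping.lookup (act w f) m = Poly_Mapping.lookup f (Poly_Mapping.map_key (apply w) m)"
  by (simp add: act_def map_key.rep_eq inj_map_key_apply)

lemma act_single: "act w (Poly_Mapping.single m c) = Poly_Mapping.single (Poly_Mapping.map_key (apply (inverse w)) m) c"
proof -
  have "Poly_Mapping.map_key (apply w) (Poly_Mapping.map_key (apply (inverse w)) m) = m"
    by (rule poly_mapping_eqI) simp
  then show ?thesis
    unfolding act_def using map_key_single[OF inj_map_key_apply] by metis
qed

lemma act_add [simp]: "act w (f + g) = act w f + act w g"
  unfolding act_def by (rule map_key_plus[OF inj_map_key_apply])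

lemma act_diff [simp]: "act w (f - g) = act w f - act w g"
  by (rule poly_mapping_eqI) (simp add: lookup_act lookup_minus)

lemma act_zero [simp]: "act w 0 = 0"
  using act_diff[of w 0 0] by simp

lemma poly_mapping_single_induct [case_names zero add]:
  assumes "P 0" and "\<And>f k c. P f \<Longrightarrow> P (f + Poly_Mapping.single k c)"
  shows "P (f :: 'a \<Rightarrow>\<^sub>0 'b::monoid_add)"
proof (induction f rule: update_induct)
  case (update f a b)
  have "Poly_Mapping.update a b f = f + Poly_Mapping.single a b"
    using update(1) by (intro poly_mapping_eqI)
      (auto simp: Poly_Mapping.lookup_update lookup_add lookup_single when_def in_keys_iff)
  then show ?case using assms(2)[OF update(3)] by simp
qed (rule assms(1))

lemma act_mult [simp]: "act w (f * g) = act w f * act w g"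
proof (induction f rule: poly_mapping_single_induct)
  case (add f m c)
  have "act w (Poly_Mapping.single m c * g) = act w (Poly_Mapping.single m c) * act w g"
  proof (induction g rule: poly_mapping_single_induct)
    case (add g n d)
    have "act w (Poly_Mapping.single m c * Poly_Mapping.single n d) = act w (Poly_Mapping.single m c) * act w (Poly_Mapping.single n d)"
      by (simp add: mult_single act_single map_key_plus bij_is_inj)
    then show ?case using add by (simp add: algebra_simps)
  qed simp
  then show ?case using add by (simp add: algebra_simps)
qed simp

lemma act_one [simp]: "act w 1 = 1"
  using act_single[of w 0 1] by simp

lemma act_of_int [simp]: "act w (of_int c) = of_int c"
  using act_single[of w 0 c] by (simp add: single_zero_eq_of_int)

lemma act_power [simp]: "act w (f ^ n) = act w f ^ n"
  by (induction n) simp_all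

lemma act_prod: "act w (\<Prod>k\<in>A. f k) = (\<Prod>k\<in>A. act w (f k))"
  by (induction A rule: infinite_finite_induct) simp_all

lemma act_act: "act u (act v f) = act (u * v) f"
  by (rule poly_mapping_eqI)
    (auto simp: lookup_act intro!: arg_cong[where f = "Poly_Mapping.lookup f"] poly_mapping_eqI)

lemma act_identity [simp]: "act 1 f = f"
proof -
  have "Poly_Mapping.map_key (apply 1) m = m" for m :: "int \<Rightarrow>\<^sub>0 nat"
    by (rule poly_mapping_eqI) (subst lookup_map_key_apply, simp)
  then show ?thesis
    by (intro poly_mapping_eqI) (simp only: lookup_act)
qed

lemma act_sref_sref [simp]: "act (sref i) (act (sref i) f) = f"
  by (simp add: act_act)

text \<open>Induction over the ring operations. It avoids computations with exponent vectors in the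
  existence proof for divided differences.\<close>

lemma ipoly_induct [case_names const mult add]:
  fixes P :: "ipoly \<Rightarrow> bool"
  assumes const: "\<And>c. P (of_int c)"
    and mult: "\<And>k f. P f \<Longrightarrow> P (xvar k * f)"
    and add: "\<And>f g. P f \<Longrightarrow> P g \<Longrightarrow> P (f + g)"
  shows "P f"
proof (induction f rule: poly_mapping_single_induct)
  case zero
  then show ?case using const[of 0] by simp
next
  case (add f m c)
  have "P (Poly_Mapping.single m c)"
  proof (induction m rule: poly_mapping_single_induct)
    case zero
    then show ?case using const[of c] by (simp add: single_zero_eq_of_int)
  next
    case (add m k n)
    show ?case
    proof (induction n)
      case 0
      then show ?case using add by simp
    next
      case (Suc n)
      have "Poly_Mapping.single (m + Poly_Mapping.single k (Suc n)) c = xvar k * Poly_Mapping.single (m + Poly_Mapping.single k n) c"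
        by (simp add: xvar_def mult_single single_add[of k 1 n, simplified] add_ac)
      then show ?case using mult[OF Suc] by simp
    qed
  qed
  then show ?case using add assms(3) by blast
qed

lemma xvar_eq_iff: "xvar i = xvar j \<longleftrightarrow> i = j"
proof
  assume "xvar i = xvar j"
  then have "Poly_Mapping.lookup (xvar i) (Poly_Mapping.single i 1) = Poly_Mapping.lookup (xvar j) (Poly_Mapping.single i 1)" by simp
  then have "(Poly_Mapping.single j 1 :: int \<Rightarrow>\<^sub>0 nat) = Poly_Mapping.single i 1"
    by (simp add: xvar_def lookup_single when_def split: if_splits)
  then have "Poly_Mapping.lookup (Poly_Mapping.single j 1 :: int \<Rightarrow>\<^sub>0 nat) i = Poly_Mapping.lookup (Poly_Mapping.single i 1) i" by simp
  then show "i = j" by (simp add: lookup_single when_def split: if_splits)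
qed simp

lemma xvar_diff_neq_0: "i \<noteq> j \<Longrightarrow> xvar i - xvar j \<noteq> 0"
  by (simp add: xvar_eq_iff)

text \<open>The Leibniz rule produces the quotient for a product from the quotients of its factors.\<close>

lemma divdiff_exists: "\<exists>g. (xvar i - xvar (i + 1)) * g = f - act (sref i) f"
proof (induction f rule: ipoly_induct)
  case (const c)
  show ?case by (rule exI[of _ 0]) simp
next
  case (add f g)
  then obtain f' g' where "(xvar i - xvar (i + 1)) * f' = f - act (sref i) f"
    "(xvar i - xvar (i + 1)) * g' = g - act (sref i) g" by blast
  then show ?case by (intro exI[of _ "f' + g'"]) (simp add: algebra_simps)
next
  case (mult k f)
  then obtain g where g: "(xvar i - xvar (i + 1)) * g = f - act (sref i) f" by blast
  obtain e where e: "(xvar i - xvar (i + 1)) * e = xvar k - act (sref i) (xvar k)"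
  proof -
    have "(xvar i - xvar (i + 1)) * (if k = i then 1 else if k = i + 1 then - 1 else 0)
      = xvar k - act (sref i) (xvar k)"
      by (simp add: act_xvar apply_sref)
    then show ?thesis using that by blast
  qed
  have "(xvar i - xvar (i + 1)) * (e * f + act (sref i) (xvar k) * g)
    = ((xvar i - xvar (i + 1)) * e) * f + act (sref i) (xvar k) * ((xvar i - xvar (i + 1)) * g)"
    by (simp only: algebra_simps)
  also have "\<dots> = xvar k * f - act (sref i) (xvar k * f)"
    unfolding e g by (simp add: algebra_simps)
  finally show ?case by blast
qed

lemma divdiffI:
  assumes "(xvar i - xvar (i + 1)) * g = f - act (sref i) f"
  shows "divdiff i f = g"
  unfolding divdiff_def
proof (rule the_equality[where P = "\<lambda>g. (xvar i - xvar (i + 1)) * g = f - act (sref i) f", OF assms])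
  fix h assume "(xvar i - xvar (i + 1)) * h = f - act (sref i) f"
  then have "(xvar i - xvar (i + 1)) * h = (xvar i - xvar (i + 1)) * g" using assms by simp
  then show "h = g" using xvar_diff_neq_0[of i "i + 1"] by simp
qed

lemma divdiff_eq: "(xvar i - xvar (i + 1)) * divdiff i f = f - act (sref i) f"
  using divdiff_exists divdiffI by metis

lemma divdiff_add: "divdiff i (f + g) = divdiff i f + divdiff i g"
  by (rule divdiffI) (simp add: distrib_left divdiff_eq)

lemma divdiff_diff: "divdiff i (f - g) = divdiff i f - divdiff i g"
  by (rule divdiffI) (simp add: right_diff_distrib divdiff_eq)

lemma divdiff_mult: "divdiff i (f * g) = divdiff i f * g + act (sref i) f * divdiff i g"
proof (rule divdiffI)
  have "(xvar i - xvar (i + 1)) * (divdiff i f * g + act (sref i) f * divdiff i g)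
    = ((xvar i - xvar (i + 1)) * divdiff i f) * g + act (sref i) f * ((xvar i - xvar (i + 1)) * divdiff i g)"
    by (simp only: algebra_simps)
  also have "\<dots> = f * g - act (sref i) (f * g)"
    unfolding divdiff_eq by (simp add: algebra_simps)
  finally show "(xvar i - xvar (i + 1)) * (divdiff i f * g + act (sref i) f * divdiff i g)
    = f * g - act (sref i) (f * g)" .
qed

lemma divdiff_symmetric: "act (sref i) f = f \<Longrightarrow> divdiff i f = 0"
  by (rule divdiffI) simp

lemma divdiff_eq_0_iff: "divdiff i f = 0 \<longleftrightarrow> act (sref i) f = f"
  using divdiff_eq[of i f] divdiff_symmetric[of i f] by auto

lemma divdiff_zero [simp]: "divdiff i 0 = 0"
  and divdiff_of_int [simp]: "divdiff i (of_int c) = 0"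
  by (simp_all add: divdiff_symmetric)

lemma divdiff_of_int_mult: "divdiff i (of_int c * f) = of_int c * divdiff i f"
  by (simp add: divdiff_mult)

lemma divdiff_sum: "divdiff i (\<Sum>k\<in>A. f k) = (\<Sum>k\<in>A. divdiff i (f k))"
  by (induction A rule: infinite_finite_induct) (simp_all add: divdiff_add)

lemma divdiff_xvar: "divdiff i (xvar k) = of_int (of_bool (k = i) - of_bool (k = i + 1))"
  by (rule divdiffI) (simp add: act_xvar apply_sref)

lemma act_divdiff: "act (sref i) (divdiff i f) = divdiff i f"
proof -
  have "act (sref i) ((xvar i - xvar (i + 1)) * divdiff i f) = act (sref i) (f - act (sref i) f)"
    by (simp only: divdiff_eq)
  then have "(xvar (i + 1) - xvar i) * act (sref i) (divdiff i f) = act (sref i) f - f"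
    by (simp add: act_xvar)
  then have "(xvar i - xvar (i + 1)) * act (sref i) (divdiff i f) = f - act (sref i) f"
    by (simp add: algebra_simps)
  then show ?thesis using divdiffI by metis
qed

lemma divdiff_divdiff: "divdiff i (divdiff i f) = 0"
  by (rule divdiff_symmetric) (rule act_divdiff)

lemma sref_commute:
  assumes "i + 1 < j \<or> j + 1 < i"
  shows "sref i * sref j = sref j * sref i"
  by (rule perm_eqI) (use assms in \<open>auto simp: apply_sref\<close>)

lemma sref_braid: "sref i * sref (i + 1) * sref i = sref (i + 1) * sref i * sref (i + 1)"
  by (rule perm_eqI) (auto simp: apply_sref)

text \<open>Clearing denominators turns either side into the same combination of the images of \<open>f\<close>
  under the group generated by the two transpositions.\<close>

lemma divdiff_commute:
  assumes "i + 1 < j \<or> j + 1 < i"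
  shows "divdiff i (divdiff j f) = divdiff j (divdiff i f)"
proof -
  define p q where "p = xvar i - xvar (i + 1)" and "q = xvar j - xvar (j + 1)"
  have expand: "(xvar i - xvar (i + 1)) * (xvar j - xvar (j + 1)) * divdiff i (divdiff j f)
     = f - act (sref j) f - act (sref i) f + act (sref i * sref j) f"
    if "i + 1 < j \<or> j + 1 < i" for i j
  proof -
    let ?p = "xvar i - xvar (i + 1)" and ?q = "xvar j - xvar (j + 1)"
    have "act (sref i) ?q = ?q" using that by (auto simp: act_xvar apply_sref)
    then have "?q * act (sref i) (divdiff j f) = act (sref i) (?q * divdiff j f)" by simp
    also have "\<dots> = act (sref i) f - act (sref i * sref j) f"
      unfolding divdiff_eq by (simp add: act_act)
    finally have 1: "?q * act (sref i) (divdiff j f) = act (sref i) f - act (sref i * sref j) f" .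
    have "?p * ?q * divdiff i (divdiff j f) = ?q * (?p * divdiff i (divdiff j f))"
      by (simp only: ac_simps)
    also have "\<dots> = ?q * divdiff j f - ?q * act (sref i) (divdiff j f)"
      by (simp only: divdiff_eq[of i] right_diff_distrib)
    also have "\<dots> = f - act (sref j) f - act (sref i) f + act (sref i * sref j) f"
      unfolding 1 divdiff_eq by simp
    finally show ?thesis .
  qed
  have "p * q * divdiff i (divdiff j f) = p * q * divdiff j (divdiff i f)"
    using expand[OF assms] expand[of j i] assms sref_commute[OF assms]
    by (auto simp add: p_def q_def mult.commute)
  moreover have "p * q \<noteq> 0"
    using xvar_diff_neq_0[of i "i + 1"] xvar_diff_neq_0[of j "j + 1"] by (simp add: p_def q_def)
  ultimately show ?thesis by simp
qed

text \<open>As in the previous lemma: after multiplication by the Vandermonde product \<open>(a - b)(a -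
  c)(b - c)\<close> both sides become the antisymmetrization of \<open>f\<close> over the six permutations of three
  variables.\<close>

lemma divdiff_braid:
  "divdiff i (divdiff (i + 1) (divdiff i f)) = divdiff (i + 1) (divdiff i (divdiff (i + 1) f))"
proof -
  define a b c where "a = xvar i" and "b = xvar (i + 1)" and "c = xvar (i + 1 + 1)"
  define s t where "s = act (sref i)" and "t = act (sref (i + 1))"
  define D E where "D = divdiff i" and "E = divdiff (i + 1)"
  have D: "(a - b) * D f = f - s f" and E: "(b - c) * E f = f - t f" for f
    using divdiff_eq[of i f] divdiff_eq[of "i + 1" f] by (simp_all add: a_def b_def c_def s_def t_def D_def E_def)
  \<comment> \<open>\<open>s\<close> and \<open>t\<close> permute \<open>a\<close>, \<open>b\<close>, \<open>c\<close>; they move the factors of the product into each other.\<close>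
  have st: "s a = b" "s b = a" "s c = c" "t a = a" "t b = c" "t c = b"
    by (simp_all add: a_def b_def c_def s_def t_def act_xvar apply_sref)
  have hom: "s (f - g) = s f - s g" "t (f - g) = t f - t g" "s (f * g) = s f * s g" "t (f * g) = t f * t g" for f g
    by (simp_all add: s_def t_def)
  have ss: "s (s f) = f" "t (t f) = f" "s (t (s f)) = t (s (t f))" for f
    using sref_braid[of i] by (simp_all add: s_def t_def act_act mult.assoc)
  have tD: "(a - c) * t (D f) = t f - t (s f)" for f
    using arg_cong[OF D[of f], of t] by (simp add: hom st)
  have stD: "(b - c) * s (t (D f)) = s (t f) - s (t (s f))" for f
    using arg_cong[OF tD[of f], of s] by (simp add: hom st)
  have sE: "(a - c) * s (E f) = s f - s (t f)" for f
    using arg_cong[OF E[of f], of s] by (simp add: hom st)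
  have tsE: "(a - b) * t (s (E f)) = t (s f) - t (s (t f))" for f
    using arg_cong[OF sE[of f], of t] by (simp add: hom st)
  have "(a - b) * (a - c) * (b - c) * D (E (D f))
      = (a - c) * (b - c) * ((a - b) * D (E (D f)))" by (simp only: ac_simps)
  also have "\<dots> = (a - c) * ((b - c) * E (D f)) - (b - c) * ((a - c) * s (E (D f)))"
    unfolding D by (simp add: algebra_simps)
  also have "\<dots> = (a - c) * (D f - t (D f)) - (b - c) * (s (D f) - s (t (D f)))"
    unfolding E sE ..
  also have "s (D f) = D f" by (simp add: s_def D_def act_divdiff)
  also have "(a - c) * (D f - t (D f)) - (b - c) * (D f - s (t (D f)))
      = (a - b) * D f - (a - c) * t (D f) + (b - c) * s (t (D f))" by (simp add: algebra_simps)
  also have "\<dots> = f - s f - t f + t (s f) + s (t f) - s (t (s f))"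
    unfolding D tD stD by (simp add: algebra_simps)
  finally have 1: "(a - b) * (a - c) * (b - c) * D (E (D f)) = \<dots>" .
  have "(a - b) * (a - c) * (b - c) * E (D (E f))
      = (a - c) * (a - b) * ((b - c) * E (D (E f)))" by (simp only: ac_simps)
  also have "\<dots> = (a - c) * ((a - b) * D (E f)) - (a - b) * ((a - c) * t (D (E f)))"
    unfolding E by (simp add: algebra_simps)
  also have "\<dots> = (a - c) * (E f - s (E f)) - (a - b) * (t (E f) - t (s (E f)))"
    unfolding D tD ..
  also have "t (E f) = E f" by (simp add: t_def E_def act_divdiff)
  also have "(a - c) * (E f - s (E f)) - (a - b) * (E f - t (s (E f)))
      = (b - c) * E f - (a - c) * s (E f) + (a - b) * t (s (E f))" by (simp add: algebra_simps)
  also have "\<dots> = f - s f - t f + t (s f) + s (t f) - s (t (s f))"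
    unfolding E sE tsE by (simp add: algebra_simps ss)
  finally have "(a - b) * (a - c) * (b - c) * D (E (D f)) = (a - b) * (a - c) * (b - c) * E (D (E f))"
    using 1 by simp
  moreover have "(a - b) * (a - c) * (b - c) \<noteq> 0"
    using xvar_diff_neq_0[of i "i + 1"] xvar_diff_neq_0[of i "i + 1 + 1"] xvar_diff_neq_0[of "i + 1" "i + 1 + 1"]
    by (simp add: a_def b_def c_def)
  ultimately show ?thesis by (simp add: D_def E_def)
qed

section \<open>Reduced words\<close>

lemma len_prod_list_le: "len (prod_list (map sref a)) \<le> length a"
proof (induction a)
  case (Cons i a)
  have "len (sref i * w) \<le> Suc (len w)" for w
    using len_sref_mult_ascent[of i w] len_sref_mult_descent[of i w]
    by (cases "descent i (inverse w)") auto
  from this[of "prod_list (map sref a)"] Cons show ?case by simp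
qed simp

lemma reduced_word_Nil_iff [simp]: "reduced_word [] w \<longleftrightarrow> w = 1"
  by (auto simp: reduced_word_def)

lemma reduced_word_Cons_iff:
  "reduced_word (i # a) w \<longleftrightarrow> descent i (inverse w) \<and> reduced_word a (sref i * w)"
proof
  assume r: "reduced_word (i # a) w"
  then have w: "sref i * w = prod_list (map sref a)" and len: "len w = Suc (length a)"
    by (simp_all add: reduced_word_def)
  have "len (sref i * w) \<le> length a" unfolding w by (rule len_prod_list_le)
  then have d: "descent i (inverse w)" using len len_sref_mult_ascent[of i w] by fastforce
  then show "descent i (inverse w) \<and> reduced_word a (sref i * w)"
    using w len len_sref_mult_descent[OF d] by (simp add: reduced_word_def)
next
  assume "descent i (inverse w) \<and> reduced_word a (sref i * w)"
  then show "reduced_word (i # a) w"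
    using len_sref_mult_descent[of i w]
    by (simp add: reduced_word_def) (metis sref_cancel(2))
qed

lemma ex_reduced_word: "\<exists>a. reduced_word a w"
proof (induction "len w" arbitrary: w)
  case 0
  then have "reduced_word [] w" by simp
  then show ?case by blast
next
  case (Suc n)
  then have "inverse w \<noteq> 1" by (metis len_inverse len_one nat.distinct(1))
  then obtain i where i: "descent i (inverse w)" using ex_descent by blast
  then have "n = len (sref i * w)" using len_sref_mult_descent[OF i] Suc(2) by simp
  then obtain a where "reduced_word a (sref i * w)" using Suc(1) by blast
  then show ?case using i reduced_word_Cons_iff by blast
qed

text \<open>Matsumoto's theorem. If two reduced words start with different letters \<open>i\<close> and \<open>j\<close>, both
  are left descents of \<open>w\<close>, so \<open>w\<close> also has reduced words starting with the two sides of the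
  braid relation for \<open>i\<close> and \<open>j\<close>; the induction hypothesis connects them to the given words. It
  is applied twice, to divided differences and to the Demazure product.\<close>

theorem foldr_reduced_word_unique:
  fixes T :: "int \<Rightarrow> 'a \<Rightarrow> 'a"
  assumes comm: "\<And>i j x. i + 1 < j \<or> j + 1 < i \<Longrightarrow> T i (T j x) = T j (T i x)"
    and braid: "\<And>i x. T i (T (i + 1) (T i x)) = T (i + 1) (T i (T (i + 1) x))"
    and "reduced_word a w" "reduced_word b w"
  shows "foldr T a x = foldr T b x"
  using assms(3,4)
proof (induction "len w" arbitrary: w a b)
  case 0
  then show ?case by (simp add: reduced_word_def)
next
  case (Suc n)
  have IH: "foldr T a x = foldr T b x" if "reduced_word a v" "reduced_word b v" "len v = n" for a b v
    using Suc(1)[of v a b] that by simp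
  obtain i a' j b' where ab: "a = i # a'" "b = j # b'"
    using Suc(2-4) by (cases a; cases b) (auto simp: reduced_word_def)
  have i: "descent i (inverse w)" "reduced_word a' (sref i * w)"
    and j: "descent j (inverse w)" "reduced_word b' (sref j * w)"
    using Suc(3,4) by (simp_all add: ab reduced_word_Cons_iff)
  have len: "len (sref i * w) = n" "len (sref j * w) = n"
    using len_sref_mult_descent[OF i(1)] len_sref_mult_descent[OF j(1)] Suc(2) by simp_all
  have adjacent: "T i (foldr T a x) = T (i + 1) (foldr T b x)"
    if i: "descent i (inverse w)" "reduced_word a (sref i * w)"
      and j: "descent (i + 1) (inverse w)" "reduced_word b (sref (i + 1) * w)"
      and len: "len (sref i * w) = n" "len (sref (i + 1) * w) = n" for i a b
  proof -
    obtain c where c: "reduced_word c (sref i * (sref (i + 1) * (sref i * w)))"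
      using ex_reduced_word by blast
    then have c': "reduced_word c (sref (i + 1) * (sref i * (sref (i + 1) * w)))"
      using sref_braid[of i] by (metis mult.assoc)
    have less: "inverse w \<langle>$\<rangle> (i + 1) < inverse w \<langle>$\<rangle> i" "inverse w \<langle>$\<rangle> (i + 1 + 1) < inverse w \<langle>$\<rangle> (i + 1)"
      using i j by (simp_all add: descent_def)
    have "reduced_word ((i + 1) # i # c) (sref i * w)"
      using c less unfolding reduced_word_Cons_iff
      by (simp add: perm.inverse_distrib_swap) (simp add: descent_def apply_sref)
    moreover have "reduced_word (i # (i + 1) # c) (sref (i + 1) * w)"
      using c' less unfolding reduced_word_Cons_iff
      by (simp add: perm.inverse_distrib_swap) (simp add: descent_def apply_sref)
    ultimately have "foldr T a x = T (i + 1) (T i (foldr T c x))"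
      "foldr T b x = T i (T (i + 1) (foldr T c x))"
      using IH i j len by fastforce+
    then show ?thesis using braid by simp
  qed
  consider "i = j" | "j = i + 1" | "i = j + 1" | "i + 1 < j \<or> j + 1 < i" by linarith
  then show ?case
  proof cases
    case 1
    then show ?thesis using IH[OF i(2)] j(2) len ab by simp
  next
    case 2
    then show ?thesis using adjacent[of i a' b'] i j len ab by simp
  next
    case 3
    then show ?thesis using adjacent[of j b' a'] i j len ab by simp
  next
    case 4
    obtain c where c: "reduced_word c (sref j * (sref i * w))"
      using ex_reduced_word by blast
    then have c': "reduced_word c (sref i * (sref j * w))"
      using sref_commute[OF 4] by (metis mult.assoc)
    have "reduced_word (j # c) (sref i * w)"
      using c j(1) 4 unfolding reduced_word_Cons_iff
      by (auto simp: perm.inverse_distrib_swap descent_def apply_sref)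
    moreover have "reduced_word (i # c) (sref j * w)"
      using c' i(1) 4 unfolding reduced_word_Cons_iff
      by (auto simp: perm.inverse_distrib_swap descent_def apply_sref)
    ultimately have "foldr T a' x = T j (foldr T c x)" "foldr T b' x = T i (foldr T c x)"
      using IH i j len by fastforce+
    then show ?thesis using comm[OF 4] by (simp add: ab)
  qed
qed

section \<open>Schubert polynomials\<close>

lemma divdiff_perm_reduced_word: "reduced_word a w \<Longrightarrow> divdiff_perm w f = foldr divdiff a f"
  unfolding divdiff_perm_def
  by (rule foldr_reduced_word_unique)
    (erule divdiff_commute, rule divdiff_braid, erule someI, assumption)

lemma divdiff_perm_one [simp]: "divdiff_perm 1 f = f"
  using divdiff_perm_reduced_word[of "[]"] by simp

lemma divdiff_divdiff_perm:
  "divdiff i (divdiff_perm w f) = (if descent i (inverse w) then 0 else divdiff_perm (sref i * w) f)"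
proof -
  have asc: "divdiff_perm (sref i * w) f = divdiff i (divdiff_perm w f)" if "\<not> descent i (inverse w)" for w
  proof -
    obtain a where a: "reduced_word a w" using ex_reduced_word by blast
    then have "reduced_word (i # a) (sref i * w)"
      using that by (simp add: reduced_word_Cons_iff)
    then show ?thesis using divdiff_perm_reduced_word a by fastforce
  qed
  show ?thesis
  proof (cases "descent i (inverse w)")
    case True
    then have "divdiff_perm w f = divdiff i (divdiff_perm (sref i * w) f)"
      using asc[of "sref i * w"] by simp
    then show ?thesis using True by (simp add: divdiff_divdiff)
  qed (simp add: asc)
qed

lemma divdiff_perm_mult_sref:
  assumes "\<not> descent i w"
  shows "divdiff_perm (w * sref i) f = divdiff_perm w (divdiff i f)"
proof -
  obtain a where a: "reduced_word a w" using ex_reduced_word by blast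
  then have "reduced_word (a @ [i]) (w * sref i)"
    using len_mult_sref_ascent[OF assms] by (simp add: reduced_word_def)
  then show ?thesis using a by (simp add: divdiff_perm_reduced_word)
qed

definition staircase :: "nat \<Rightarrow> ipoly" where
  "staircase n = (\<Prod>i = 1..n. xvar (int i) ^ (n - i))"

lemma schubert_eq:
  "schubert v = divdiff_perm (inverse v * longest n) (staircase n)" if "n = (LEAST n. v \<in> S_fin n)"
  using that by (simp add: schubert_def staircase_def Let_def)

lemma monomial_symmetric:
  fixes e :: "nat \<Rightarrow> nat"
  assumes "finite A" "i \<in> A" "Suc i \<in> A" "e i = e (Suc i)"
  shows "act (sref (int i)) (\<Prod>k\<in>A. xvar (int k) ^ e k) = (\<Prod>k\<in>A. xvar (int k) ^ e k)"
proof -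
  define B where "B = A - {i, Suc i}"
  have A: "A = insert i (insert (Suc i) B)" "i \<notin> insert (Suc i) B" "Suc i \<notin> B" "finite B"
    using assms by (auto simp: B_def)
  have "(\<Prod>k\<in>B. act (sref (int i)) (xvar (int k) ^ e k)) = (\<Prod>k\<in>B. xvar (int k) ^ e k)"
    by (rule prod.cong) (auto simp: B_def act_xvar apply_sref)
  moreover have "sref (int i) \<langle>$\<rangle> (1 + int i) = int i" by (simp add: apply_sref)
  ultimately show ?thesis
    using A assms(4) by (simp add: act_prod act_xvar ac_simps)
qed

text \<open>The stages in the passage from \<open>staircase (Suc n)\<close>, for \<open>j = 0\<close>, to \<open>staircase n\<close>, for \<open>j
  = n\<close>: the operator \<open>\<partial>\<^bsub>j+1\<^esub>\<close> lowers the exponent of \<open>x\<^bsub>j+1\<^esub>\<close> by one, since the rest of the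
  monomial is symmetric in \<open>x\<^bsub>j+1\<^esub>\<close> and \<open>x\<^bsub>j+2\<^esub>\<close>.\<close>

definition partial_staircase :: "nat \<Rightarrow> nat \<Rightarrow> ipoly" where
  "partial_staircase n j = (\<Prod>i = 1..Suc n. xvar (int i) ^ (if i \<le> j then n - i else Suc n - i))"

lemma divdiff_partial_staircase:
  assumes "j < n"
  shows "divdiff (int (Suc j)) (partial_staircase n j) = partial_staircase n (Suc j)"
proof -
  have "partial_staircase n j = xvar (int (Suc j)) * partial_staircase n (Suc j)"
  proof -
    let ?A = "{1..Suc n} - {Suc j}"
    have split: "partial_staircase n k
      = xvar (int (Suc j)) ^ (if Suc j \<le> k then n - Suc j else Suc n - Suc j)
        * (\<Prod>i\<in>?A. xvar (int i) ^ (if i \<le> k then n - i else Suc n - i))" for k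
      unfolding partial_staircase_def using assms by (intro prod.remove) auto
    have "(\<Prod>i\<in>?A. xvar (int i) ^ (if i \<le> j then n - i else Suc n - i))
      = (\<Prod>i\<in>?A. xvar (int i) ^ (if i \<le> Suc j then n - i else Suc n - i))"
      by (rule prod.cong) auto
    moreover have "n - j = Suc (n - Suc j)" using assms by simp
    ultimately show ?thesis
      unfolding split by (simp add: ac_simps)
  qed
  moreover have "act (sref (int (Suc j))) (partial_staircase n (Suc j)) = partial_staircase n (Suc j)"
    unfolding partial_staircase_def using assms by (intro monomial_symmetric) auto
  ultimately show ?thesis
    by (simp add: divdiff_mult divdiff_xvar divdiff_symmetric act_xvar)
qed

text \<open>This is \<open>s\<^sub>n s\<^bsub>n-1\<^esub> \<dots> s\<^bsub>n-j+1\<^esub>\<close>, so that \<open>tail n n\<close> is the factor by which the longest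
  elements for \<open>n\<close> and \<open>n + 1\<close> differ.\<close>

fun tail :: "nat \<Rightarrow> nat \<Rightarrow> int perm" where
  "tail n 0 = 1"
| "tail n (Suc j) = tail n j * sref (int n - int j)"

lemma apply_tail:
  "j \<le> n \<Longrightarrow> tail n j \<langle>$\<rangle> k = (if k = int n - int j + 1 then int n + 1
     else if int n - int j + 1 < k \<and> k \<le> int n + 1 then k - 1 else k)"
  by (induction j arbitrary: k) (auto simp: apply_sref)

lemma apply_longest: "longest n \<langle>$\<rangle> i = (if 1 \<le> i \<and> i \<le> int n then int n + 1 - i else i)"
  by (simp add: longest.rep_eq)

lemma longest_Suc: "longest (Suc n) = longest n * tail n n"
  by (rule perm_eqI) (auto simp: apply_longest apply_tail)

lemma divdiff_perm_tail:
  assumes "affected u \<subseteq> {1..int n}" "j \<le> n"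
  shows "divdiff_perm (u * tail n j) (partial_staircase n (n - j)) = divdiff_perm u (partial_staircase n n)"
  using assms(2)
proof (induction j)
  case (Suc j)
  have "\<not> descent (int n - int j) (u * tail n j)"
  proof -
    have "u \<langle>$\<rangle> (int n + 1) = int n + 1" using apply_outside[OF assms(1)] by simp
    moreover have "u \<langle>$\<rangle> (int n - int j) \<le> int n"
      using apply_inside[OF assms(1), of "int n - int j"] Suc.prems by simp
    ultimately show ?thesis using Suc.prems by (simp add: not_descent_iff apply_tail)
  qed
  then have "divdiff_perm (u * tail n (Suc j)) (partial_staircase n (n - Suc j))
    = divdiff_perm (u * tail n j) (divdiff (int n - int j) (partial_staircase n (n - Suc j)))"
    using divdiff_perm_mult_sref[of "int n - int j" "u * tail n j"] by (simp add: mult.assoc)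
  also have "divdiff (int n - int j) (partial_staircase n (n - Suc j)) = partial_staircase n (n - j)"
    using divdiff_partial_staircase[of "n - Suc j" n] Suc.prems by (simp add: Suc_diff_Suc of_nat_diff)
  finally show ?case using Suc by simp
qed simp

lemma partial_staircase_all: "partial_staircase n n = staircase n"
  by (simp add: partial_staircase_def staircase_def)

lemma partial_staircase_none: "partial_staircase n 0 = staircase (Suc n)"
  unfolding partial_staircase_def staircase_def by (rule prod.cong) auto

lemma affected_longest: "affected (longest n) \<subseteq> {1..int n}"
  by (auto simp: in_affected apply_longest split: if_splits)

lemma affected_mult_subset: "affected u \<subseteq> A \<Longrightarrow> affected v \<subseteq> A \<Longrightarrow> affected (u * v) \<subseteq> A"
  using affected_times[of u v] by blast

text \<open>Stability: \<open>w\<^bsub>n+1\<^esub> = w\<^sub>n s\<^sub>n \<dots> s\<^sub>1\<close>, and \<open>\<partial>\<^sub>n \<dots> \<partial>\<^sub>1\<close> takes one staircase monomial to the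
  next smaller one.\<close>

lemma schubert_eq_any:
  assumes "v \<in> S_fin n"
  shows "schubert v = divdiff_perm (inverse v * longest n) (staircase n)"
proof -
  define m where "m = (LEAST n. v \<in> S_fin n)"
  have m: "v \<in> S_fin m" unfolding m_def using assms by (rule LeastI)
  have "m \<le> n" unfolding m_def using assms by (rule Least_le)
  then show ?thesis
    using assms
  proof (induction n rule: dec_induct)
    case base
    then show ?case using schubert_eq[OF m_def] by simp
  next
    case (step n)
    have "v \<in> S_fin n" using m step(1) by (fastforce simp: S_fin_def)
    have u: "affected (inverse v * longest n) \<subseteq> {1..int n}"
      using \<open>v \<in> S_fin n\<close> affected_longest by (intro affected_mult_subset) (simp_all add: S_fin_def)
    have "schubert v = divdiff_perm (inverse v * longest n) (partial_staircase n n)"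
      using step(3) \<open>v \<in> S_fin n\<close> by (simp add: partial_staircase_all)
    also have "\<dots> = divdiff_perm (inverse v * longest (Suc n)) (staircase (Suc n))"
      using divdiff_perm_tail[OF u, of n] by (simp add: partial_staircase_none longest_Suc mult.assoc)
    finally show ?case .
  qed
qed

lemma S_infty_S_fin:
  assumes "v \<in> S_infty"
  obtains N where "N \<ge> M" "v \<in> S_fin N"
proof -
  obtain l u where "affected v \<subseteq> {l..u}" using ex_affected_bounds by blast
  then have "affected v \<subseteq> {1..int (max M (nat u))}"
    using assms by (auto simp: S_infty_def subset_iff nat_le_iff max_def)
  then show ?thesis using that[of "max M (nat u)"] by (simp add: S_fin_def)
qed

lemma affected_sref: "affected (sref i) = {i, i + 1}"
  by (auto simp: in_affected apply_sref split: if_splits)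

lemma descent_longest_mult:
  assumes "v \<in> S_fin N" "1 \<le> i" "i < int N"
  shows "descent i (longest N * v) \<longleftrightarrow> \<not> descent i v"
proof -
  have "v \<langle>$\<rangle> k \<in> {1..int N}" if "k \<in> {1..int N}" for k
    using apply_inside[OF _ that] assms(1) by (simp add: S_fin_def)
  from this[of i] this[of "i + 1"] show ?thesis
    using assms(2,3) by (auto simp: not_descent_iff) (auto simp: descent_def apply_longest)
qed

lemma mult_sref_S_fin: "v \<in> S_fin N \<Longrightarrow> 1 \<le> i \<Longrightarrow> i < int N \<Longrightarrow> v * sref i \<in> S_fin N"
  unfolding S_fin_def by (simp add: affected_mult_subset affected_sref)

lemma inverse_longest [simp]: "inverse (longest n) = longest n"
  by (rule perm.inverse_unique) (auto simp: perm_eq_iff apply_longest)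

theorem divdiff_schubert:
  assumes "v \<in> S_infty" "1 \<le> i"
  shows "divdiff i (schubert v) = (if descent i v then schubert (v * sref i) else 0)"
proof -
  obtain N where N: "N \<ge> nat (i + 1)" "v \<in> S_fin N" using S_infty_S_fin[OF assms(1)] .
  then have i: "i < int N" by simp
  have "divdiff i (schubert v) = divdiff i (divdiff_perm (inverse v * longest N) (staircase N))"
    by (simp add: schubert_eq_any[OF N(2)])
  also have "\<dots> = (if descent i v then divdiff_perm (sref i * (inverse v * longest N)) (staircase N) else 0)"
    unfolding divdiff_divdiff_perm
    using descent_longest_mult[OF N(2) assms(2) i] by (simp add: perm.inverse_distrib_swap)
  also have "\<dots> = (if descent i v then schubert (v * sref i) else 0)"
    using schubert_eq_any[OF mult_sref_S_fin[OF N(2) assms(2) i]]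
    by (simp add: perm.inverse_distrib_swap mult.assoc)
  finally show ?thesis .
qed

lemma schubert_one: "schubert 1 = 1"
proof -
  have "1 \<in> S_fin 0" by (simp add: S_fin_def)
  moreover have "longest 0 = 1" by (rule perm_eqI) (simp add: apply_longest)
  ultimately show ?thesis using schubert_eq_any[of 1 0] by (simp add: staircase_def)
qed

section \<open>Homogeneity\<close>

text \<open>Homogeneous polynomials of degree \<open>d\<close> in the variables with positive index, generated by
  multiplication with variables. This form is preserved by divided differences for the same
  reason for which these exist, the Leibniz rule.\<close>

inductive homogeneous :: "nat \<Rightarrow> ipoly \<Rightarrow> bool" where
  const: "homogeneous 0 (of_int c)"
| mult: "1 \<le> k \<Longrightarrow> homogeneous d f \<Longrightarrow> homogeneous (Suc d) (xvar k * f)"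
| add: "homogeneous d f \<Longrightarrow> homogeneous d g \<Longrightarrow> homogeneous d (f + g)"

lemma homogeneous_zero: "homogeneous d 0"
proof (induction d)
  case 0
  then show ?case using homogeneous.const[of 0] by simp
next
  case (Suc d)
  then show ?case using homogeneous.mult[of 1 d 0] by simp
qed

lemma homogeneous_of_int_mult: "homogeneous d f \<Longrightarrow> homogeneous d (of_int c * f)"
proof (induction rule: homogeneous.induct)
  case (const c')
  then show ?case using homogeneous.const[of "c * c'"] by simp
next
  case (mult k d f)
  then show ?case using homogeneous.mult by (simp add: mult.left_commute)
qed (simp add: distrib_left homogeneous.add)

lemma homogeneous_divdiff:
  assumes "homogeneous d f" "1 \<le> i"
  shows "case d of 0 \<Rightarrow> divdiff i f = 0 | Suc d' \<Rightarrow> homogeneous d' (divdiff i f)"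
  using assms(1)
proof (induction rule: homogeneous.induct)
  case (mult k d f)
  have "1 \<le> sref i \<langle>$\<rangle> k" using mult(1) assms(2) by (simp add: apply_sref)
  then have "homogeneous d (xvar (sref i \<langle>$\<rangle> k) * divdiff i f)"
    using mult(3) by (cases d) (simp_all add: homogeneous_zero homogeneous.mult)
  moreover have "homogeneous d (divdiff i (xvar k) * f)"
    unfolding divdiff_xvar by (rule homogeneous_of_int_mult[OF mult(2)])
  ultimately show ?case
    by (simp add: divdiff_mult act_xvar homogeneous.add)
next
  case (add d f g)
  then show ?case by (auto simp: divdiff_add homogeneous.add split: nat.splits)
qed simp

lemma homogeneous_power_mult: "1 \<le> k \<Longrightarrow> homogeneous d f \<Longrightarrow> homogeneous (n + d) (xvar k ^ n * f)"
  by (induction n) (simp_all add: mult.assoc homogeneous.mult)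

lemma homogeneous_monomial:
  fixes e :: "nat \<Rightarrow> nat"
  shows "\<exists>d. homogeneous d (\<Prod>i = 1..n. xvar (int i) ^ e i)"
proof (induction n)
  case 0
  then show ?case using homogeneous.const[of 1] by auto
next
  case (Suc n)
  then obtain d where d: "homogeneous d (\<Prod>i = 1..n. xvar (int i) ^ e i)" by blast
  have "homogeneous (e (Suc n) + d) (xvar (int (Suc n)) ^ e (Suc n) * (\<Prod>i = 1..n. xvar (int i) ^ e i))"
    by (rule homogeneous_power_mult[OF _ d]) simp
  then show ?case by (auto simp: mult.commute)
qed

lemma homogeneous_positive_vars:
  "homogeneous d f \<Longrightarrow> m \<in> Poly_Mapping.keys f \<Longrightarrow> Poly_Mapping.keys m \<subseteq> {1..}"
proof (induction arbitrary: m rule: homogeneous.induct)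
  case (const c)
  then have "m = 0" using single_zero_eq_of_int[of c, symmetric] by (simp split: if_splits)
  then show ?case by simp
next
  case (mult k d f)
  then obtain m' where m': "m = Poly_Mapping.single k 1 + m'" "m' \<in> Poly_Mapping.keys f"
    using keys_mult[of "xvar k" f] by (auto simp: xvar_def)
  have "Poly_Mapping.keys m' \<subseteq> {1..}" by (rule mult.IH[OF m'(2)])
  then show ?case using mult.hyps(1) keys_add[of "Poly_Mapping.single k 1" m'] by (auto simp: m'(1))
next
  case (add d f g)
  then show ?case using keys_add[of f g] by blast
qed

lemma homogeneous_Suc_no_constant:
  assumes "homogeneous d f" "d \<noteq> 0"
  shows "Poly_Mapping.lookup f 0 = 0"
  using assms
proof (induction rule: homogeneous.induct)
  case (mult k d f)
  have "0 \<notin> Poly_Mapping.keys (xvar k * f)"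
  proof
    assume "0 \<in> Poly_Mapping.keys (xvar k * f)"
    then obtain m' where "0 = Poly_Mapping.single k (1::nat) + m'"
      using keys_mult[of "xvar k" f] by (auto simp: xvar_def)
    then have "Poly_Mapping.lookup (0 :: int \<Rightarrow>\<^sub>0 nat) k = 1 + Poly_Mapping.lookup m' k"
      by (metis lookup_add lookup_single_eq)
    then show False by simp
  qed
  then show ?case by (simp add: in_keys_iff)
qed (simp_all add: lookup_add)

lemma descent_bounds:
  assumes "affected w \<subseteq> {l..u}" "descent i w"
  shows "l \<le> i" "i < u"
proof -
  have "(i, i + 1) \<in> inversions w" using assms(2) by (simp add: inversions_def descent_def)
  then show "l \<le> i" "i < u" using inversions_subset[OF assms(1)] by auto
qed

lemma schubert_homogeneous:
  assumes "v \<in> S_infty"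
  shows "\<exists>d. homogeneous d (schubert v)"
proof -
  obtain N where "v \<in> S_fin N" using S_infty_S_fin[OF assms] by blast
  then show ?thesis
  proof (induction "len (longest N * v)" arbitrary: v rule: less_induct)
    case less
    show ?case
    proof (cases "longest N * v = 1")
      case True
      then have "inverse v * longest N = 1"
        by (metis inverse_longest perm.inverse_distrib_swap perm.inverse_neutral)
      then show ?thesis
        using schubert_eq_any[OF less.prems] homogeneous_monomial by (simp add: staircase_def)
    next
      case False
      then obtain i where i: "descent i (longest N * v)" using ex_descent by blast
      have "affected (longest N * v) \<subseteq> {1..int N}"
        using less.prems affected_longest by (simp add: S_fin_def affected_mult_subset)
      then have iN: "1 \<le> i" "i < int N" using descent_bounds i by blast+
      have vs: "v * sref i \<in> S_fin N" by (rule mult_sref_S_fin[OF less.prems iN])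
      have "len (longest N * (v * sref i)) < len (longest N * v)"
        using len_mult_sref_descent[OF i] by (simp add: mult.assoc)
      then obtain d where d: "homogeneous d (schubert (v * sref i))" using less.hyps vs by blast
      have "v * sref i \<in> S_infty" using vs by (auto simp: S_fin_def S_infty_def)
      moreover have "descent i (v * sref i)"
        using i descent_longest_mult[OF less.prems iN] by simp
      ultimately have "divdiff i (schubert (v * sref i)) = schubert v"
        using divdiff_schubert iN by simp
      then show ?thesis
        using homogeneous_divdiff[OF d iN(1)] homogeneous_zero by (cases d) auto
    qed
  qed
qed

lemma S_infty_descent: "v \<in> S_infty \<Longrightarrow> descent i v \<Longrightarrow> 1 \<le> i"
  using S_infty_S_fin[of v 0] descent_bounds(1)[of v 1 _ i] unfolding S_fin_def by blast

lemma mult_sref_S_infty: "v \<in> S_infty \<Longrightarrow> 1 \<le> i \<Longrightarrow> v * sref i \<in> S_infty"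
  unfolding S_infty_def by (simp add: affected_mult_subset affected_sref)

text \<open>Some divided difference of \<open>schubert v\<close> is the Schubert polynomial of a shorter
  permutation, and the chain ends at \<open>schubert 1 = 1\<close>.\<close>

lemma schubert_neq_0:
  "v \<in> S_infty \<Longrightarrow> schubert v \<noteq> 0"
proof (induction "len v" arbitrary: v rule: less_induct)
  case less
  show ?case
  proof (cases "v = 1")
    case False
    then obtain i where i: "descent i v" using ex_descent by blast
    have "1 \<le> i" by (rule S_infty_descent[OF less.prems i])
    then have "divdiff i (schubert v) \<noteq> 0"
      using less.hyps[of "v * sref i"] i len_mult_sref_descent[OF i] less.prems
      by (simp add: divdiff_schubert mult_sref_S_infty)
    then show ?thesis by auto
  qed (simp add: schubert_one)
qed

text \<open>The degree cannot be \<open>0\<close>, as a constant has no non-zero divided difference.\<close>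

lemma schubert_homogeneous_positive:
  assumes "v \<in> S_infty" "v \<noteq> 1"
  shows "\<exists>d. homogeneous (Suc d) (schubert v)"
proof -
  obtain d where d: "homogeneous d (schubert v)" using schubert_homogeneous[OF assms(1)] by blast
  obtain i where i: "descent i v" using ex_descent assms(2) by blast
  have "1 \<le> i" by (rule S_infty_descent[OF assms(1) i])
  then have "divdiff i (schubert v) \<noteq> 0"
    using i schubert_neq_0[of "v * sref i"] assms(1) by (simp add: divdiff_schubert mult_sref_S_infty)
  then show ?thesis using d homogeneous_divdiff[OF d \<open>1 \<le> i\<close>] by (cases d) auto
qed

text \<open>Such a polynomial is symmetric in infinitely many variables: if one of them occurred, then
  so would all later ones.\<close>

lemma eq_0_if_divdiff_0:
  assumes pos: "\<And>m. m \<in> Poly_Mapping.keys f \<Longrightarrow> Poly_Mapping.keys m \<subseteq> {1..}"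
    and const: "Poly_Mapping.lookup f 0 = 0"
    and divdiff: "\<And>i. 1 \<le> i \<Longrightarrow> divdiff i f = 0"
  shows "f = 0"
proof -
  have sym: "Poly_Mapping.map_key (apply (sref i)) m \<in> Poly_Mapping.keys f"
    if "1 \<le> i" "m \<in> Poly_Mapping.keys f" for i m
    using that divdiff[of i] lookup_act[of "sref i" f m] by (simp add: divdiff_eq_0_iff in_keys_iff)
  define V where "V = (\<Union>m\<in>Poly_Mapping.keys f. Poly_Mapping.keys m)"
  have "finite V" by (simp add: V_def)
  have step: "k + 1 \<in> V" if k: "k \<in> V" for k
  proof -
    obtain m where m: "m \<in> Poly_Mapping.keys f" "k \<in> Poly_Mapping.keys m" using k by (auto simp: V_def)
    have "1 \<le> k" using pos[OF m(1)] m(2) by auto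
    moreover have "k + 1 \<in> Poly_Mapping.keys (Poly_Mapping.map_key (apply (sref k)) m)"
      using m(2) by (simp add: in_keys_iff)
    ultimately show ?thesis using sym m(1) by (auto simp: V_def)
  qed
  have "V = {}"
  proof (rule ccontr)
    assume "V \<noteq> {}"
    then have "Max V \<in> V" using \<open>finite V\<close> by simp
    then have "Max V + 1 \<le> Max V" using step Max_ge[OF \<open>finite V\<close>] by blast
    then show False by simp
  qed
  then have "m = 0" if "m \<in> Poly_Mapping.keys f" for m
    using that by (auto simp: V_def)
  then have "Poly_Mapping.lookup f m = 0" for m using const in_keys_iff[of m f] by metis
  then show ?thesis by (intro poly_mapping_eqI) simp
qed

section \<open>The Demazure product\<close>

text \<open>Demazure multiplication by \<open>s\<^sub>i\<close> on the right and on the left. The braid relations are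
  visible in one-line notation for the right action, where a comparison of three neighbouring
  values decides everything; taking inverses transports them to the left action.\<close>

definition demazure_right :: "int \<Rightarrow> int perm \<Rightarrow> int perm" where
  "demazure_right i w = (if descent i w then w else w * sref i)"

definition demazure_left :: "int \<Rightarrow> int perm \<Rightarrow> int perm" where
  "demazure_left i w = (if descent i (inverse w) then w else sref i * w)"

lemma demazure_left_eq: "demazure_left i w = inverse (demazure_right i (inverse w))"
  by (simp add: demazure_left_def demazure_right_def perm.inverse_distrib_swap)

lemma demazure_right_commute:
  assumes "i + 1 < j \<or> j + 1 < i"
  shows "demazure_right i (demazure_right j w) = demazure_right j (demazure_right i w)"
proof -
  have "descent i (w * sref j) \<longleftrightarrow> descent i w" "descent j (w * sref i) \<longleftrightarrow> descent j w"
    using assms by (auto simp: descent_def apply_sref)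
  then show ?thesis
    using sref_commute[OF assms] by (simp add: demazure_right_def mult.assoc)
qed

lemma demazure_right_braid:
  "demazure_right i (demazure_right (i + 1) (demazure_right i w)) =
   demazure_right (i + 1) (demazure_right i (demazure_right (i + 1) w))"
proof -
  define j k where "j = i + 1" and "k = i + 2"
  have s: "sref i \<langle>$\<rangle> i = j" "sref i \<langle>$\<rangle> j = i" "sref i \<langle>$\<rangle> k = k"
    "sref j \<langle>$\<rangle> i = i" "sref j \<langle>$\<rangle> j = k" "sref j \<langle>$\<rangle> k = j"
    by (simp_all add: j_def k_def apply_sref)
  have d: "descent i v \<longleftrightarrow> v \<langle>$\<rangle> j < v \<langle>$\<rangle> i" "descent j v \<longleftrightarrow> v \<langle>$\<rangle> k < v \<langle>$\<rangle> j" for v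
    by (simp_all add: descent_def j_def k_def add.assoc)
  have braid: "w * sref i * sref j * sref i = w * sref j * sref i * sref j"
    using sref_braid[of i] unfolding j_def by (metis mult.assoc)
  have "i \<noteq> j" "i \<noteq> k" "j \<noteq> k" by (simp_all add: j_def k_def)
  then have neq: "w \<langle>$\<rangle> i \<noteq> w \<langle>$\<rangle> j" "w \<langle>$\<rangle> i \<noteq> w \<langle>$\<rangle> k" "w \<langle>$\<rangle> j \<noteq> w \<langle>$\<rangle> k"
    by (simp_all add: apply_inj)
  show ?thesis
    using neq unfolding demazure_right_def j_def[symmetric]
    by (cases "w \<langle>$\<rangle> i < w \<langle>$\<rangle> j"; cases "w \<langle>$\<rangle> i < w \<langle>$\<rangle> k"; cases "w \<langle>$\<rangle> j < w \<langle>$\<rangle> k")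
      (simp_all add: d s braid del: descent_mult_sref apply_sref_simps)
qed

lemma demazure_left_commute:
  "i + 1 < j \<or> j + 1 < i \<Longrightarrow> demazure_left i (demazure_left j w) = demazure_left j (demazure_left i w)"
  using demazure_right_commute[of i j "inverse w"] by (simp add: demazure_left_eq)

lemma demazure_left_braid:
  "demazure_left i (demazure_left (i + 1) (demazure_left i w)) =
   demazure_left (i + 1) (demazure_left i (demazure_left (i + 1) w))"
  using demazure_right_braid[of i "inverse w"] by (simp add: demazure_left_eq)

lemma demazure_left_idem: "demazure_left i (demazure_left i w) = demazure_left i w"
  by (simp add: demazure_left_def)

definition demazure_fold :: "int perm \<Rightarrow> int perm \<Rightarrow> int perm" where
  "demazure_fold u v = foldr demazure_left (SOME a. reduced_word a u) v"

lemma demazure_fold_reduced_word: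
  "reduced_word a u \<Longrightarrow> demazure_fold u v = foldr demazure_left a v"
  unfolding demazure_fold_def
  by (rule foldr_reduced_word_unique)
    (erule demazure_left_commute, rule demazure_left_braid, erule someI, assumption)

lemma demazure_fold_one [simp]: "demazure_fold 1 v = v"
  using demazure_fold_reduced_word[of "[]"] by simp

lemma demazure_fold_sref_mult:
  assumes "\<not> descent i (inverse u)"
  shows "demazure_fold (sref i * u) v = demazure_left i (demazure_fold u v)"
proof -
  obtain a where a: "reduced_word a u" using ex_reduced_word by blast
  then have "reduced_word (i # a) (sref i * u)" using assms by (simp add: reduced_word_Cons_iff)
  then show ?thesis using a demazure_fold_reduced_word by simp
qed

lemma demazure_fold_demazure_left:
  "demazure_fold (demazure_left i u) v = demazure_left i (demazure_fold u v)"
proof (cases "descent i (inverse u)")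
  case True
  then have "demazure_fold u v = demazure_left i (demazure_fold (sref i * u) v)"
    using demazure_fold_sref_mult[of i "sref i * u"] by simp
  then show ?thesis using True demazure_left_idem by (simp add: demazure_left_def)
next
  case False
  then show ?thesis using demazure_fold_sref_mult by (simp add: demazure_left_def)
qed

lemma demazure_fold_assoc: "demazure_fold (demazure_fold u v) w = demazure_fold u (demazure_fold v w)"
proof -
  obtain a where a: "reduced_word a u" using ex_reduced_word by blast
  have "demazure_fold (foldr demazure_left a v) w = foldr demazure_left a (demazure_fold v w)"
    by (induction a) (simp_all add: demazure_fold_demazure_left)
  then show ?thesis using demazure_fold_reduced_word[OF a] by simp
qed

lemma len_mult_le: "len (u * v) \<le> len u + len v"
proof -
  obtain a b where "reduced_word a u" "reduced_word b v" using ex_reduced_word by blast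
  then show ?thesis using len_prod_list_le[of "a @ b"] by (simp add: reduced_word_def)
qed

lemma demazure_fold_length_additive:
  assumes "len (u * v) = len u + len v"
  shows "demazure_fold u v = u * v"
proof -
  obtain a where "reduced_word a u" using ex_reduced_word by blast
  then show ?thesis
    using assms
  proof (induction a arbitrary: u)
    case (Cons i a)
    define u' where "u' = sref i * u"
    have u: "u = sref i * u'" by (simp add: u'_def)
    have i: "descent i (inverse u)" and a: "reduced_word a u'"
      using Cons.prems(1) by (simp_all add: reduced_word_Cons_iff u'_def)
    have lu: "Suc (len u') = len u" unfolding u'_def by (rule len_sref_mult_descent[OF i])
    have asc: "\<not> descent i (inverse (u' * v))"
    proof
      assume "descent i (inverse (u' * v))"
      then have "Suc (len (u * v)) = len (u' * v)"
        using len_sref_mult_descent[of i "u' * v"] by (simp add: u mult.assoc)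
      then show False using len_mult_le[of u' v] Cons.prems(2) lu by simp
    qed
    then have "len (u * v) = Suc (len (u' * v))"
      using len_sref_mult_ascent[of i "u' * v"] by (simp add: u mult.assoc)
    then have "demazure_fold u' v = u' * v" using Cons.IH[OF a] Cons.prems(2) lu by simp
    moreover have "\<not> descent i (inverse u')" using i by (simp add: u'_def)
    ultimately show ?case
      using demazure_fold_sref_mult[of i u' v] asc by (simp add: u demazure_left_def mult.assoc)
  qed simp
qed

lemma len_sref [simp]: "len (sref i) = 1"
  using len_mult_sref_ascent[of i 1] by simp

text \<open>The three properties determine multiplication by \<open>s\<^sub>i\<close> on the left, and associativity then
  determines the product along a reduced word.\<close>

lemma is_demazure_unique:
  assumes assoc: "\<And>u v w. d (d u v) w = d u (d v w)"
    and add: "\<And>u v. len (u * v) = len u + len v \<Longrightarrow> d u v = u * v"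
    and idem: "\<And>i. d (sref i) (sref i) = sref i"
  shows "d u v = demazure_fold u v"
proof -
  have left: "d (sref i) x = demazure_left i x" for i x
  proof (cases "descent i (inverse x)")
    case True
    then have "len x = len (sref i) + len (sref i * x)" using len_sref_mult_descent[OF True] by simp
    then have "d (sref i) (sref i * x) = x" using add[of "sref i" "sref i * x"] by simp
    then have "d (sref i) x = d (d (sref i) (sref i)) (sref i * x)" using assoc by metis
    then show ?thesis
      using True \<open>d (sref i) (sref i * x) = x\<close> by (simp add: idem demazure_left_def)
  next
    case False
    then show ?thesis using add[of "sref i" x] len_sref_mult_ascent[OF False]
      by (simp add: demazure_left_def)
  qed
  obtain a where "reduced_word a u" using ex_reduced_word by blast
  then show ?thesis
  proof (induction a arbitrary: u)
    case Nil
    then show ?case using add[of 1 v] by simp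
  next
    case (Cons i a)
    then have i: "descent i (inverse u)" and a: "reduced_word a (sref i * u)"
      by (simp_all add: reduced_word_Cons_iff)
    have "d (sref i) (sref i * u) = u"
      using i by (simp add: left demazure_left_def)
    then have "d u v = d (sref i) (d (sref i * u) v)" using assoc by metis
    also have "\<dots> = demazure_left i (demazure_fold (sref i * u) v)"
      unfolding left Cons.IH[OF a] ..
    also have "\<dots> = demazure_fold u v"
      using demazure_fold_sref_mult[of i "sref i * u" v] i by simp
    finally show ?case .
  qed
qed

lemma demazure_eq: "demazure = demazure_fold"
  unfolding demazure_def
proof (rule the_equality)
  have "demazure_fold (sref i) (sref i) = sref i" for i
    using demazure_fold_sref_mult[of i 1 "sref i"] descent_mult_sref[of i 1]
    by (simp add: demazure_left_def del: descent_mult_sref)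
  then show "(\<forall>u v w. demazure_fold (demazure_fold u v) w = demazure_fold u (demazure_fold v w)) \<and>
      (\<forall>u v. len (u * v) = len u + len v \<longrightarrow> demazure_fold u v = u * v) \<and>
      (\<forall>i. demazure_fold (sref i) (sref i) = sref i)"
    using demazure_fold_assoc demazure_fold_length_additive by simp
next
  fix d assume d: "(\<forall>u v w. d (d u v) w = d u (d v w)) \<and>
      (\<forall>u v. len (u * v) = len u + len v \<longrightarrow> d u v = u * v) \<and> (\<forall>i. d (sref i) (sref i) = sref i)"
  show "d = demazure_fold"
    by (intro ext is_demazure_unique) (use d in blast)+
qed

lemma demazure_assoc: "demazure (demazure u v) w = demazure u (demazure v w)"
  and demazure_length_additive: "len (u * v) = len u + len v \<Longrightarrow> demazure u v = u * v"
  unfolding demazure_eq by (rule demazure_fold_assoc, rule demazure_fold_length_additive)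

lemma demazure_sref_left: "demazure (sref i) v = demazure_left i v"
  using demazure_fold_sref_mult[of i 1 v] by (simp add: demazure_eq)

lemma demazure_sref_right: "demazure u (sref i) = demazure_right i u"
proof (cases "descent i u")
  case True
  have "u = demazure (u * sref i) (sref i)"
    using demazure_length_additive[of "u * sref i" "sref i"] len_mult_sref_descent[OF True] by simp
  then have "demazure u (sref i) = demazure (u * sref i) (demazure (sref i) (sref i))"
    using demazure_assoc by metis
  also have "demazure (sref i) (sref i) = sref i"
    using descent_mult_sref[of i 1] by (simp add: demazure_sref_left demazure_left_def del: descent_mult_sref)
  finally show ?thesis using \<open>u = demazure (u * sref i) (sref i)\<close> True by (simp add: demazure_right_def)
next
  case False
  then show ?thesis
    using demazure_length_additive[of u "sref i"] len_mult_sref_ascent[OF False]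
    by (simp add: demazure_right_def)
qed

section \<open>Atoms\<close>

definition demazure_square :: "int perm \<Rightarrow> int perm" where
  "demazure_square w = demazure (inverse w) w"

lemma demazure_square_one [simp]: "demazure_square 1 = 1"
  by (simp add: demazure_square_def demazure_eq)

text \<open>After \<open>y\<close> has been multiplied by \<open>s\<^sub>i\<close> on the right, where \<open>i\<close> is an ascent,
  multiplication on the left is absorbed exactly if \<open>i\<close> and \<open>i + 1\<close> are fixed points of \<open>y\<close>.
  This explains the case distinction in \<^const>\<open>up\<close>.\<close>

lemma demazure_conj_eq_up:
  assumes "y \<in> I_Z"
  shows "demazure_left i (demazure_right i y) = up i y"
proof (cases "descent i y")
  case True
  then show ?thesis using assms by (simp add: demazure_left_def demazure_right_def I_Z_inverse)
next
  case False
  have inv: "inverse (y * sref i) = sref i * y"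
    using assms by (simp add: perm.inverse_distrib_swap I_Z_inverse)
  have less: "y \<langle>$\<rangle> i < y \<langle>$\<rangle> (i + 1)" using False by (simp add: not_descent_iff)
  show ?thesis
  proof (cases "y \<langle>$\<rangle> i = i \<and> y \<langle>$\<rangle> (i + 1) = i + 1")
    case True
    then have "descent i (sref i * y)" by (simp add: descent_def)
    then show ?thesis
      using False True unfolding demazure_left_def demazure_right_def up_def
      by (simp add: I_Z_inverse[OF assms])
  next
    case noncomm: False
    have "\<not> (y \<langle>$\<rangle> i = i + 1 \<and> y \<langle>$\<rangle> (i + 1) = i)" using less by auto
    then have "sref i \<langle>$\<rangle> (y \<langle>$\<rangle> i) < sref i \<langle>$\<rangle> (y \<langle>$\<rangle> (i + 1))"
      using less noncomm sref_less_iff[of "y \<langle>$\<rangle> i" i "y \<langle>$\<rangle> (i + 1)"] by blast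
    then have "\<not> descent i (sref i * y)" by (simp add: not_descent_iff)
    then show ?thesis
      using False noncomm unfolding demazure_left_def demazure_right_def up_def
      by (simp only: inv if_False mult.assoc)
  qed
qed

lemma demazure_square_mult_sref:
  assumes "\<not> descent i w" "demazure_square w \<in> I_Z"
  shows "demazure_square (w * sref i) = up i (demazure_square w)"
proof -
  have len: "len (w * sref i) = Suc (len w)" by (rule len_mult_sref_ascent[OF assms(1)])
  then have "demazure w (sref i) = w * sref i" by (simp add: demazure_length_additive)
  moreover have "len (sref i * inverse w) = Suc (len w)"
    using len_sref_mult_ascent[of i "inverse w"] assms(1) by simp
  then have "demazure (sref i) (inverse w) = sref i * inverse w"
    by (simp add: demazure_length_additive)
  ultimately have "demazure_square (w * sref i)
    = demazure (demazure (sref i) (inverse w)) (demazure w (sref i))"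
    by (simp add: demazure_square_def perm.inverse_distrib_swap)
  also have "\<dots> = demazure (sref i) (demazure (demazure_square w) (sref i))"
    by (simp add: demazure_assoc demazure_square_def)
  also have "\<dots> = up i (demazure_square w)"
    using demazure_conj_eq_up[OF assms(2)] by (simp add: demazure_sref_left demazure_sref_right)
  finally show ?thesis .
qed

definition exceedances :: "int perm \<Rightarrow> int set" where
  "exceedances y = {k. k < y \<langle>$\<rangle> k}"

lemma finite_exceedances [simp]: "finite (exceedances y)"
  by (rule finite_subset[OF _ finite_affected[of y]]) (auto simp: exceedances_def in_affected)

text \<open>The exceedances of an involution are the smaller points of its 2-cycles. Adding their
  number to the length compensates for the fact that \<open>up i\<close>, applied at an ascent, adds \<open>2\<close> to
  the length if it conjugates and only \<open>1\<close> if it creates a 2-cycle: the sum grows by \<open>2\<close> in both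
  cases. So it is twice the common length of the atoms (\<open>atoms_iff\<close>).\<close>

definition double_rank :: "int perm \<Rightarrow> nat" where
  "double_rank y = len y + card (exceedances y)"

lemma double_rank_one [simp]: "double_rank 1 = 0"
  by (simp add: double_rank_def exceedances_def)

lemma double_rank_up:
  assumes y: "y \<in> I_Z" and asc: "\<not> descent i y"
  shows "double_rank (up i y) = double_rank y + 2"
proof (cases "y \<langle>$\<rangle> i = i \<and> y \<langle>$\<rangle> (i + 1) = i + 1")
  case True
  then have up: "up i y = y * sref i" using asc by (simp add: up_def)
  have "exceedances (y * sref i) = insert i (exceedances y)"
  proof (rule set_eqI)
    fix k
    show "k \<in> exceedances (y * sref i) \<longleftrightarrow> k \<in> insert i (exceedances y)"
      using True by (cases "k = i"; cases "k = i + 1") (simp_all add: exceedances_def apply_sref)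
  qed
  moreover have "i \<notin> exceedances y" using True by (simp add: exceedances_def)
  ultimately show ?thesis
    using len_mult_sref_ascent[OF asc] by (simp add: double_rank_def up)
next
  case False
  then have up: "up i y = sref i * y * sref i" using asc unfolding up_def by (simp only: if_False)
  have neq: "y \<langle>$\<rangle> i \<noteq> i + 1" "y \<langle>$\<rangle> (i + 1) \<noteq> i"
    using I_Z_cycle_descent[OF y] I_Z_eq_swap[OF y] asc by blast+
  have "exceedances (sref i * y * sref i) = apply (sref i) ` exceedances y"
  proof (rule set_eqI)
    fix k
    have "k \<in> apply (sref i) ` A \<longleftrightarrow> sref i \<langle>$\<rangle> k \<in> A" for A
    proof
      assume "sref i \<langle>$\<rangle> k \<in> A"
      then have "sref i \<langle>$\<rangle> (sref i \<langle>$\<rangle> k) \<in> apply (sref i) ` A" by (rule imageI)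
      then show "k \<in> apply (sref i) ` A" by simp
    qed auto
    moreover have "sref i \<langle>$\<rangle> (sref i \<langle>$\<rangle> k) < sref i \<langle>$\<rangle> (y \<langle>$\<rangle> (sref i \<langle>$\<rangle> k))
        \<longleftrightarrow> sref i \<langle>$\<rangle> k < y \<langle>$\<rangle> (sref i \<langle>$\<rangle> k)"
      using neq by (intro sref_less_iff) auto
    ultimately show "k \<in> exceedances (sref i * y * sref i) \<longleftrightarrow> k \<in> apply (sref i) ` exceedances y"
      by (simp add: exceedances_def)
  qed
  then have "card (exceedances (sref i * y * sref i)) = card (exceedances y)"
    by (simp add: card_image inj_on_def apply_inj)
  moreover have "len (sref i * y * sref i) = len y + 2"
  proof -
    have 1: "len (y * sref i) = Suc (len y)" by (rule len_mult_sref_ascent[OF asc])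
    have "\<not> descent i (inverse (y * sref i))"
    proof -
      have "sref i \<langle>$\<rangle> (y \<langle>$\<rangle> i) < sref i \<langle>$\<rangle> (y \<langle>$\<rangle> (i + 1))"
        using asc False neq sref_less_iff[of "y \<langle>$\<rangle> i" i "y \<langle>$\<rangle> (i + 1)"]
        unfolding not_descent_iff by blast
      then show ?thesis
        using y by (simp add: not_descent_iff perm.inverse_distrib_swap I_Z_inverse)
    qed
    then have "len (sref i * (y * sref i)) = Suc (len (y * sref i))" by (rule len_sref_mult_ascent)
    then show ?thesis using 1 by (simp add: mult.assoc)
  qed
  ultimately show ?thesis by (simp add: double_rank_def up)
qed

lemma double_rank_down:
  "y \<in> I_Z \<Longrightarrow> descent i y \<Longrightarrow> double_rank y = double_rank (down i y) + 2"
  using double_rank_up[of "down i y" i] by simp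

lemma demazure_square_bound: "demazure_square w \<in> I_Z \<and> double_rank (demazure_square w) \<le> 2 * len w"
proof (induction "len w" arbitrary: w rule: less_induct)
  case less
  show ?case
  proof (cases "w = 1")
    case False
    then obtain i where i: "descent i w" using ex_descent by blast
    define v where "v = w * sref i"
    have v: "\<not> descent i v" "w = v * sref i" "Suc (len v) = len w"
      using i len_mult_sref_descent[OF i] by (simp_all add: v_def)
    have IH: "demazure_square v \<in> I_Z" "double_rank (demazure_square v) \<le> 2 * len v"
      using less[of v] v(3) by simp_all
    have "demazure_square w = up i (demazure_square v)"
      using demazure_square_mult_sref[OF v(1) IH(1)] v(2) by simp
    then show ?thesis
      using IH double_rank_up[OF IH(1), of i] v(3) by (cases "descent i (demazure_square v)") simp_all
  qed simp
qed

lemma demazure_square_I_Z [simp]: "demazure_square w \<in> I_Z"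
  using demazure_square_bound by blast

lemma demazure_square_descent:
  assumes "descent i w"
  shows "demazure_square w = up i (demazure_square (w * sref i))"
  using demazure_square_mult_sref[of i "w * sref i"] assms by simp

lemma descent_demazure_square: "descent i w \<Longrightarrow> descent i (demazure_square w)"
  using demazure_square_descent by simp

lemma ex_minimal_demazure_square:
  "y \<in> I_Z \<Longrightarrow> \<exists>w. demazure_square w = y \<and> 2 * len w = double_rank y"
proof (induction "len y" arbitrary: y rule: less_induct)
  case less
  show ?case
  proof (cases "y = 1")
    case True
    then show ?thesis by (intro exI[of _ 1]) simp
  next
    case False
    then obtain i where i: "descent i y" using ex_descent by blast
    obtain w where w: "demazure_square w = down i y" "2 * len w = double_rank (down i y)"
      using less.hyps[OF len_down_less[OF less.prems i]] less.prems by auto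
    have "\<not> descent i w" using descent_demazure_square[of i w] w(1) less.prems by auto
    then have "demazure_square (w * sref i) = y" "len (w * sref i) = Suc (len w)"
      using demazure_square_mult_sref[of i w] len_mult_sref_ascent[of i w] w(1) less.prems i by simp_all
    then show ?thesis using w(2) double_rank_down[OF less.prems i] by (intro exI[of _ "w * sref i"]) simp
  qed
qed

lemma atoms_iff:
  assumes "y \<in> I_Z"
  shows "w \<in> atoms y \<longleftrightarrow> demazure_square w = y \<and> 2 * len w = double_rank y"
proof -
  obtain v where v: "demazure_square v = y" "2 * len v = double_rank y"
    using ex_minimal_demazure_square[OF assms] by blast
  have bound: "double_rank y \<le> 2 * len u" if "demazure_square u = y" for u
    using demazure_square_bound[of u] that by simp
  show ?thesis
  proof
    assume "w \<in> atoms y"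
    then have w: "demazure_square w = y" and min: "\<not> len v < len w"
      using v(1) unfolding atoms_def is_arg_min_def demazure_square_def by auto
    then show "demazure_square w = y \<and> 2 * len w = double_rank y" using bound[OF w] v(2) by simp
  next
    assume w: "demazure_square w = y \<and> 2 * len w = double_rank y"
    have "\<not> len u < len w" if "y = demazure (inverse u) u" for u
      using bound[of u] that w by (simp add: demazure_square_def)
    then show "w \<in> atoms y"
      using w unfolding atoms_def is_arg_min_def demazure_square_def by auto
  qed
qed

lemma atoms_descent: "y \<in> I_Z \<Longrightarrow> w \<in> atoms y \<Longrightarrow> descent i w \<Longrightarrow> descent i y"
  using descent_demazure_square[of i w] by (simp add: atoms_iff)

text \<open>The recursion for atoms. Since the length of an atom is known, the last letter of \<open>w\<close> must
  have acted at an ascent, so that removing it yields an atom of \<open>down i y\<close>.\<close>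

lemma atoms_mult_sref:
  assumes y: "y \<in> I_Z" and i: "descent i y"
  shows "w \<in> atoms y \<and> descent i w \<longleftrightarrow> w * sref i \<in> atoms (down i y)"
proof
  assume w: "w \<in> atoms y \<and> descent i w"
  then have y_eq: "y = up i (demazure_square (w * sref i))" and len: "2 * len w = double_rank y"
    using demazure_square_descent[of i w] by (simp_all add: atoms_iff[OF y])
  have lw: "Suc (len (w * sref i)) = len w" using len_mult_sref_descent w by blast
  have "\<not> descent i (demazure_square (w * sref i))"
  proof
    assume "descent i (demazure_square (w * sref i))"
    then have "demazure_square (w * sref i) = y" using y_eq by simp
    then have "double_rank y \<le> 2 * len (w * sref i)" using demazure_square_bound by blast
    then show False using len lw by simp
  qed
  then have "demazure_square (w * sref i) = down i y" using y_eq by simp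
  then show "w * sref i \<in> atoms (down i y)"
    using len lw double_rank_down[OF y i] y by (simp add: atoms_iff)
next
  assume "w * sref i \<in> atoms (down i y)"
  then have w: "demazure_square (w * sref i) = down i y" "2 * len (w * sref i) = double_rank (down i y)"
    using y by (simp_all add: atoms_iff)
  have "\<not> descent i (w * sref i)"
    using descent_demazure_square[of i "w * sref i"] w(1) y by auto
  then have iw: "descent i w" by simp
  then have "demazure_square w = y"
    using demazure_square_descent[of i w] w(1) y i by simp
  then show "w \<in> atoms y \<and> descent i w"
    using iw w(2) len_mult_sref_descent[OF iw] double_rank_down[OF y i] by (simp add: atoms_iff[OF y])
qed

lemma affected_down:
  assumes "affected y \<subseteq> A" "i \<in> A" "i + 1 \<in> A"
  shows "affected (down i y) \<subseteq> A"
  using assms by (simp add: down_def affected_mult_subset affected_sref)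

lemma atoms_affected:
  assumes "y \<in> I_Z" "affected y \<subseteq> {l..u}" "w \<in> atoms y"
  shows "affected w \<subseteq> {l..u}"
  using assms
proof (induction "len w" arbitrary: w y rule: less_induct)
  case less
  show ?case
  proof (cases "w = 1")
    case False
    then obtain i where i: "descent i w" using ex_descent by blast
    have iy: "descent i y" by (rule atoms_descent[OF less.prems(1,3) i])
    then have lu: "i \<in> {l..u}" "i + 1 \<in> {l..u}" using descent_bounds[OF less.prems(2)] by force+
    have "w * sref i \<in> atoms (down i y)"
      using atoms_mult_sref[OF less.prems(1) iy] less.prems(3) i by blast
    then have "affected (w * sref i) \<subseteq> {l..u}"
      using less.hyps[of "w * sref i" "down i y"] len_mult_sref_descent[OF i] less.prems(1)
        affected_down[OF less.prems(2) lu] by simp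
    then have "affected (w * sref i * sref i) \<subseteq> {l..u}"
      by (rule affected_mult_subset) (use lu in \<open>simp add: affected_sref\<close>)
    then show ?thesis by simp
  qed simp
qed

lemma finite_atoms: "y \<in> I_Z \<Longrightarrow> finite (atoms y)"
proof -
  assume y: "y \<in> I_Z"
  obtain l u where lu: "affected y \<subseteq> {l..u}" using ex_affected_bounds by blast
  have "atoms y \<subseteq> {w. affected w \<subseteq> {l..u}}" using atoms_affected[OF y lu] by blast
  then show ?thesis by (rule finite_subset) (rule finite_perms_within, simp)
qed

lemma atoms_S_infty: "y \<in> I_infty \<Longrightarrow> w \<in> atoms y \<Longrightarrow> w \<in> S_infty"
proof -
  assume y: "y \<in> I_infty" and w: "w \<in> atoms y"
  obtain N where "y \<in> S_fin N" using S_infty_S_fin[of y 0] y by (auto simp: I_infty_def)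
  then have "affected w \<subseteq> {1..int N}"
    using atoms_affected[OF _ _ w] y by (simp add: I_infty_def S_fin_def)
  then show "w \<in> S_infty" by (auto simp: S_infty_def)
qed

section \<open>Involution Schubert polynomials\<close>

lemma down_S_infty: "y \<in> S_infty \<Longrightarrow> 1 \<le> i \<Longrightarrow> down i y \<in> S_infty"
  unfolding S_infty_def by (simp add: affected_down)

lemma up_S_infty: "y \<in> S_infty \<Longrightarrow> 1 \<le> i \<Longrightarrow> up i y \<in> S_infty"
  unfolding S_infty_def up_def by (simp add: affected_mult_subset affected_sref)

text \<open>The formula for \<open>\<partial>\<^sub>i\<close> of a Schubert polynomial is summed over the atoms, with the help of
  \<open>atoms_mult_sref\<close>. Outside of \<^const>\<open>I_infty\<close> both sides are \<open>0\<close>, because \<open>up i\<close> with \<open>i \<ge> 1\<close> does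
  not leave \<^const>\<open>I_infty\<close>.\<close>

theorem divdiff_inv_schubert:
  assumes y: "y \<in> I_Z" and i: "1 \<le> i"
  shows "divdiff i (inv_schubert y) = (if descent i y then inv_schubert (down i y) else 0)"
proof (cases "y \<in> I_infty")
  case False
  have "down i y \<notin> I_infty" if "descent i y"
    using False up_S_infty[of "down i y" i] i that y by (auto simp: I_infty_def)
  then show ?thesis using False by (simp add: inv_schubert_def)
next
  case True
  have "divdiff i (inv_schubert y) = (\<Sum>w\<in>atoms y. divdiff i (schubert w))"
    using True by (simp add: inv_schubert_def divdiff_sum)
  also have "\<dots> = (\<Sum>w\<in>atoms y. if descent i w then schubert (w * sref i) else 0)"
    using divdiff_schubert i atoms_S_infty[OF True] by (intro sum.cong) simp_all
  also have "\<dots> = (\<Sum>w\<in>{w\<in>atoms y. descent i w}. schubert (w * sref i))"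
    using finite_atoms[OF y] by (simp add: sum.inter_filter)
  also have "\<dots> = (if descent i y then inv_schubert (down i y) else 0)"
  proof (cases "descent i y")
    case iy: True
    have "(\<Sum>w\<in>{w\<in>atoms y. descent i w}. schubert (w * sref i)) = (\<Sum>w\<in>atoms (down i y). schubert w)"
      using atoms_mult_sref[OF y iy]
      by (intro sum.reindex_bij_witness[where i = "\<lambda>w. w * sref i" and j = "\<lambda>w. w * sref i"]) auto
    moreover have "down i y \<in> I_infty"
      using True down_S_infty i by (simp add: I_infty_def)
    ultimately show ?thesis using iy by (simp add: inv_schubert_def)
  next
    case False
    then have "{w \<in> atoms y. descent i w} = {}" using atoms_descent[OF y] by blast
    then show ?thesis using False by (simp only: sum.empty if_False)
  qed
  finally show ?thesis .
qed

section \<open>The transition formula\<close>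

text \<open>What is needed from both sides of the transition formula in order to apply
  \<open>eq_0_if_divdiff_0\<close>: positive variables, and no constant term.\<close>

definition positive_terms :: "ipoly \<Rightarrow> bool" where
  "positive_terms f \<longleftrightarrow> (\<forall>m\<in>Poly_Mapping.keys f. Poly_Mapping.keys m \<subseteq> {1..} \<and> m \<noteq> 0)"

lemma positive_terms_zero [simp]: "positive_terms 0"
  by (simp add: positive_terms_def)

lemma positive_terms_add: "positive_terms f \<Longrightarrow> positive_terms g \<Longrightarrow> positive_terms (f + g)"
  unfolding positive_terms_def using keys_add[of f g] by blast

lemma positive_terms_of_int_mult: "positive_terms f \<Longrightarrow> positive_terms (of_int c * f)"
proof -
  assume f: "positive_terms f"
  have nat: "positive_terms (of_nat n * f)" for n
    by (induction n) (simp_all add: distrib_right positive_terms_add f)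
  have neg: "positive_terms (- g)" if "positive_terms g" for g
    using that by (simp add: positive_terms_def in_keys_iff)
  show ?thesis
    using nat neg by (cases c rule: int_cases2) simp_all
qed

lemma positive_terms_sum: "(\<And>k. k \<in> A \<Longrightarrow> positive_terms (f k)) \<Longrightarrow> positive_terms (\<Sum>k\<in>A. f k)"
  by (induction A rule: infinite_finite_induct) (simp_all add: positive_terms_add)

lemma homogeneous_positive_terms: "homogeneous (Suc d) f \<Longrightarrow> positive_terms f"
  using homogeneous_positive_vars[of "Suc d" f] homogeneous_Suc_no_constant[of "Suc d" f]
  unfolding positive_terms_def by (auto simp: in_keys_iff)

lemma positive_terms_inv_schubert:
  assumes "y \<in> I_Z" "y \<noteq> 1"
  shows "positive_terms (inv_schubert y)"
proof (cases "y \<in> I_infty")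
  case True
  have "positive_terms (schubert w)" if w: "w \<in> atoms y" for w
  proof -
    have "w \<noteq> 1" using w assms by (auto simp: atoms_iff)
    then show ?thesis
      using schubert_homogeneous_positive[OF atoms_S_infty[OF True w]] homogeneous_positive_terms by blast
  qed
  then show ?thesis by (simp add: inv_schubert_def positive_terms_sum)
qed (simp add: inv_schubert_def)

lemma positive_terms_xvar_mult_inv_schubert:
  assumes "1 \<le> k" "y \<in> I_infty"
  shows "positive_terms (xvar k * inv_schubert y)"
proof -
  have "positive_terms (xvar k * schubert w)" if w: "w \<in> atoms y" for w
    using schubert_homogeneous[OF atoms_S_infty[OF assms(2) w]] homogeneous.mult[OF assms(1)]
      homogeneous_positive_terms by blast
  then show ?thesis using assms(2) by (simp add: inv_schubert_def sum_distrib_left positive_terms_sum)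
qed

text \<open>The infinitely many covers of \<open>y\<close> that do not move \<open>q\<close> have weight \<open>0\<close>; they must be
  removed to obtain a finite sum.\<close>

definition moving_covers :: "int perm \<Rightarrow> int \<Rightarrow> int perm set" where
  "moving_covers y q = {z. inv_covers y z \<and> z \<langle>$\<rangle> q \<noteq> y \<langle>$\<rangle> q}"

lemma finite_moving_covers [simp]: "finite (moving_covers y q)"
  unfolding moving_covers_def by (rule finite_covers_moving)

definition weighted_sum :: "int perm \<Rightarrow> int \<Rightarrow> ipoly" where
  "weighted_sum y q = (\<Sum>z\<in>moving_covers y q. of_int (weight y z q) * inv_schubert z)"

lemma weighted_sum_eq:
  assumes "finite K" "K \<subseteq> {z. inv_covers y z}" "moving_covers y q \<subseteq> K"
  shows "weighted_sum y q = (\<Sum>z\<in>K. of_int (weight y z q) * inv_schubert z)"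
  unfolding weighted_sum_def
  using assms by (intro sum.mono_neutral_left) (auto simp: moving_covers_def weight_eq_0_iff)

text \<open>An involution in between is caught by the lifting property, whether or not it has the
  descent \<open>i\<close>.\<close>

lemma inv_covers_up_self:
  assumes y: "y \<in> I_Z" and asc: "\<not> descent i y"
  shows "inv_covers y (up i y)"
  unfolding inv_covers_iff
proof (intro conjI ballI impI)
  fix \<sigma> assume s: "\<sigma> \<in> I_Z" "bruhat_le y \<sigma>" "bruhat_le \<sigma> (up i y)"
  have "bruhat_le y (down i \<sigma>)" using down_bruhat_lift[OF y s(1,2) asc] .
  moreover have "bruhat_le (down i \<sigma>) y"
    using down_mono[OF s(1) _ s(3), of i] y asc by simp
  ultimately have "down i \<sigma> = y" by (rule bruhat_le_antisym[rotated])
  then show "\<sigma> = y \<or> \<sigma> = up i y" using s(1) up_down[of \<sigma> i] by (cases "descent i \<sigma>") auto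
qed (use y asc up_neq[OF y asc] in \<open>auto simp: bruhat_le_up\<close>)

lemma divdiff_weighted_sum:
  assumes "y \<in> I_Z" "1 \<le> i"
  shows "divdiff i (weighted_sum y q) =
    (\<Sum>z\<in>{z\<in>moving_covers y q. descent i z}. of_int (weight y z q) * inv_schubert (down i z))"
proof -
  have "divdiff i (weighted_sum y q)
    = (\<Sum>z\<in>moving_covers y q. of_int (weight y z q) * divdiff i (inv_schubert z))"
    unfolding weighted_sum_def divdiff_sum divdiff_of_int_mult ..
  also have "\<dots> = (\<Sum>z\<in>moving_covers y q.
      if descent i z then of_int (weight y z q) * inv_schubert (down i z) else 0)"
  proof (rule sum.cong)
    fix z assume "z \<in> moving_covers y q"
    then have "z \<in> I_Z" using inv_coversD(2) by (auto simp: moving_covers_def)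
    then show "of_int (weight y z q) * divdiff i (inv_schubert z)
      = (if descent i z then of_int (weight y z q) * inv_schubert (down i z) else 0)"
      using divdiff_inv_schubert assms(2) by simp
  qed simp
  also have "\<dots> = (\<Sum>z\<in>{z\<in>moving_covers y q. descent i z}. of_int (weight y z q) * inv_schubert (down i z))"
    by (rule sum.inter_filter[symmetric]) simp
  finally show ?thesis .
qed

text \<open>Only covers with descent \<open>i\<close> survive, and \<open>up i y\<close> is the only one.\<close>

lemma divdiff_weighted_sum_ascent:
  assumes y: "y \<in> I_Z" and i: "1 \<le> i" and asc: "\<not> descent i y"
  shows "divdiff i (weighted_sum y q) = of_int (weight y (up i y) q) * inv_schubert y"
proof -
  have "{z \<in> moving_covers y q. descent i z} = (if weight y (up i y) q = 0 then {} else {up i y})"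
  proof (rule set_eqI)
    fix z
    have "z = up i y" if "inv_covers y z" "descent i z"
      by (rule inv_covers_ascent_descent[OF that(1) asc that(2)])
    moreover have "inv_covers y (up i y)" "descent i (up i y)"
      using inv_covers_up_self[OF y asc] y by simp_all
    ultimately show "z \<in> {z \<in> moving_covers y q. descent i z}
      \<longleftrightarrow> z \<in> (if weight y (up i y) q = 0 then {} else {up i y})"
      unfolding moving_covers_def weight_eq_0_iff by (cases "z = up i y") auto
  qed
  then show ?thesis using divdiff_weighted_sum[OF y i, of q] y asc by simp
qed

text \<open>The surviving covers of \<open>y\<close> correspond under \<open>down i\<close> to the covers of \<open>down i y\<close> other
  than \<open>y\<close>. A finite set \<open>K\<close> of these is prescribed by the user of the lemma, who combines two
  weighted sums over \<open>down i y\<close> when \<open>q\<close> belongs to the cycle that \<open>down i\<close> splits.\<close>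

lemma divdiff_weighted_sum_descent:
  assumes y: "y \<in> I_Z" and i: "1 \<le> i" and desc: "descent i y"
    and K: "finite K" "K \<subseteq> {z. inv_covers (down i y) z} - {y}"
    and weights: "\<And>z. inv_covers (down i y) z \<Longrightarrow> z \<noteq> y \<Longrightarrow> z \<notin> K \<Longrightarrow> weight y (up i z) q = 0"
  shows "divdiff i (weighted_sum y q) = (\<Sum>z\<in>K. of_int (weight y (up i z) q) * inv_schubert z)"
proof -
  let ?y = "down i y"
  have asc: "\<not> descent i ?y" and upy: "up i ?y = y" using y desc by simp_all
  have z: "inv_covers y (up i z)" "\<not> descent i z" "z \<in> I_Z" if "inv_covers ?y z" "z \<noteq> y" for z
    using inv_covers_up[OF that(1) asc] inv_covers_ascent[OF that(1) asc] that inv_coversD(2)[OF that(1)] upy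
    by simp_all
  have "divdiff i (weighted_sum y q) =
    (\<Sum>z\<in>{z\<in>moving_covers y q. descent i z}. of_int (weight y z q) * inv_schubert (down i z))"
    by (rule divdiff_weighted_sum[OF y i])
  also have "\<dots> = (\<Sum>z\<in>{z\<in>K. weight y (up i z) q \<noteq> 0}. of_int (weight y (up i z) q) * inv_schubert z)"
  proof (rule sum.reindex_bij_witness[where j = "down i" and i = "up i"])
    fix w assume "w \<in> {z \<in> moving_covers y q. descent i z}"
    then have w: "inv_covers y w" "descent i w" "weight y w q \<noteq> 0" "w \<in> I_Z"
      using inv_coversD(2) by (auto simp: moving_covers_def weight_eq_0_iff)
    show up: "up i (down i w) = w" using w by simp
    have "inv_covers ?y (down i w)" by (rule inv_covers_down[OF w(1) desc w(2)])
    moreover have "down i w \<noteq> y" using not_descent_down[OF w(4), of i] desc by auto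
    ultimately have "down i w \<in> K" using weights[of "down i w"] w(3) up by metis
    then show "down i w \<in> {z \<in> K. weight y (up i z) q \<noteq> 0}" using w(3) up by simp
    show "of_int (weight y (up i (down i w)) q) * inv_schubert (down i w)
      = of_int (weight y w q) * inv_schubert (down i w)" by (simp only: up)
  next
    fix z assume zK: "z \<in> {z \<in> K. weight y (up i z) q \<noteq> 0}"
    then have "inv_covers ?y z" "z \<noteq> y" using K by auto
    note z' = z[OF this]
    show "down i (up i z) = z" using z' by simp
    show "up i z \<in> {z \<in> moving_covers y q. descent i z}"
      using z' zK by (simp add: moving_covers_def weight_eq_0_iff)
  qed
  also have "\<dots> = (\<Sum>z\<in>K. of_int (weight y (up i z) q) * inv_schubert z)"
    using K(1) by (intro sum.mono_neutral_left) auto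
  finally show ?thesis .
qed

text \<open>Both sides compare the occurrences of \<open>i\<close> and of \<open>i + 1\<close> in the cycle of \<open>q\<close>.\<close>

lemma divdiff_x_cyc:
  assumes y: "y \<in> I_Z" and q: "y \<langle>$\<rangle> p = q" and asc: "\<not> descent i y"
  shows "divdiff i (x_cyc (p, q)) = of_int (weight y (up i y) q)"
proof -
  have "q = y \<langle>$\<rangle> k \<longleftrightarrow> p = k" for k
    unfolding q[symmetric] by (rule apply_inj)
  then have "weight y (up i y) q
    = of_bool (q = i \<or> p = i) - of_bool (q = i + 1 \<or> p = i + 1)"
    unfolding weight_up[OF y asc] by (simp only: insert_iff empty_iff simp_thms)
  then show ?thesis by (cases "p = q") (auto simp: x_cyc_def divdiff_add divdiff_xvar)
qed

lemma divdiff_act_sref: "divdiff i (act (sref i) f) = - divdiff i f"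
  by (rule divdiffI) (simp add: divdiff_eq)

lemma act_x_cyc: "act w (x_cyc (p, q)) = x_cyc (w \<langle>$\<rangle> p, w \<langle>$\<rangle> q)"
  by (simp add: x_cyc_def act_xvar apply_inj)

lemma Cyc_iff: "(p, q) \<in> Cyc y \<longleftrightarrow> 1 \<le> p \<and> p \<le> q \<and> y \<langle>$\<rangle> p = q"
  by (auto simp: Cyc_def)

text \<open>The transition formula with a single signed sum. Apply \<open>\<partial>\<^sub>i\<close> to both sides. If \<open>i\<close> is an
  ascent of \<open>y\<close>, then \<open>divdiff_x_cyc\<close> and \<open>divdiff_weighted_sum_ascent\<close> agree. If it is a
  descent, the Leibniz rule gives on the left the term \<open>x\<close> for the cycle \<open>(s\<^sub>i p, s\<^sub>i q)\<close> of
  \<open>down i y\<close>, to which the induction hypothesis applies, and a multiple of the polynomial of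
  \<open>y\<close>. On the right this multiple makes up for the cover \<open>y\<close> of \<open>down i y\<close> that is missing in
  \<open>divdiff_weighted_sum_descent\<close>.\<close>

theorem x_cyc_mult_inv_schubert:
  assumes "y \<in> I_infty" "(p, q) \<in> Cyc y"
  shows "x_cyc (p, q) * inv_schubert y = weighted_sum y q"
  using assms
proof (induction "len y" arbitrary: y p q rule: less_induct)
  case less
  have y: "y \<in> I_Z" "y \<in> S_infty" using less.prems(1) by (simp_all add: I_infty_def)
  have pq: "1 \<le> p" "p \<le> q" "y \<langle>$\<rangle> p = q" using less.prems(2) by (simp_all add: Cyc_iff)
  define F where "F = x_cyc (p, q) * inv_schubert y - weighted_sum y q"
  have killed: "divdiff i F = 0" if i: "1 \<le> i" for i
  proof (cases "descent i y")
    case False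
    have "divdiff i (inv_schubert y) = 0" using divdiff_inv_schubert[OF y(1) i] False by simp
    then show ?thesis
      unfolding F_def
      by (simp add: divdiff_diff divdiff_mult divdiff_x_cyc[OF y(1) pq(3) False]
          divdiff_weighted_sum_ascent[OF y(1) i False])
  next
    case desc: True
    define y' where "y' = down i y"
    have y': "y' \<in> I_Z" "\<not> descent i y'" "up i y' = y" "y' \<in> I_infty" "len y' < len y"
      using y i desc len_down_less[OF y(1) desc] down_S_infty by (simp_all add: y'_def I_infty_def)
    have IH: "x_cyc (a, b) * inv_schubert y' = weighted_sum y' b" if "(a, b) \<in> Cyc y'" for a b
      by (rule less.hyps[OF y'(5,4) that])
    have cov_y: "inv_covers y' y" using inv_covers_up_self[OF y'(1,2)] y'(3) by simp
    define s where "s = sref i"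
    have LHS: "divdiff i (x_cyc (p, q) * inv_schubert y)
      = divdiff i (x_cyc (p, q)) * inv_schubert y + x_cyc (s \<langle>$\<rangle> p, s \<langle>$\<rangle> q) * inv_schubert y'"
      using divdiff_inv_schubert[OF y(1) i] desc by (simp add: divdiff_mult act_x_cyc s_def y'_def)
    \<comment> \<open>The cover \<open>y\<close> of \<open>y'\<close> is added to complete the sum for \<open>s\<^sub>i q\<close>, and subtracted again.\<close>
    have transfer: "divdiff i F = 0"
      if cyc: "(s \<langle>$\<rangle> p, s \<langle>$\<rangle> q) \<in> Cyc y'"
        and wt: "\<And>z. inv_covers y' z \<Longrightarrow> z \<noteq> y \<Longrightarrow> weight y (up i z) q = weight y' z (s \<langle>$\<rangle> q)"
    proof -
      let ?q = "s \<langle>$\<rangle> q"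
      define K where "K = moving_covers y' ?q - {y}"
      have "finite K" by (simp add: K_def)
      moreover have "K \<subseteq> {z. inv_covers y' z} - {y}" by (auto simp: K_def moving_covers_def)
      ultimately have K: "finite K" "K \<subseteq> {z. inv_covers y' z} - {y}" by blast+
      have "divdiff i (weighted_sum y q) = (\<Sum>z\<in>K. of_int (weight y (up i z) q) * inv_schubert z)"
        using K wt by (intro divdiff_weighted_sum_descent[OF y(1) i desc])
          (auto simp: y'_def K_def moving_covers_def weight_eq_0_iff)
      also have "\<dots> = (\<Sum>z\<in>K. of_int (weight y' z ?q) * inv_schubert z)"
        using K wt by (intro sum.cong) auto
      also have "\<dots> = weighted_sum y' ?q - of_int (weight y' y ?q) * inv_schubert y"
      proof -
        have "weighted_sum y' ?q = (\<Sum>z\<in>insert y K. of_int (weight y' z ?q) * inv_schubert z)"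
          using K(1) cov_y by (intro weighted_sum_eq) (simp, auto simp: K_def moving_covers_def)
        moreover have "y \<notin> K" using K(2) by blast
        ultimately show ?thesis using K(1) by simp
      qed
      also have "weighted_sum y' ?q = x_cyc (s \<langle>$\<rangle> p, ?q) * inv_schubert y'"
        using IH[OF cyc] by simp
      also have "of_int (weight y' y ?q) = divdiff i (x_cyc (s \<langle>$\<rangle> p, ?q))"
        using divdiff_x_cyc[OF y'(1) _ y'(2), of "s \<langle>$\<rangle> p" ?q] cyc y'(3) by (simp add: Cyc_iff)
      also have "\<dots> = - divdiff i (x_cyc (p, q))"
        unfolding s_def act_x_cyc[symmetric] by (rule divdiff_act_sref)
      finally show ?thesis by (simp add: F_def divdiff_diff LHS)
    qed
    show ?thesis
    proof (cases "y \<langle>$\<rangle> i = i + 1")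
      case False
      then have conj: "y' = sref i * y * sref i" using desc by (simp add: y'_def down_def)
      have yfix: "\<not> (y' \<langle>$\<rangle> i = i \<and> y' \<langle>$\<rangle> (i + 1) = i + 1)"
      proof
        assume "y' \<langle>$\<rangle> i = i \<and> y' \<langle>$\<rangle> (i + 1) = i + 1"
        then have "up i y' \<langle>$\<rangle> i = i + 1" using up_fixed[of y' i] by simp
        then show False using False y'(3) by simp
      qed
      have "\<not> (p = i \<and> q = i + 1)" using False pq by auto
      then have "s \<langle>$\<rangle> p \<le> s \<langle>$\<rangle> q"
        using pq(2) sref_less_iff[of p i q] unfolding s_def by (cases "p = q") auto
      moreover have "1 \<le> s \<langle>$\<rangle> p" using pq(1) i by (simp add: s_def apply_sref)
      moreover have "y' \<langle>$\<rangle> (s \<langle>$\<rangle> p) = s \<langle>$\<rangle> q" using pq(3) by (simp add: conj s_def)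
      ultimately have "(s \<langle>$\<rangle> p, s \<langle>$\<rangle> q) \<in> Cyc y'" by (simp add: Cyc_iff)
      moreover have "weight y (up i z) q = weight y' z (s \<langle>$\<rangle> q)" if "inv_covers y' z" "z \<noteq> y" for z
        using weight_up_conj[OF that(1) y'(2) _ yfix, of "s \<langle>$\<rangle> q"] that(2) y'(3) by (simp add: s_def)
      ultimately show ?thesis by (rule transfer)
    next
      case cycle: True
      then have y'_eq: "y' = y * sref i" using desc by (simp add: y'_def down_def)
      have "y \<langle>$\<rangle> (i + 1) = i" using I_Z_sym[OF y(1) cycle] .
      then have fixed: "y' \<langle>$\<rangle> i = i" "y' \<langle>$\<rangle> (i + 1) = i + 1" using cycle by (simp_all add: y'_eq)
      note wt = weight_up_fixed[OF _ _ fixed, unfolded y'(3)]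
      show ?thesis
      proof (cases "q \<in> {i, i + 1}")
        case False
        then have p: "p \<notin> {i, i + 1}" using pq(3) cycle \<open>y \<langle>$\<rangle> (i + 1) = i\<close> by auto
        have s: "s \<langle>$\<rangle> p = p" "s \<langle>$\<rangle> q = q" using False p by (simp_all add: s_def apply_sref)
        have "(s \<langle>$\<rangle> p, s \<langle>$\<rangle> q) \<in> Cyc y'"
          unfolding s using pq p by (simp add: Cyc_iff y'_eq apply_sref)
        moreover have "weight y (up i z) q = weight y' z (s \<langle>$\<rangle> q)" if "inv_covers y' z" "z \<noteq> y" for z
          unfolding s by (rule wt(1)[OF that False])
        ultimately show ?thesis by (rule transfer)
      next
        case True
        have "y \<langle>$\<rangle> q = p" by (rule I_Z_sym[OF y(1) pq(3)])
        then have pq_eq: "p = i" "q = i + 1"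
          using True pq(2) cycle \<open>y \<langle>$\<rangle> (i + 1) = i\<close> by auto
        \<comment> \<open>Now \<open>down i\<close> splits the cycle of \<open>q\<close>; the weights of \<open>y\<close> at \<open>i\<close> and \<open>i + 1\<close> cancel.\<close>
        define K where "K = moving_covers y' i \<union> moving_covers y' (i + 1) - {y}"
        have "finite K" by (simp add: K_def)
      moreover have "K \<subseteq> {z. inv_covers y' z} - {y}" by (auto simp: K_def moving_covers_def)
      ultimately have K: "finite K" "K \<subseteq> {z. inv_covers y' z} - {y}" by blast+
        have cyc: "(i, i) \<in> Cyc y'" "(i + 1, i + 1) \<in> Cyc y'" using fixed i by (simp_all add: Cyc_iff)
        have "divdiff i (weighted_sum y q) = (\<Sum>z\<in>K. of_int (weight y (up i z) q) * inv_schubert z)"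
        proof (rule divdiff_weighted_sum_descent[OF y(1) i desc K(1)])
          fix z assume z: "inv_covers (down i y) z" "z \<noteq> y" "z \<notin> K"
          then have "weight y' z i = 0" "weight y' z (i + 1) = 0"
            by (auto simp: K_def moving_covers_def weight_eq_0_iff y'_def)
          then show "weight y (up i z) q = 0" using wt(2)[of z] z by (simp add: pq_eq y'_def)
        qed (use K in \<open>simp add: y'_def\<close>)
        also have "\<dots> = (\<Sum>z\<in>K. of_int (weight y' z i) * inv_schubert z + of_int (weight y' z (i + 1)) * inv_schubert z)"
        proof (rule sum.cong)
          fix z assume "z \<in> K"
          then have "inv_covers y' z" "z \<noteq> y" using K(2) by blast+
          then show "of_int (weight y (up i z) q) * inv_schubert z
            = of_int (weight y' z i) * inv_schubert z + of_int (weight y' z (i + 1)) * inv_schubert z"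
            using wt(2) by (simp add: pq_eq distrib_right)
        qed simp
        also have "\<dots> = (\<Sum>z\<in>K. of_int (weight y' z i) * inv_schubert z)
            + (\<Sum>z\<in>K. of_int (weight y' z (i + 1)) * inv_schubert z)"
          by (rule sum.distrib)
        also have "\<dots> = (weighted_sum y' i - of_int (weight y' y i) * inv_schubert y)
            + (weighted_sum y' (i + 1) - of_int (weight y' y (i + 1)) * inv_schubert y)"
        proof -
          have "weighted_sum y' k = (\<Sum>z\<in>insert y K. of_int (weight y' z k) * inv_schubert z)"
            if "k \<in> {i, i + 1}" for k
            using K(1) cov_y that by (intro weighted_sum_eq) (simp, auto simp: K_def moving_covers_def)
          moreover have "y \<notin> K" using K(2) by blast
          ultimately show ?thesis using K(1) by simp
        qed
        also have "weight y' y i = 1"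
          using weight_up[OF y'(1,2), of i] fixed y'(3) by simp
        also have "weight y' y (i + 1) = - 1"
          using weight_up[OF y'(1,2), of "i + 1"] fixed y'(3) by simp
        also have "weighted_sum y' i = xvar i * inv_schubert y'"
          using IH[OF cyc(1)] by (simp add: x_cyc_def)
        also have "weighted_sum y' (i + 1) = xvar (i + 1) * inv_schubert y'"
          using IH[OF cyc(2)] by (simp add: x_cyc_def)
        finally have RHS: "divdiff i (weighted_sum y q) = (xvar i + xvar (i + 1)) * inv_schubert y'"
          by (simp add: algebra_simps)
        have "divdiff i (x_cyc (p, q)) = 0"
          by (simp add: x_cyc_def pq_eq divdiff_add divdiff_xvar)
        moreover have "x_cyc (s \<langle>$\<rangle> p, s \<langle>$\<rangle> q) = xvar i + xvar (i + 1)"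
          by (simp add: pq_eq s_def x_cyc_def)
        ultimately show ?thesis by (simp add: F_def divdiff_diff LHS RHS)
      qed
    qed
  qed
  have pos: "positive_terms F"
  proof -
    have "positive_terms (x_cyc (p, q) * inv_schubert y)"
      using positive_terms_xvar_mult_inv_schubert[OF _ less.prems(1)] pq
      by (auto simp: x_cyc_def distrib_right intro!: positive_terms_add)
    moreover have "positive_terms (weighted_sum y q)"
      unfolding weighted_sum_def
    proof (intro positive_terms_sum positive_terms_of_int_mult positive_terms_inv_schubert)
      fix z assume "z \<in> moving_covers y q"
      then have c: "inv_covers y z" by (simp add: moving_covers_def)
      show "z \<in> I_Z" by (rule inv_coversD(2)[OF c])
      show "z \<noteq> 1"
        using inv_coversD(3,4)[OF c] bruhat_less_imp_len_less[of y z] by (auto simp: bruhat_less_iff)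
    qed
    then have "positive_terms (of_int (- 1) * weighted_sum y q)" by (rule positive_terms_of_int_mult)
    ultimately have "positive_terms (x_cyc (p, q) * inv_schubert y + of_int (- 1) * weighted_sum y q)"
      by (rule positive_terms_add)
    then show ?thesis by (simp add: F_def)
  qed
  have "F = 0"
  proof (rule eq_0_if_divdiff_0)
    show "Poly_Mapping.keys m \<subseteq> {1..}" if "m \<in> Poly_Mapping.keys F" for m
      using pos that unfolding positive_terms_def by blast
    have "0 \<notin> Poly_Mapping.keys F" using pos unfolding positive_terms_def by blast
    then show "Poly_Mapping.lookup F 0 = 0" by (simp add: in_keys_iff)
  qed (rule killed)
  then show ?case by (simp add: F_def)
qed

text \<open>This reconciles the two endpoints: \<^const>\<open>Phi_plus\<close> is taken at \<open>q\<close> and \<^const>\<open>Phi_minus\<close> at \<open>p\<close>,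
  while the signed sum refers to \<open>q\<close> only.\<close>

lemma weight_apply:
  assumes "inv_covers y z"
  shows "weight y z (y \<langle>$\<rangle> k) = weight y z k"
proof -
  have I: "y \<in> I_Z" "z \<in> I_Z" using inv_coversD[OF assms] by auto
  obtain P N where r: "raises y z P N" using inv_covers_raises[OF assms] by blast
  note w = raises_weight[OF I r]
  have closed: "y \<langle>$\<rangle> k \<in> P" if "k \<in> P" for k
  proof -
    have "y \<langle>$\<rangle> k \<in> {k, y \<langle>$\<rangle> k}" by blast
    also have "{k, y \<langle>$\<rangle> k} = P" by (rule w(3)[OF that, symmetric])
    finally show ?thesis .
  qed
  have closed': "y \<langle>$\<rangle> k \<in> N" if "k \<in> N" for k
  proof -
    have "y \<langle>$\<rangle> k \<in> {k, y \<langle>$\<rangle> k}" by blast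
    also have "{k, y \<langle>$\<rangle> k} = N" by (rule w(4)[OF that, symmetric])
    finally show ?thesis .
  qed
  have "y \<langle>$\<rangle> k \<in> P \<longleftrightarrow> k \<in> P" "y \<langle>$\<rangle> k \<in> N \<longleftrightarrow> k \<in> N"
    using closed[of k] closed[of "y \<langle>$\<rangle> k"] closed'[of k] closed'[of "y \<langle>$\<rangle> k"]
    unfolding I_Z_apply[OF I(1)] by blast+
  then show ?thesis unfolding w(1) by simp
qed

theorem theorem1p5:
  fixes y :: "int perm" and p q :: int
  assumes "y \<in> I_infty" and "(p, q) \<in> Cyc y"
  shows "x_cyc (p, q) * inv_schubert y =
    (\<Sum>z\<in>Phi_plus y q. inv_schubert z) - (\<Sum>z\<in>Phi_minus y p. inv_schubert z)"
proof -
  have y: "y \<in> I_Z" using assms(1) by (simp add: I_infty_def)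
  have pq: "p \<le> q" "y \<langle>$\<rangle> p = q" using assms(2) by (simp_all add: Cyc_iff)
  have yq: "y \<langle>$\<rangle> q = p" by (rule I_Z_sym[OF y pq(2)])
  have "Phi_plus y q = {z. inv_covers y z \<and> y \<langle>$\<rangle> q < z \<langle>$\<rangle> q}"
    by (rule Phi_plus_eq[OF y]) (simp only: yq pq(1))
  then have plus: "Phi_plus y q = {z. inv_covers y z \<and> weight y z q = 1}"
    by (simp only: weight_def sgn_1_pos diff_gt_0_iff_gt)
  have "Phi_minus y p = {z. inv_covers y z \<and> z \<langle>$\<rangle> p < y \<langle>$\<rangle> p}"
    by (rule Phi_minus_eq[OF y]) (simp only: pq)
  then have minus_p: "Phi_minus y p = {z. inv_covers y z \<and> weight y z p = - 1}"
    by (simp only: weight_def sgn_1_neg diff_less_0_iff_less)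
  have weight_pq: "weight y z q = weight y z p" if "inv_covers y z" for z
    using weight_apply[OF that, of p] unfolding pq(2) .
  have minus: "Phi_minus y p = {z. inv_covers y z \<and> weight y z q = - 1}"
    unfolding minus_p by (rule Collect_cong) (auto simp: weight_pq)
  have split: "moving_covers y q = Phi_plus y q \<union> Phi_minus y p"
    unfolding plus minus by (auto simp: moving_covers_def weight_def sgn_if)
  then have fin: "finite (Phi_plus y q)" "finite (Phi_minus y p)"
    using finite_moving_covers[of y q] by simp_all
  have "x_cyc (p, q) * inv_schubert y = weighted_sum y q"
    by (rule x_cyc_mult_inv_schubert[OF assms])
  also have "\<dots> = (\<Sum>z\<in>Phi_plus y q. of_int (weight y z q) * inv_schubert z)
      + (\<Sum>z\<in>Phi_minus y p. of_int (weight y z q) * inv_schubert z)"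
    unfolding weighted_sum_def split using fin by (intro sum.union_disjoint) (auto simp: plus minus)
  also have "(\<Sum>z\<in>Phi_plus y q. of_int (weight y z q) * inv_schubert z) = (\<Sum>z\<in>Phi_plus y q. inv_schubert z)"
    by (rule sum.cong) (simp_all add: plus)
  also have "(\<Sum>z\<in>Phi_minus y p. of_int (weight y z q) * inv_schubert z) = - (\<Sum>z\<in>Phi_minus y p. inv_schubert z)"
    unfolding sum_negf[symmetric] by (rule sum.cong) (simp_all add: minus)
  finally show ?thesis by simp
qed

end
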